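(* (The Gauss Lemma) Let $M$ be a smooth manifold, let $g=\langle\cdot,\cdot\rangle$ be a $C^{1,1}$-pseudo-Riemannian metric on $M$, and let $p\in M$. Then $p$ possesses a basis of normal neighbourhoods $U$ with the following properties: $\exp_p:\tilde U\to U$ is a bi-Lipschitz homeomorphism, where $\tilde U$ is an open star-shaped neighbourhood of $0$ in $T_pM$. Moreover, for almost all $x\in\tilde U$, if $v_x,w_x\in T_x(T_pM)$ and $v_x$ is radial, then $$\langle T_x\exp_p(v_x),T_x\exp_p(w_x)\rangle=\langle v_x,w_x\rangle.$$
   Context: $C^{1,1}$ means continuously differentiable with locally Lipschitz first order derivatives. $\exp_p$ is the exponential map of $g$ at $p$ (the geodesic equation is uniquely solvable for $C^{1,1}$-metrics). A neighbourhood $U$ of $p$ is called normal if $\exp_p:\tilde U\to U$ is a bi-Lipschitz homeomorphism for some open $\tilde U\ni 0$ in $T_pM$ star-shaped around $0$. Since $\exp_p$ is Lipschitz on $\tilde U$, it is differentiable at almost every $x\in\tilde U$ (Rademacher), with differential $T_x\exp_p: T_x(T_pM)\to T_{\exp_p(x)}M$. On the right hand side, $T_x(T_pM)$ is identified with $T_pM$ and $\langle v_x,w_x\rangle=g_p(v_x,w_x)$; on the left hand side $\langle\cdot,\cdot\rangle=g_{\exp_p(x)}$. A vector $v_x\in T_x(T_pM)\cong T_pM$ is radial if it is a scalar multiple of $x$. *)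

theory Defs
  imports "HOL-Analysis.Analysis"
begin

section \<open>Smooth manifolds\<close>

fun Ck_on :: "nat \<Rightarrow> ('a::real_normed_vector) set \<Rightarrow> ('a \<Rightarrow> 'b::real_normed_vector) \<Rightarrow> bool" where
  "Ck_on 0 S f \<longleftrightarrow> continuous_on S f"
| "Ck_on (Suc k) S f \<longleftrightarrow> (\<forall>x\<in>S. f differentiable (at x)) \<and>
     (\<forall>v. Ck_on k S (\<lambda>x. frechet_derivative f (at x) v))"

text \<open>Meant for open \<open>S\<close>, as derivatives are taken at \<^term>\<open>at x\<close>.\<close>

definition smooth_on :: "('a::real_normed_vector) set \<Rightarrow> ('a \<Rightarrow> 'b::real_normed_vector) \<Rightarrow> bool" where
  "smooth_on S f \<longleftrightarrow> (\<forall>k. Ck_on k S f)"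

text \<open>
  A manifold is an entire type of class \<^class>\<open>t2_space\<close> and
  \<^class>\<open>second_countable_topology\<close> with a smooth atlas \<open>A\<close>. The atlas need not be maximal.
  A chart consists of its domain and its map, whose values off the domain are irrelevant.
\<close>

datatype ('m, 'e) chart = Chart (cdom: "'m set") (cmap: "'m \<Rightarrow> 'e")

abbreviation cran :: "('m, 'e) chart \<Rightarrow> 'e set" where
  "cran c \<equiv> cmap c ` cdom c"

definition cinv :: "('m, 'e) chart \<Rightarrow> 'e \<Rightarrow> 'm" where
  "cinv c = inv_into (cdom c) (cmap c)"

definition is_chart :: "('m::topological_space, 'e::topological_space) chart \<Rightarrow> bool" where
  "is_chart c \<longleftrightarrow> open (cdom c) \<and> open (cran c) \<and>
     homeomorphism (cdom c) (cran c) (cmap c) (cinv c)"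

definition transition :: "('m, 'e) chart \<Rightarrow> ('m, 'e) chart \<Rightarrow> 'e \<Rightarrow> 'e" where
  "transition c d = cmap d \<circ> cinv c"

definition smooth_atlas :: "('m::topological_space, 'e::real_normed_vector) chart set \<Rightarrow> bool" where
  "smooth_atlas A \<longleftrightarrow> (\<forall>c\<in>A. is_chart c) \<and> (\<Union>c\<in>A. cdom c) = UNIV \<and>
     (\<forall>c\<in>A. \<forall>d\<in>A. smooth_on (cmap c ` (cdom c \<inter> cdom d)) (transition c d))"

definition charts_at :: "('m, 'e) chart set \<Rightarrow> 'm \<Rightarrow> ('m, 'e) chart set" where
  "charts_at A p = {c\<in>A. p \<in> cdom c}"


section \<open>Tangent vectors\<close>

text \<open>
  A tangent vector \<open>v\<close> at \<open>p\<close> is a family of coordinate vectors \<open>v c\<close>, indexed by the charts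
  \<open>c\<close> around \<open>p\<close> (and \<open>0\<close> at all other \<open>c\<close>), that transforms under a change of charts by the
  derivative of the transition map. The vector space operations are pointwise.
\<close>

type_synonym ('m, 'e) tvec = "('m, 'e) chart \<Rightarrow> 'e"

definition tangent_space ::
    "('m, 'e::real_normed_vector) chart set \<Rightarrow> 'm \<Rightarrow> ('m, 'e) tvec set" where
  "tangent_space A p = {v.
     (\<forall>c\<in>charts_at A p. \<forall>d\<in>charts_at A p.
        v d = frechet_derivative (transition c d) (at (cmap c p)) (v c)) \<and>
     (\<forall>c. c \<notin> charts_at A p \<longrightarrow> v c = 0)}"

definition tzero :: "('m, 'e::real_vector) tvec" where
  "tzero = (\<lambda>c. 0)"

definition tadd :: "('m, 'e::real_vector) tvec \<Rightarrow> ('m, 'e) tvec \<Rightarrow> ('m, 'e) tvec" where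
  "tadd v w = (\<lambda>c. v c + w c)"

definition tscale :: "real \<Rightarrow> ('m, 'e::real_vector) tvec \<Rightarrow> ('m, 'e) tvec" where
  "tscale a v = (\<lambda>c. a *\<^sub>R v c)"

definition coords :: "('m, 'e) chart \<Rightarrow> ('m, 'e) tvec \<Rightarrow> 'e" where
  "coords c v = v c"

text \<open>For \<open>c\<close> around \<open>p\<close>, the inverse of \<^term>\<open>coords c\<close> on the tangent space at \<open>p\<close>:\<close>

definition of_coords ::
    "('m, 'e::real_normed_vector) chart set \<Rightarrow> ('m, 'e) chart \<Rightarrow> 'm \<Rightarrow> 'e \<Rightarrow> ('m, 'e) tvec" where
  "of_coords A c p u = (\<lambda>d. if d \<in> charts_at A p
     then frechet_derivative (transition c d) (at (cmap c p)) u else 0)"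

text \<open>
  Openness and null sets in the tangent space are those of the model space. They do not depend
  on the chart, since coordinate changes of the tangent space are linear isomorphisms.
\<close>

definition topen ::
    "('m, 'e::real_normed_vector) chart set \<Rightarrow> 'm \<Rightarrow> ('m, 'e) tvec set \<Rightarrow> bool" where
  "topen A p S \<longleftrightarrow> S \<subseteq> tangent_space A p \<and> (\<forall>b\<in>charts_at A p. open (coords b ` S))"

definition talmost_all ::
    "('m, 'e::euclidean_space) chart set \<Rightarrow> 'm \<Rightarrow> ('m, 'e) tvec set \<Rightarrow> (('m, 'e) tvec \<Rightarrow> bool) \<Rightarrow> bool"
  where
  "talmost_all A p S P \<longleftrightarrow> (\<forall>b\<in>charts_at A p. negligible (coords b ` {x\<in>S. \<not> P x}))"

definition star_shaped_0 :: "('m, 'e::real_vector) tvec set \<Rightarrow> bool" where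
  "star_shaped_0 S \<longleftrightarrow> tzero \<in> S \<and> (\<forall>v\<in>S. \<forall>t\<in>{0..1}. tscale t v \<in> S)"

definition velocity ::
    "('m, 'e::real_normed_vector) chart set \<Rightarrow> (real \<Rightarrow> 'm) \<Rightarrow> real \<Rightarrow> ('m, 'e) tvec" where
  "velocity A \<gamma> t = (\<lambda>c. if c \<in> charts_at A (\<gamma> t)
     then vector_derivative (cmap c \<circ> \<gamma>) (at t) else 0)"


section \<open>Metrics of class C(1,1)\<close>

type_synonym ('m, 'e) metric_field = "'m \<Rightarrow> ('m, 'e) tvec \<Rightarrow> ('m, 'e) tvec \<Rightarrow> real"

definition metric_matrix ::
    "('m, real^'n) chart set \<Rightarrow> ('m, real^'n) metric_field \<Rightarrow> ('m, real^'n) chart \<Rightarrow>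
     real^'n \<Rightarrow> real^'n^'n" where
  "metric_matrix A g c x = (\<chi> i j. g (cinv c x)
     (of_coords A c (cinv c x) (axis i 1)) (of_coords A c (cinv c x) (axis j 1)))"

definition partial :: "'n \<Rightarrow> (real^'n \<Rightarrow> real) \<Rightarrow> real^'n \<Rightarrow> real" where
  "partial i f x = frechet_derivative f (at x) (axis i 1)"

definition locally_lipschitz_on ::
    "('a::metric_space) set \<Rightarrow> ('a \<Rightarrow> 'b::metric_space) \<Rightarrow> bool" where
  "locally_lipschitz_on S f \<longleftrightarrow> (\<forall>x\<in>S. \<exists>e>0. \<exists>L. L-lipschitz_on (ball x e \<inter> S) f)"

definition C11_on :: "(real^'n) set \<Rightarrow> (real^'n \<Rightarrow> real) \<Rightarrow> bool" where
  "C11_on S f \<longleftrightarrow> (\<forall>x\<in>S. f differentiable (at x)) \<and>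
     (\<forall>i. continuous_on S (partial i f) \<and> locally_lipschitz_on S (partial i f))"

text \<open>
  The index: the largest dimension of a subspace on which the form at \<open>p\<close> is negative definite,
  with subspaces of the tangent space given by their coordinates in a chart \<open>c\<close> around \<open>p\<close>.
\<close>

definition metric_index ::
    "('m, real^'n) chart set \<Rightarrow> ('m, real^'n) metric_field \<Rightarrow> ('m, real^'n) chart \<Rightarrow> 'm \<Rightarrow> nat" where
  "metric_index A g c p = Max {dim W | W. subspace W \<and>
     (\<forall>u\<in>W - {0}. g p (of_coords A c p u) (of_coords A c p u) < 0)}"

text \<open>
  A pseudo-Riemannian metric is a field of symmetric nondegenerate bilinear forms of constant
  index. The values of \<open>g p\<close> off the tangent space at \<open>p\<close> are irrelevant.
\<close>

definition C11_pseudo_riemannian_metric ::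
    "('m, real^'n) chart set \<Rightarrow> ('m, real^'n) metric_field \<Rightarrow> bool" where
  "C11_pseudo_riemannian_metric A g \<longleftrightarrow>
     (\<forall>p. \<forall>u\<in>tangent_space A p. \<forall>v\<in>tangent_space A p. \<forall>w\<in>tangent_space A p. \<forall>a.
        g p v w = g p w v \<and>
        g p (tadd (tscale a u) v) w = a * g p u w + g p v w) \<and>
     (\<forall>p. \<forall>v\<in>tangent_space A p. (\<forall>w\<in>tangent_space A p. g p v w = 0) \<longrightarrow> v = tzero) \<and>
     (\<exists>\<nu>. \<forall>p. \<forall>c\<in>charts_at A p. metric_index A g c p = \<nu>) \<and>
     (\<forall>c\<in>A. \<forall>i j. C11_on (cran c) (\<lambda>x. metric_matrix A g c x $ i $ j))"


section \<open>Geodesics and the exponential map\<close>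

text \<open>The Christoffel symbol of the second kind, with upper index \<open>k\<close>, in the chart \<open>c\<close>:\<close>

definition christoffel ::
    "('m, real^'n) chart set \<Rightarrow> ('m, real^'n) metric_field \<Rightarrow> ('m, real^'n) chart \<Rightarrow>
     'n \<Rightarrow> 'n \<Rightarrow> 'n \<Rightarrow> real^'n \<Rightarrow> real" where
  "christoffel A g c k i j x = 1/2 * (\<Sum>l\<in>UNIV. matrix_inv (metric_matrix A g c x) $ k $ l *
     (partial i (\<lambda>y. metric_matrix A g c y $ j $ l) x
    + partial j (\<lambda>y. metric_matrix A g c y $ i $ l) x
    - partial l (\<lambda>y. metric_matrix A g c y $ i $ j) x))"

text \<open>To be used on open \<open>I\<close> only, as the derivatives are two-sided.\<close>

definition geodesic_on ::
    "('m::topological_space, real^'n) chart set \<Rightarrow> ('m, real^'n) metric_field \<Rightarrow>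
     real set \<Rightarrow> (real \<Rightarrow> 'm) \<Rightarrow> bool" where
  "geodesic_on A g I \<gamma> \<longleftrightarrow> continuous_on I \<gamma> \<and>
     (\<forall>t\<in>I. \<forall>c\<in>charts_at A (\<gamma> t).
        let x = cmap c \<circ> \<gamma>; x' = (\<lambda>s. vector_derivative x (at s)) in
        (x has_vector_derivative x' t) (at t) \<and>
        (x' has_vector_derivative
          (\<chi> k. - (\<Sum>i\<in>UNIV. \<Sum>j\<in>UNIV. christoffel A g c k i j (x t) * x' t $ i * x' t $ j)))
          (at t))"

text \<open>\<open>q = \<gamma> 1\<close> for a geodesic \<open>\<gamma>\<close> defined on \<open>{0..1}\<close> with initial position \<open>p\<close> and velocity \<open>v\<close>:\<close>

definition exp_rel ::
    "('m::topological_space, real^'n) chart set \<Rightarrow> ('m, real^'n) metric_field \<Rightarrow>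
     'm \<Rightarrow> ('m, real^'n) tvec \<Rightarrow> 'm \<Rightarrow> bool" where
  "exp_rel A g p v q \<longleftrightarrow> (\<exists>I \<gamma>. open I \<and> is_interval I \<and> {0..1} \<subseteq> I \<and> geodesic_on A g I \<gamma> \<and>
     \<gamma> 0 = p \<and> velocity A \<gamma> 0 = v \<and> \<gamma> 1 = q)"

definition exp_dom ::
    "('m::topological_space, real^'n) chart set \<Rightarrow> ('m, real^'n) metric_field \<Rightarrow>
     'm \<Rightarrow> ('m, real^'n) tvec set" where
  "exp_dom A g p = {v \<in> tangent_space A p. \<exists>q. exp_rel A g p v q}"

definition exp_map ::
    "('m::topological_space, real^'n) chart set \<Rightarrow> ('m, real^'n) metric_field \<Rightarrow>
     'm \<Rightarrow> ('m, real^'n) tvec \<Rightarrow> 'm" where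
  "exp_map A g p v = (THE q. exp_rel A g p v q)"


section \<open>Maps from a tangent space to the manifold\<close>

text \<open>
  The bi-Lipschitz property is measured by norms in charts, of the domain in any chart \<open>b\<close> around
  \<open>p\<close> and of the target in a chart \<open>c\<close> whose domain contains \<open>U\<close>. Requiring \<open>U\<close> to be relatively
  compact in that domain makes this independent of \<open>c\<close> and equivalent to the
  bi-Lipschitz property for the distance of any background Riemannian metric.
\<close>

definition bi_lipschitz_homeomorphism ::
    "('m::topological_space, 'e::real_normed_vector) chart set \<Rightarrow> 'm \<Rightarrow>
     ('m, 'e) tvec set \<Rightarrow> 'm set \<Rightarrow> (('m, 'e) tvec \<Rightarrow> 'm) \<Rightarrow> bool" where
  "bi_lipschitz_homeomorphism A p S U f \<longleftrightarrow>
     (\<exists>b\<in>charts_at A p. \<exists>c\<in>A. \<exists>K h L.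
        compact K \<and> U \<subseteq> K \<and> K \<subseteq> cdom c \<and>
        homeomorphism (coords b ` S) U (f \<circ> of_coords A b p) h \<and>
        L-lipschitz_on (coords b ` S) (cmap c \<circ> (f \<circ> of_coords A b p)) \<and>
        L-lipschitz_on (cmap c ` U) (h \<circ> cinv c))"

definition normal_neighbourhood ::
    "('m::topological_space, real^'n) chart set \<Rightarrow> ('m, real^'n) metric_field \<Rightarrow>
     'm \<Rightarrow> ('m, real^'n) tvec set \<Rightarrow> 'm set \<Rightarrow> bool" where
  "normal_neighbourhood A g p S U \<longleftrightarrow>
     open U \<and> p \<in> U \<and> topen A p S \<and> star_shaped_0 S \<and> S \<subseteq> exp_dom A g p \<and>
     bi_lipschitz_homeomorphism A p S U (exp_map A g p)"

text \<open>
  \<open>f\<close> is differentiable at \<open>x\<close>, with differential \<open>D\<close> from the tangent space at \<open>p\<close> (identified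
  with its own tangent space at \<open>x\<close>) to the tangent space at \<open>f x\<close>.
\<close>

definition has_differential ::
    "('m, 'e::real_normed_vector) chart set \<Rightarrow> 'm \<Rightarrow> (('m, 'e) tvec \<Rightarrow> 'm) \<Rightarrow>
     (('m, 'e) tvec \<Rightarrow> ('m, 'e) tvec) \<Rightarrow> ('m, 'e) tvec \<Rightarrow> bool" where
  "has_differential A p f D x \<longleftrightarrow>
     (\<forall>v\<in>tangent_space A p. D v \<in> tangent_space A (f x)) \<and>
     (\<forall>b\<in>charts_at A p. \<forall>c\<in>charts_at A (f x).
        ((cmap c \<circ> f \<circ> of_coords A b p) has_derivative (coords c \<circ> D \<circ> of_coords A b p))
          (at (coords b x)))"

definition radial :: "('m, 'e::real_vector) tvec \<Rightarrow> ('m, 'e) tvec \<Rightarrow> bool" where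
  "radial x v \<longleftrightarrow> (\<exists>a. v = tscale a x)"

end

theory Submission
  imports Defs
begin

text \<open>
  In a chart, the geodesic equation is a second order equation whose right hand side is locally
  Lipschitz in the position and quadratic in the velocity. For small initial velocities \<open>v\<close> a
  contraction argument gives solutions \<open>X v\<close> on \<open>{-1..2}\<close> for which \<open>E v = X v 1\<close> satisfies
  \<open>norm (E v - E w - (v - w)) \<le> norm (v - w) / 2\<close>, so that \<open>E\<close> is bi-Lipschitz with open image.
  Rademacher's theorem gives the differentiability of \<open>E\<close> almost everywhere.

  The Gauss lemma then holds at every point of differentiability, without interchanging derivatives
  or approximating the metric: the geodesics \<open>X v\<close> and \<open>X w\<close> have constant Lagrangian, and by the
  first variation of the energy the momentum of \<open>X v\<close> at time \<open>1\<close> paired with \<open>E w - E v\<close> equals the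
  inner product of \<open>v\<close> and \<open>w - v\<close> up to an error of order \<open>(norm (w - v))\<^sup>2\<close>.
\<close>

section \<open>Differentiability of Lipschitz functions almost everywhere\<close>

text \<open>The classical proof differentiates the variation sending \<open>s\<close> and
  \<open>t\<close> to \<open>exp (t (v + s w))\<close> in both variables and exchanges the
  derivatives. For a C(1,1) metric the exponential map is only Lipschitz, and differentiability at
  \<open>v\<close> says nothing about the rest of the ray. Hence the comparison of two geodesics by
  finite differences. The error is quadratic because of the Taylor estimate for a metric with
  Lipschitz first derivatives (last clause of \<open>controlled\<close>) and the Lipschitz
  dependence of \<open>X\<close> and \<open>U\<close> on the initial velocity; passing to the limit
  then needs differentiability at the single point \<open>v\<close> only. The radial derivative of
  \<open>E\<close> is the end velocity of the geodesic because \<open>X (s v) 1 = X v s\<close>,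
  which rests on the uniqueness of geodesics. Uniqueness is proved on the manifold, since
  \<open>exp_map\<close> is a definite description over all geodesics and these may leave a given
  chart. As \<open>geodesic_on\<close> demands the equation in every chart, solutions found in one
  chart have to be transported to the others.\<close>

lemma emeasure_image_le_slope:
  fixes f :: "real \<Rightarrow> real"
  assumes mono: "strict_mono f" and lip: "L-lipschitz_on UNIV f"
    and E: "E \<in> sets lebesgue" "f ` E \<in> sets lebesgue" and a: "0 < a"
    and slope: "\<And>x d. x \<in> E \<Longrightarrow> 0 < d \<Longrightarrow>
      \<exists>p q. p < q \<and> x \<in> {p..q} \<and> q - p < d \<and> f q - f p \<le> a * (q - p)"
  shows "emeasure lebesgue (f ` E) \<le> ennreal a * emeasure lebesgue E"
proof (rule ennreal_le_epsilon)
  fix e :: real assume e: "0 < e"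
  \<comment> \<open>The excess \<open>e / a\<close> of the open set becomes \<open>e\<close> after
    multiplication by the slope bound \<open>a\<close>.\<close>
  obtain T where T: "open T" "E \<subseteq> T" "T - E \<in> lmeasurable" "emeasure lebesgue (T - E) < ennreal (e / a)"
    using sets_lebesgue_outer_open[OF E(1), of "e / a"] e a by auto
  \<comment> \<open>\<open>K\<close> is a Vitali cover of \<open>E\<close>. Disjoint intervals have
    disjoint images under the injective \<open>f\<close>, so the lengths of the images add up to at
    most \<open>a\<close> times the measure of \<open>T\<close>. The part \<open>N\<close> of
    \<open>E\<close> missed by a disjoint subfamily is null, and so is its Lipschitz image.\<close>
  define K where "K = {(p, q). p < q \<and> {p..q} \<subseteq> T \<and> f q - f p \<le> a * (q - p)}"
  define c r where "c = (\<lambda>(p::real, q). (p + q) / 2)" and "r = (\<lambda>(p::real, q). (q - p) / 2)"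
  have cb: "cball (c i) (r i) = {fst i..snd i}" for i
    by (auto simp: c_def r_def cball_eq_atLeastAtMost field_simps split: prod.splits)
  obtain C where C: "countable C" "C \<subseteq> K"
    "pairwise (\<lambda>i j. disjnt (cball (c i) (r i)) (cball (c j) (r j))) C"
    "negligible (E - (\<Union>i\<in>C. cball (c i) (r i)))"
  proof (rule Vitali_covering_theorem_cballs[of K r E c])
    show "0 < r i" if "i \<in> K" for i
      using that by (auto simp: K_def r_def)
    show "\<exists>i. i \<in> K \<and> x \<in> cball (c i) (r i) \<and> r i < d" if x: "x \<in> E" and d: "0 < d" for x d
    proof -
      obtain \<epsilon> where \<epsilon>: "0 < \<epsilon>" "ball x \<epsilon> \<subseteq> T"
        using T x by (meson openE subsetD)
      obtain p q where pq: "p < q" "x \<in> {p..q}" "q - p < min d \<epsilon>" "f q - f p \<le> a * (q - p)"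
        using slope[OF x, of "min d \<epsilon>"] d \<epsilon> by auto
      have "{p..q} \<subseteq> ball x \<epsilon>" using pq by (auto simp: dist_real_def)
      then have "(p, q) \<in> K" using pq \<epsilon> by (auto simp: K_def)
      moreover have "x \<in> cball (c (p, q)) (r (p, q))" using pq unfolding cb by simp
      moreover have "r (p, q) < d" using pq by (auto simp: r_def)
      ultimately show ?thesis by blast
    qed
  qed blast
  define N where "N = E - (\<Union>i\<in>C. cball (c i) (r i))"
  have Cle: "fst i < snd i" "{fst i..snd i} \<subseteq> T" "f (snd i) - f (fst i) \<le> a * (snd i - fst i)" if "i \<in> C" for i
    using that C(2) unfolding K_def by (cases i; force)+
  have disj: "disjoint_family_on (\<lambda>i. {fst i..snd i}) C"
    using C(3) by (auto simp: disjoint_family_on_def pairwise_def disjnt_def cb)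
  have inj: "inj f" using mono by (rule strict_mono_imp_inj_on)
  have contf: "continuous_on UNIV f" by (rule lipschitz_on_continuous_on[OF lip])
  have fI: "f ` {fst i..snd i} = {f (fst i)..f (snd i)}" if i: "i \<in> C" for i
  proof (rule antisym)
    show "f ` {fst i..snd i} \<subseteq> {f (fst i)..f (snd i)}"
      using strict_mono_less_eq[OF mono] by auto
    show "{f (fst i)..f (snd i)} \<subseteq> f ` {fst i..snd i}"
    proof
      fix y assume "y \<in> {f (fst i)..f (snd i)}"
      then obtain x where "fst i \<le> x" "x \<le> snd i" "f x = y"
        using IVT'[of f "fst i" y "snd i"] Cle(1)[OF i] continuous_on_subset[OF contf] by auto
      then show "y \<in> f ` {fst i..snd i}" by auto
    qed
  qed
  have disj': "disjoint_family_on (\<lambda>i. f ` {fst i..snd i}) C"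
    using disj inj unfolding disjoint_family_on_def
    by (metis image_Int image_empty)
  have Nneg: "negligible N" using C(4) by (simp add: N_def)
  have "negligible (f ` N)"
  proof (rule negligible_locally_Lipschitz_image)
    show "negligible N" by fact
    fix x assume "x \<in> N"
    show "\<exists>T B. open T \<and> x \<in> T \<and> (\<forall>y \<in> N \<inter> T. norm (f y - f x) \<le> B * norm (y - x))"
      using lipschitz_on_normD[OF lip] by (intro exI[of _ UNIV] exI[of _ L]) auto
  qed simp
  then have fN: "f ` N \<in> null_sets lebesgue" by (simp add: negligible_iff_null_sets)
  have "f ` E \<subseteq> f ` N \<union> (\<Union>i\<in>C. f ` {fst i..snd i})"
    unfolding N_def cb by auto
  then have "emeasure lebesgue (f ` E) \<le> emeasure lebesgue (f ` N \<union> (\<Union>i\<in>C. f ` {fst i..snd i}))"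
    using fN C(1) fI by (intro emeasure_mono) (auto intro!: sets.Un sets.countable_UN'')
  also have "\<dots> \<le> emeasure lebesgue (f ` N) + emeasure lebesgue (\<Union>i\<in>C. f ` {fst i..snd i})"
    using fN C(1) fI by (intro emeasure_subadditive) (auto intro!: sets.countable_UN'')
  also have "\<dots> = emeasure lebesgue (\<Union>i\<in>C. f ` {fst i..snd i})"
    using fN by auto
  also have "\<dots> = (\<integral>\<^sup>+i. emeasure lebesgue (f ` {fst i..snd i}) \<partial>count_space C)"
    using C(1) fI disj' by (intro emeasure_UN_countable) auto
  also have "\<dots> \<le> (\<integral>\<^sup>+i. ennreal a * emeasure lebesgue {fst i..snd i} \<partial>count_space C)"
  proof (rule nn_integral_mono)
    fix i assume "i \<in> space (count_space C)"
    then have i: "i \<in> C" by simp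
    have "f (fst i) \<le> f (snd i)" using Cle(1)[OF i] strict_mono_less_eq[OF mono] by auto
    then show "emeasure lebesgue (f ` {fst i..snd i}) \<le> ennreal a * emeasure lebesgue {fst i..snd i}"
      using Cle[OF i] fI[OF i] a
      by (auto simp: ennreal_mult[symmetric] intro!: ennreal_leI)
  qed
  also have "\<dots> = ennreal a * (\<integral>\<^sup>+i. emeasure lebesgue {fst i..snd i} \<partial>count_space C)"
    by (rule nn_integral_cmult) auto
  also have "(\<integral>\<^sup>+i. emeasure lebesgue {fst i..snd i} \<partial>count_space C) = emeasure lebesgue (\<Union>i\<in>C. {fst i..snd i})"
    using C(1) disj by (intro emeasure_UN_countable[symmetric]) auto
  also have "\<dots> \<le> emeasure lebesgue T"
    using Cle(2) T(1) by (intro emeasure_mono) auto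
  also have "emeasure lebesgue T = emeasure lebesgue E + emeasure lebesgue (T - E)"
    using T E(1) by (metis Diff_disjoint Un_Diff_cancel Un_absorb1 fmeasurableD plus_emeasure)
  also have "ennreal a * \<dots> \<le> ennreal a * (emeasure lebesgue E + ennreal (e / a))"
    using T(4) by (intro mult_left_mono add_left_mono) auto
  also have "\<dots> = ennreal a * emeasure lebesgue E + ennreal e"
    using a e by (simp add: distrib_left ennreal_mult[symmetric])
  finally show "emeasure lebesgue (f ` E) \<le> ennreal a * emeasure lebesgue E + ennreal e"
    by (simp add: mult_left_mono)
qed

text \<open>The lower limit of the slopes of \<open>f\<close> over intervals shrinking to
  \<open>x\<close> is at most \<open>a\<close>. Slopes above \<open>b\<close> are expressed by
  negating both the function and the bound, so that one notion serves for both.\<close>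

definition small_slopes :: "(real \<Rightarrow> real) \<Rightarrow> real \<Rightarrow> real set" where
  "small_slopes f a = {x. \<forall>d>0. \<exists>p q. p < x \<and> x < q \<and> q - p < d \<and> f q - f p < a * (q - p)}"

lemma small_slopesE:
  assumes "x \<in> small_slopes f a" "0 < d"
  obtains p q where "p < x" "x < q" "q - p < d" "f q - f p < a * (q - p)"
  using assms unfolding small_slopes_def by blast

text \<open>The measure of \<open>f ` E\<close> is at most \<open>a\<close> times that of \<open>E\<close> and, by the same estimate for the inverse
  of \<open>f\<close>, at least \<open>b\<close> times that of \<open>E\<close>.\<close>

lemma null_small_and_large_slopes_bi_lipschitz:
  fixes f :: "real \<Rightarrow> real"
  assumes c: "0 < c"
    and bounds: "\<And>x y. x \<le> y \<Longrightarrow> c * (y - x) \<le> f y - f x \<and> f y - f x \<le> C * (y - x)"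
    and ab: "0 < a" "a < b"
    and E: "E \<in> sets borel" "E \<subseteq> {-m..m}" "E \<subseteq> small_slopes f a" "E \<subseteq> small_slopes (\<lambda>x. - f x) (- b)"
  shows "E \<in> null_sets lebesgue"
proof -
  have mono: "strict_mono f"
  proof (rule strict_monoI)
    fix x y :: real assume "x < y"
    then have "0 < c * (y - x)" using c by simp
    then show "f x < f y" using bounds[of x y] \<open>x < y\<close> by linarith
  qed
  have inj: "inj f" using mono by (rule strict_mono_imp_inj_on)
  have cC: "c \<le> C" using bounds[of 0 1] by auto
  have lip: "C-lipschitz_on UNIV f"
  proof (rule lipschitz_onI)
    fix x y :: real
    show "dist (f x) (f y) \<le> C * dist x y"
    proof (cases "x \<le> y")
      case True
      then show ?thesis using bounds[of x y] strict_mono_less_eq[OF mono, of x y] by (simp add: dist_real_def)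
    next
      case False
      then show ?thesis using bounds[of y x] strict_mono_less_eq[OF mono, of y x] by (simp add: dist_real_def)
    qed
  qed (use c cC in auto)
  have contf: "continuous_on UNIV f" by (rule lipschitz_on_continuous_on[OF lip])
  have surj: "surj f"
    unfolding surj_def
  proof
    fix y
    define m where "m = (\<bar>y\<bar> + \<bar>f 0\<bar>) / c"
    have m: "0 \<le> m" "c * m = \<bar>y\<bar> + \<bar>f 0\<bar>" using c by (auto simp: m_def)
    have "c * m \<le> f 0 - f (-m)" using bounds[of "-m" 0] m by simp
    then have "f (-m) \<le> y" using m by linarith
    moreover have "c * m \<le> f m - f 0" using bounds[of 0 m] m by simp
    then have "y \<le> f m" using m by linarith
    ultimately show "\<exists>x. y = f x"
      using IVT'[of f "-m" y m] m continuous_on_subset[OF contf] by auto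
  qed
  define h where "h = inv f"
  have hf: "h (f x) = x" and fh: "f (h y) = y" for x y
    using inj surj by (auto simp: h_def surj_f_inv_f)
  have hmono: "strict_mono h"
    by (rule strict_monoI) (metis fh strict_mono_less[OF mono])
  have hlip: "(1/c)-lipschitz_on UNIV h"
  proof (rule lipschitz_onI)
    fix x y
    have *: "dist (h x) (h y) \<le> 1 / c * dist x y" if "h x \<le> h y" for x y
    proof -
      have "x \<le> y" using that by (metis fh strict_mono_less_eq[OF mono])
      then show ?thesis using bounds[OF that] that c
        by (simp add: dist_real_def fh field_simps)
    qed
    show "dist (h x) (h y) \<le> 1 / c * dist x y"
      using *[of x y] *[of y x] by (cases "h x \<le> h y") (auto simp: dist_commute)
  qed (use c in auto)
  have conth: "continuous_on UNIV h" by (rule lipschitz_on_continuous_on[OF hlip])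
  have fE: "f ` E = h -` E" using hf fh by (auto intro!: image_eqI[where x="h _"])
  have "h \<in> borel_measurable borel" using conth by (rule borel_measurable_continuous_onI)
  then have fEb: "f ` E \<in> sets borel" unfolding fE using E(1) by (metis measurable_sets_borel)
  have hfE: "h ` f ` E = E" by (auto simp: hf image_image)
  have 1: "emeasure lebesgue (f ` E) \<le> ennreal a * emeasure lebesgue E"
  proof (rule emeasure_image_le_slope[OF mono lip _ _ ab(1)])
    fix x d :: real assume "x \<in> E" "0 < d"
    then obtain p q where "p < x" "x < q" "q - p < d" "f q - f p < a * (q - p)"
      using E(3) by (blast elim: small_slopesE)
    then show "\<exists>p q. p < q \<and> x \<in> {p..q} \<and> q - p < d \<and> f q - f p \<le> a * (q - p)"
      by (intro exI[of _ p] exI[of _ q]) auto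
  qed (use E fEb in auto)
  \<comment> \<open>Slopes of the inverse \<open>h\<close> are reciprocals of slopes of
    \<open>f\<close>: those above \<open>b\<close> around \<open>x\<close> become slopes below
    \<open>1 / b\<close> around \<open>f x\<close>. The scale \<open>d / C\<close> makes the image
    interval shorter than \<open>d\<close>.\<close>
  have 2: "emeasure lebesgue (h ` f ` E) \<le> ennreal (1 / b) * emeasure lebesgue (f ` E)"
  proof (rule emeasure_image_le_slope[OF hmono hlip])
    fix y d :: real assume "y \<in> f ` E" and d: "0 < d"
    then obtain x where x: "y = f x" "x \<in> small_slopes (\<lambda>x. - f x) (- b)" using E(4) by auto
    obtain p q where pq: "p < x" "x < q" "q - p < d / C" "f q - f p > b * (q - p)"
      by (rule small_slopesE[OF x(2), of "d / C"]) (use d c cC in auto)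
    have "f q - f p < d" using bounds[of p q] pq c cC by (auto simp: field_simps)
    moreover have "q - p \<le> 1 / b * (f q - f p)" using pq ab by (auto simp: field_simps)
    moreover have "f p < f x" "f x < f q" using pq strict_mono_less[OF mono] by auto
    ultimately show "\<exists>p q. p < q \<and> y \<in> {p..q} \<and> q - p < d \<and> h q - h p \<le> 1 / b * (q - p)"
      using x by (intro exI[of _ "f p"] exI[of _ "f q"]) (auto simp: hf)
  qed (use E fEb hfE ab in auto)
  \<comment> \<open>The two estimates give \<open>r \<le> a / b * r\<close> for the measure
    \<open>r\<close> of \<open>E\<close>. Boundedness of \<open>E\<close> makes \<open>r\<close>
    finite, so that \<open>a < b\<close> forces \<open>r = 0\<close>.\<close>
  have "emeasure lebesgue E \<le> emeasure lebesgue {-m..m}"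
    using E by (intro emeasure_mono) auto
  also have "\<dots> < \<infinity>" by (simp add: emeasure_lborel_Icc_eq)
  finally obtain r where r: "emeasure lebesgue E = ennreal r" "0 \<le> r"
    by (metis ennreal_cases infinity_ennreal_def less_irrefl)
  have "ennreal r \<le> ennreal (1 / b) * (ennreal a * ennreal r)"
    using 2 1 unfolding hfE r by (meson mult_left_mono order_trans zero_le)
  also have "\<dots> = ennreal (a / b * r)"
    using ab r by (simp add: ennreal_mult[symmetric])
  finally have "r \<le> a / b * r" using ab r by simp
  then have "r * (1 - a / b) \<le> 0" by (simp add: algebra_simps)
  moreover have "0 < 1 - a / b" using ab by simp
  ultimately have "r = 0" using r by (smt (verit, best) mult_pos_pos)
  then show ?thesis using r E by (auto simp: null_sets_def)
qed

text \<open>Adding \<open>(L + 1) * x\<close> turns \<open>f\<close> into an increasing function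
  with slopes between \<open>1\<close> and \<open>2 * L + 1\<close> and shifts both bounds by
  \<open>L + 1\<close>. The bi-Lipschitz case then applies to each bounded piece of
  \<open>E\<close>.\<close>

lemma null_small_and_large_slopes:
  assumes lip: "L-lipschitz_on UNIV f" and ab: "a < b"
    and E: "E \<in> sets borel" "E \<subseteq> small_slopes f a" "E \<subseteq> small_slopes (\<lambda>x. - f x) (- b)"
  shows "E \<in> null_sets lebesgue"
proof (cases "E = {}")
  case False
  have L: "\<bar>f y - f x\<bar> \<le> L * \<bar>y - x\<bar>" for x y
    using lipschitz_onD[OF lip] by (auto simp: dist_real_def)
  define F where "F = (\<lambda>x. f x + (L + 1) * x)"
  \<comment> \<open>One point of \<open>E\<close> already gives a slope below \<open>a\<close>, and
    slopes are at least \<open>- L\<close>. Hence the shifted bound is positive, as the bi-Lipschitz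
    case requires.\<close>
  obtain x where "x \<in> small_slopes f a" using E(2) False by blast
  then obtain p q where pq: "p < x" "x < q" "f q - f p < a * (q - p)" by (rule small_slopesE[of _ _ _ 1]) auto
  then have "0 < (a + L) * (q - p)" using L[of q p] by (simp add: algebra_simps abs_less_iff abs_le_iff)
  then have a: "0 < a + (L + 1)" using pq by (simp add: zero_less_mult_iff)
  have F: "x \<in> small_slopes F (a + (L + 1))" "x \<in> small_slopes (\<lambda>x. - F x) (- (b + (L + 1)))" if "x \<in> E" for x
    using E(2,3) that unfolding F_def small_slopes_def by (force simp: algebra_simps)+
  have "E \<inter> {- real n..real n} \<in> null_sets lebesgue" for n
  proof (rule null_small_and_large_slopes_bi_lipschitz[where c=1 and f=F and C="2 * L + 1" and b="b + (L + 1)" and m="real n", OF _ _ a])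
    show "1 * (y - x) \<le> F y - F x \<and> F y - F x \<le> (2 * L + 1) * (y - x)" if "x \<le> y" for x y
      using L[of y x] that by (auto simp: F_def algebra_simps abs_if split: if_splits)
  qed (use ab E(1) F in auto)
  then have "(\<Union>n. E \<inter> {- real n..real n}) \<in> null_sets lebesgue" by (rule null_sets_UN)
  moreover have "(\<Union>n. E \<inter> {- real n..real n}) = E"
  proof -
    have "\<exists>n. x \<in> {- real n..real n}" for x :: real
      using real_arch_simple[of "\<bar>x\<bar>"] by (metis abs_le_iff atLeastAtMost_iff minus_le_iff)
    then show ?thesis by blast
  qed
  ultimately show ?thesis by simp
qed simp

text \<open>By continuity at \<open>0\<close>, the interval between \<open>0\<close> and
  \<open>k\<close> may be extended slightly beyond \<open>0\<close>, to the point
  \<open>- (s * t)\<close> with \<open>s = sgn k\<close>, without spoiling the strict slope bound.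
  This passes from difference quotients at a point to the intervals of
  \<open>small_slopes\<close>.\<close>

lemma two_sided_small_slope:
  fixes f :: "real \<Rightarrow> real"
  assumes cont: "isCont f 0" and k: "k \<noteq> 0" "\<bar>k\<bar> < d" "(f k - f 0) / k < a"
  obtains p q where "p < 0" "0 < q" "q - p < d" "f q - f p < a * (q - p)"
proof -
  define s where "s = sgn k"
  have "\<forall>\<^sub>F t in at_right 0. \<bar>k\<bar> + t < d"
    by (rule order_tendstoD(2)[OF tendsto_add[OF tendsto_const tendsto_ident_at]]) (use k in simp)
  moreover have "((\<lambda>t. f (- (s * t))) \<longlongrightarrow> f 0) (at_right 0)"
    by (rule isCont_tendsto_compose[OF cont]) (auto intro!: tendsto_eq_intros)
  then have "((\<lambda>t. s * (f k - f (- (s * t))) - a * (\<bar>k\<bar> + t)) \<longlongrightarrow> s * (f k - f 0) - a * (\<bar>k\<bar> + 0)) (at_right 0)"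
    by (intro tendsto_intros)
  then have "\<forall>\<^sub>F t in at_right 0. s * (f k - f (- (s * t))) - a * (\<bar>k\<bar> + t) < 0"
    by (rule order_tendstoD(2)) (use k in \<open>auto simp: s_def sgn_if field_simps split: if_splits\<close>)
  ultimately have "\<forall>\<^sub>F t in at_right (0::real). 0 < t \<and> \<bar>k\<bar> + t < d \<and> s * (f k - f (- (s * t))) - a * (\<bar>k\<bar> + t) < 0"
    using eventually_at_right_less[of "0::real"] by eventually_elim auto
  then obtain t where t: "0 < t" "\<bar>k\<bar> + t < d" "s * (f k - f (- (s * t))) - a * (\<bar>k\<bar> + t) < 0"
    using eventually_happens'[OF trivial_limit_at_right_real] by blast
  show thesis
  proof (cases "0 < k")
    case True
    then show thesis using t by (intro that[of "- t" k]) (auto simp: s_def algebra_simps)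
  next
    case False
    then show thesis using t k by (intro that[of k t]) (auto simp: s_def algebra_simps)
  qed
qed

text \<open>Here \<open>l = Sup S\<close> is the lower limit of \<open>q\<close> at
  \<open>0\<close>. Eventually \<open>q\<close> stays above \<open>l - e\<close>, so wherever it is
  at least \<open>e\<close> away from \<open>l\<close> it is at least \<open>l + e\<close>; any
  rationals \<open>a < b\<close> strictly between \<open>l\<close> and \<open>l + e\<close> are then
  crossed at every scale.\<close>

lemma no_limit_oscillation:
  fixes q :: "real \<Rightarrow> real"
  assumes bound: "\<And>k. \<bar>q k\<bar> \<le> C" and nolim: "\<And>l. \<not> (q \<longlongrightarrow> l) (at 0)"
  obtains a b where "a \<in> \<rat>" "b \<in> \<rat>" "a < b" "\<And>d. 0 < d \<Longrightarrow> \<exists>k. k \<noteq> 0 \<and> \<bar>k\<bar> < d \<and> q k < a"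
    "\<And>d. 0 < d \<Longrightarrow> \<exists>k. k \<noteq> 0 \<and> \<bar>k\<bar> < d \<and> b < q k"
proof -
  define S where "S = {a. \<exists>d>0. \<forall>k. k \<noteq> 0 \<and> \<bar>k\<bar> < d \<longrightarrow> a \<le> q k}"
  have cS: "- C \<in> S" unfolding S_def using bound by (auto simp: abs_le_iff minus_le_iff intro!: exI[of _ 1])
  have bS: "bdd_above S"
  proof (rule bdd_aboveI[of _ C])
    fix a assume "a \<in> S"
    then obtain d where d: "d > 0" "\<And>k. k \<noteq> 0 \<Longrightarrow> \<bar>k\<bar> < d \<Longrightarrow> a \<le> q k" by (auto simp: S_def)
    show "a \<le> C" using d(2)[of "d/2"] bound[of "d/2"] d(1) by auto
  qed
  define l where "l = Sup S"
  obtain e where e: "e > 0" "\<not> (\<forall>\<^sub>F k in at 0. dist (q k) l < e)"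
    using nolim[of l] unfolding tendsto_iff by blast
  have freq: "\<exists>k. k \<noteq> 0 \<and> \<bar>k\<bar> < d \<and> \<bar>q k - l\<bar> \<ge> e" if "d > 0" for d
    using e(2) that unfolding eventually_at by (force simp: dist_real_def)
  obtain s where s: "s \<in> S" "l - e < s"
    using less_cSup_iff[of S "l - e"] cS bS e(1) unfolding l_def by auto
  then obtain d0 where d0: "d0 > 0" "\<And>k. k \<noteq> 0 \<Longrightarrow> \<bar>k\<bar> < d0 \<Longrightarrow> s \<le> q k" by (auto simp: S_def)
  obtain a where a: "a \<in> \<rat>" "l < a" "a < l + e" using Rats_dense_in_real[of l "l + e"] e by auto
  obtain b where b: "b \<in> \<rat>" "a < b" "b < l + e" using Rats_dense_in_real[of a "l + e"] a by auto
  have "a \<notin> S" using cSup_upper[of a S] bS a by (auto simp: l_def)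
  show thesis
  proof (rule that[OF a(1) b(1,2)])
    fix d :: real assume d: "0 < d"
    show "\<exists>k. k \<noteq> 0 \<and> \<bar>k\<bar> < d \<and> q k < a" using \<open>a \<notin> S\<close> d unfolding S_def by force
    obtain k where "k \<noteq> 0" "\<bar>k\<bar> < min d d0" "\<bar>q k - l\<bar> \<ge> e"
      using freq[of "min d d0"] d d0 by auto
    then show "\<exists>k. k \<noteq> 0 \<and> \<bar>k\<bar> < d \<and> b < q k" using d0(2)[of k] s b by (intro exI[of _ k]) auto
  qed
qed

text \<open>The measure of \<open>A\<close> is translation invariant, hence equal to its average
  over the translates by \<open>t *\<^sub>R u\<close> with \<open>t\<close> in
  \<open>{0..1}\<close>. Exchanging the integrals leaves the traces of \<open>A\<close> on lines
  inside. This spares a change of coordinates that would make \<open>u\<close> a coordinate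
  direction.\<close>

lemma null_sets_if_null_on_lines:
  fixes A :: "'a::euclidean_space set"
  assumes A: "A \<in> sets borel" and null: "\<And>x. {t::real. x + t *\<^sub>R u \<in> A} \<in> null_sets lborel"
  shows "A \<in> null_sets lborel"
proof -
  have meas: "(\<lambda>(x, t). indicator A (x + t *\<^sub>R u) * indicator {0..1} t :: ennreal) \<in> borel_measurable (lborel \<Otimes>\<^sub>M (lborel::real measure))"
    using A by measurable
  have "emeasure lborel A = (\<integral>\<^sup>+t. emeasure lborel A * indicator {0..1} t \<partial>(lborel::real measure))"
    by (simp add: nn_integral_cmult)
  also have "\<dots> = (\<integral>\<^sup>+t. (\<integral>\<^sup>+x. indicator A (x + t *\<^sub>R u) * indicator {0..1} t \<partial>lborel) \<partial>(lborel::real measure))"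
  proof (rule nn_integral_cong)
    fix t :: real
    have "emeasure lborel A = (\<integral>\<^sup>+x. indicator A x \<partial>distr lborel borel ((+) (t *\<^sub>R u)))"
      using A by (simp add: lborel_distr_plus)
    also have "\<dots> = (\<integral>\<^sup>+x. indicator A (t *\<^sub>R u + x) \<partial>lborel)"
      using A by (subst nn_integral_distr) auto
    finally have *: "emeasure lborel A = (\<integral>\<^sup>+x. indicator A (x + t *\<^sub>R u) \<partial>lborel)"
      by (simp add: add.commute)
    have "(\<lambda>x. indicator A (x + t *\<^sub>R u) :: ennreal) \<in> borel_measurable lborel"
      using A by measurable
    then show "emeasure lborel A * indicator {0..1} t = (\<integral>\<^sup>+x. indicator A (x + t *\<^sub>R u) * indicator {0..1} t \<partial>lborel)"
      unfolding * by (rule nn_integral_multc[symmetric])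
  qed
  also have "\<dots> = (\<integral>\<^sup>+x. (\<integral>\<^sup>+t. indicator A (x + t *\<^sub>R u) * indicator {0..1} t \<partial>(lborel::real measure)) \<partial>lborel)"
    using lborel_pair.Fubini'[OF meas] by simp
  also have "\<dots> = (\<integral>\<^sup>+x. 0 \<partial>(lborel :: 'a measure))"
  proof (rule nn_integral_cong)
    fix x :: 'a
    have "AE t in lborel. t \<notin> {t::real. x + t *\<^sub>R u \<in> A}"
      by (rule AE_not_in[OF null])
    then have "AE t in lborel. indicator A (x + t *\<^sub>R u) * indicator {0..1} t = (0::ennreal)"
      by eventually_elim simp
    then have "(\<integral>\<^sup>+t. indicator A (x + t *\<^sub>R u) * indicator {0..1} t \<partial>(lborel::real measure)) = (\<integral>\<^sup>+t. 0 \<partial>(lborel::real measure))"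
      by (rule nn_integral_cong_AE)
    then show "(\<integral>\<^sup>+t. indicator A (x + t *\<^sub>R u) * indicator {0..1} t \<partial>(lborel::real measure)) = 0"
      by simp
  qed
  finally show ?thesis using A by (simp add: null_sets_def)
qed

section \<open>Directional derivatives almost everywhere\<close>

definition dir_deriv :: "('a::real_vector \<Rightarrow> real) \<Rightarrow> 'a \<Rightarrow> 'a \<Rightarrow> real \<Rightarrow> bool" where
  "dir_deriv f x u y \<longleftrightarrow> ((\<lambda>k. f (x + k *\<^sub>R u)) has_real_derivative y) (at 0)"

lemma dir_deriv_iff: "dir_deriv f x u y \<longleftrightarrow> ((\<lambda>k. (f (x + k *\<^sub>R u) - f x) / k) \<longlongrightarrow> y) (at 0)"
  by (simp add: dir_deriv_def DERIV_def)

lemma dir_deriv_unique: "dir_deriv f x u y \<Longrightarrow> dir_deriv f x u z \<Longrightarrow> y = z"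
  unfolding dir_deriv_def by (rule DERIV_unique)

lemma dir_deriv_eps:
  assumes "dir_deriv f x u y" "0 < e"
  obtains d where "0 < d" "\<And>k. \<bar>k\<bar> < d \<Longrightarrow> \<bar>f (x + k *\<^sub>R u) - f x - k * y\<bar> \<le> e * \<bar>k\<bar>"
proof -
  have "\<forall>\<^sub>F k in at 0. dist ((f (x + k *\<^sub>R u) - f x) / k) y < e"
    using assms unfolding dir_deriv_iff tendsto_iff by blast
  then obtain d where d: "0 < d" "\<And>k. k \<noteq> 0 \<Longrightarrow> \<bar>k\<bar> < d \<Longrightarrow> \<bar>(f (x + k *\<^sub>R u) - f x) / k - y\<bar> < e"
    unfolding eventually_at by (auto simp: dist_real_def)
  show thesis
  proof (rule that[OF d(1)])
    fix k :: real assume k: "\<bar>k\<bar> < d"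
    show "\<bar>f (x + k *\<^sub>R u) - f x - k * y\<bar> \<le> e * \<bar>k\<bar>"
    proof (cases "k = 0")
      case False
      have "f (x + k *\<^sub>R u) - f x - k * y = ((f (x + k *\<^sub>R u) - f x) / k - y) * k"
        using False by (simp add: field_simps)
      then show ?thesis using d(2)[OF False k] by (auto simp: abs_mult intro!: mult_right_mono)
    qed simp
  qed
qed

lemma dir_deriv_scale:
  assumes "dir_deriv f x u y"
  shows "dir_deriv f x (c *\<^sub>R u) (c * y)"
proof -
  have "((\<lambda>k. f (x + k *\<^sub>R u)) \<circ> (\<lambda>k. c * k) has_real_derivative y * c) (at 0)"
    using assms unfolding dir_deriv_def
    by (intro DERIV_chain) (auto intro!: derivative_eq_intros)
  then show ?thesis by (simp add: dir_deriv_def o_def mult.commute)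
qed

text \<open>A bounded difference quotient without a limit oscillates across two rationals
  \<open>a < b\<close>. The points where this happens lie in a Borel set \<open>E (a, b)\<close>
  whose trace on every line in direction \<open>u\<close> is null by the one-dimensional result, and
  there are only countably many such pairs.\<close>

lemma AE_dir_deriv_exists:
  fixes f :: "'a::euclidean_space \<Rightarrow> real"
  assumes lip: "L-lipschitz_on UNIV f"
  shows "AE x in lborel. \<exists>y. dir_deriv f x u y"
proof -
  have contf: "continuous_on UNIV f" by (rule lipschitz_on_continuous_on[OF lip])
  have L: "\<bar>f (x + s *\<^sub>R u) - f (x + t *\<^sub>R u)\<bar> \<le> L * norm u * \<bar>s - t\<bar>" for x s t
    using lipschitz_onD[OF lip, of "x + s *\<^sub>R u" "x + t *\<^sub>R u"]
    by (simp add: dist_norm algebra_simps flip: scaleR_diff_left)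
  \<comment> \<open>The condition of \<open>small_slopes\<close> at the single scale
    \<open>1 / Suc n\<close>, on the line through \<open>x\<close> in direction \<open>u\<close>.
    Strict inequalities make it open, so that \<open>E\<close> is a countable intersection of open
    sets.\<close>
  define W where "W = (\<lambda>\<phi> a n. {x. \<exists>p q. p < 0 \<and> 0 < q \<and> q - p < 1 / real (Suc n) \<and> \<phi> (x + q *\<^sub>R u) - \<phi> (x + p *\<^sub>R u) < a * (q - p)})"
  have openW: "open (W \<phi> a n)" if "continuous_on UNIV \<phi>" for \<phi> a n
    unfolding W_def
    by (intro open_Collect_ex open_Collect_conj open_Collect_const open_Collect_less
        continuous_intros continuous_on_compose2[OF that]) auto
  define E where "E = (\<lambda>(a, b). (\<Inter>n. W f a n) \<inter> (\<Inter>n. W (\<lambda>x. - f x) (- b) n))"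
  have Eb: "E i \<in> sets borel" for i
    unfolding E_def split_beta
    by (intro sets.Int sets.countable_INT'') (use openW[OF contf] openW[OF continuous_on_minus[OF contf]] in auto)
  have slopes: "t \<in> small_slopes (\<lambda>t. \<phi> (x + t *\<^sub>R u)) a" if W: "\<And>n. x + t *\<^sub>R u \<in> W \<phi> a n" for x t \<phi> a
    unfolding small_slopes_def
  proof (intro CollectI allI impI)
    fix d :: real assume "0 < d"
    then obtain n where n: "1 / real (Suc n) < d" by (metis nat_approx_posE)
    obtain p q where pq: "p < 0" "0 < q" "q - p < 1 / real (Suc n)"
      "\<phi> (x + t *\<^sub>R u + q *\<^sub>R u) - \<phi> (x + t *\<^sub>R u + p *\<^sub>R u) < a * (q - p)"
      using W[of n] unfolding W_def by blast
    then show "\<exists>p q. p < t \<and> t < q \<and> q - p < d \<and> \<phi> (x + q *\<^sub>R u) - \<phi> (x + p *\<^sub>R u) < a * (q - p)"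
      using n by (intro exI[of _ "t + p"] exI[of _ "t + q"]) (simp add: scaleR_add_left add.assoc)
  qed
  have null: "E (a, b) \<in> null_sets lborel" if ab: "a < b" for a b
  proof (rule null_sets_if_null_on_lines[OF Eb])
    fix x
    let ?T = "{t. x + t *\<^sub>R u \<in> E (a, b)}"
    have "(\<lambda>t. x + t *\<^sub>R u) -` E (a, b) \<inter> space borel \<in> sets borel"
      by (rule measurable_sets[OF borel_measurable_continuous_onI Eb]) (intro continuous_intros)
    then have T: "?T \<in> sets borel" by (simp add: vimage_def)
    have "(L * norm u)-lipschitz_on UNIV (\<lambda>t. f (x + t *\<^sub>R u))"
      using L lipschitz_on_nonneg[OF lip] by (intro lipschitz_onI) (auto simp: dist_real_def)
    then have "?T \<in> null_sets lebesgue"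
      by (rule null_small_and_large_slopes[OF _ ab T]) (use slopes[where \<phi>=f] slopes[where \<phi>="\<lambda>x. - f x"] in \<open>auto simp: E_def\<close>)
    then show "?T \<in> null_sets lborel" using T by (simp add: null_sets_completion_iff)
  qed
  define I where "I = {(a::real, b). a \<in> \<rat> \<and> b \<in> \<rat> \<and> a < b}"
  have "countable I"
    by (rule countable_subset[of _ "\<rat> \<times> \<rat>"]) (auto simp: I_def intro: countable_rat)
  then have "(\<Union>i\<in>I. E i) \<in> null_sets lborel" by (rule null_sets_UN') (use null in \<open>auto simp: I_def\<close>)
  moreover have "x \<in> (\<Union>i\<in>I. E i)" if nd: "\<not> (\<exists>y. dir_deriv f x u y)" for x
  proof -
    define q where "q = (\<lambda>k. (f (x + k *\<^sub>R u) - f x) / k)"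
    have "\<bar>q k\<bar> \<le> L * norm u" for k unfolding q_def
      using L[of x k 0] lipschitz_on_nonneg[OF lip] by (cases "k = 0") (simp_all add: abs_divide divide_le_eq)
    moreover have "\<not> (q \<longlongrightarrow> l) (at 0)" for l using nd unfolding dir_deriv_iff q_def by blast
    ultimately obtain a b where ab: "a \<in> \<rat>" "b \<in> \<rat>" "a < b"
      "\<And>d. 0 < d \<Longrightarrow> \<exists>k. k \<noteq> 0 \<and> \<bar>k\<bar> < d \<and> q k < a" "\<And>d. 0 < d \<Longrightarrow> \<exists>k. k \<noteq> 0 \<and> \<bar>k\<bar> < d \<and> b < q k"
      by (rule no_limit_oscillation) (rule that)
    \<comment> \<open>Difference quotients at \<open>x\<close> are turned into slopes over intervals
      around \<open>x\<close> by \<open>two_sided_small_slope\<close>.\<close>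
    have inW: "x \<in> W \<phi> c n" if \<phi>: "continuous_on UNIV \<phi>"
      and fr: "\<And>d. 0 < d \<Longrightarrow> \<exists>k. k \<noteq> 0 \<and> \<bar>k\<bar> < d \<and> (\<phi> (x + k *\<^sub>R u) - \<phi> x) / k < c" for \<phi> c n
    proof -
      obtain k where k: "k \<noteq> 0" "\<bar>k\<bar> < 1 / real (Suc n)" "(\<phi> (x + k *\<^sub>R u) - \<phi> (x + 0 *\<^sub>R u)) / k < c"
        using fr[of "1 / real (Suc n)"] by auto
      have "continuous_on UNIV (\<lambda>t. \<phi> (x + t *\<^sub>R u))"
        by (intro continuous_on_compose2[OF \<phi>] continuous_intros) auto
      then have "isCont (\<lambda>t. \<phi> (x + t *\<^sub>R u)) 0" by (simp add: continuous_on_eq_continuous_at)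
      from two_sided_small_slope[OF this k] show ?thesis unfolding W_def by blast
    qed
    have "x \<in> W f a n" for n using inW[OF contf] ab(4) unfolding q_def by blast
    moreover have "x \<in> W (\<lambda>x. - f x) (- b) n" for n
    proof (rule inW[OF continuous_on_minus[OF contf]])
      fix d :: real assume "0 < d"
      then obtain k where k: "k \<noteq> 0" "\<bar>k\<bar> < d" "b < q k" using ab(5) by blast
      moreover have "(- f (x + k *\<^sub>R u) - - f x) / k = - q k" by (simp add: q_def minus_divide_left)
      ultimately show "\<exists>k. k \<noteq> 0 \<and> \<bar>k\<bar> < d \<and> (- f (x + k *\<^sub>R u) - - f x) / k < - b"
        by (intro exI[of _ k]) simp
    qed
    ultimately have "x \<in> E (a, b)" by (simp add: E_def)
    then show ?thesis using ab by (auto simp: I_def)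
  qed
  ultimately show ?thesis by (intro AE_I'[where N="\<Union>i\<in>I. E i"]) blast+
qed

text \<open>Each half-open interval between consecutive multiples of \<open>d\<close> contains at
  most one point of \<open>S\<close>.\<close>

lemma countable_separated_real:
  fixes S :: "real set"
  assumes "0 < d" and sep: "\<And>s t. s \<in> S \<Longrightarrow> t \<in> S \<Longrightarrow> s \<noteq> t \<Longrightarrow> d \<le> \<bar>s - t\<bar>"
  shows "countable S"
proof -
  have "inj_on (\<lambda>s. \<lfloor>s / d\<rfloor>) S"
  proof (rule inj_onI, rule ccontr)
    fix s t assume st: "s \<in> S" "t \<in> S" "\<lfloor>s / d\<rfloor> = \<lfloor>t / d\<rfloor>" "s \<noteq> t"
    have "\<bar>s / d - t / d\<bar> < 1" using st(3) by linarith
    then have "\<bar>s - t\<bar> < d" using \<open>0 < d\<close> by (simp add: diff_divide_distrib[symmetric] abs_divide)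
    with sep[OF st(1,2,4)] show False by simp
  qed
  then show ?thesis by (rule countableI')
qed

text \<open>On a line in direction \<open>u\<close>, the exceptional set is discrete: the value at \<open>x + k u\<close> of the difference
  quotient in direction \<open>v\<close> is also the difference at \<open>x\<close> of those in directions \<open>u + v\<close> and \<open>u\<close>.\<close>

lemma AE_dir_deriv_add:
  fixes f :: "'a::euclidean_space \<Rightarrow> real"
  assumes lip: "L-lipschitz_on UNIV f"
  shows "AE x in lborel. \<forall>y z w. dir_deriv f x u y \<longrightarrow> dir_deriv f x v z \<longrightarrow> dir_deriv f x (u + v) w \<longrightarrow> w = y + z"
proof -
  have contf: "continuous_on UNIV f" by (rule lipschitz_on_continuous_on[OF lip])
  \<comment> \<open>At \<open>x\<close>, increments in direction \<open>v\<close> are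
    \<open>k * z\<close> up to \<open>e * \<bar>k\<bar>\<close>, but increments in the same
    direction starting from \<open>x + k *\<^sub>R u\<close> are off by at least
    \<open>2 * e * \<bar>k\<bar>\<close>. Weak inequalities for all small \<open>k\<close> make the
    set closed.\<close>
  define A where "A = (\<lambda>(z, e, d). {x. \<forall>k. \<bar>k\<bar> < d \<longrightarrow>
     \<bar>f (x + k *\<^sub>R v) - f x - k * z\<bar> \<le> e * \<bar>k\<bar> \<and> 2 * e * \<bar>k\<bar> \<le> \<bar>f (x + k *\<^sub>R (u + v)) - f (x + k *\<^sub>R u) - k * z\<bar>})"
  define I where "I = {(z::real, e::real, d::real). z \<in> \<rat> \<and> e \<in> \<rat> \<and> d \<in> \<rat> \<and> 0 < d \<and> 0 < e}"
  have clA: "closed (A i)" for i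
    unfolding A_def split_beta
    by (intro closed_Collect_all closed_Collect_imp open_Collect_const closed_Collect_conj closed_Collect_le
        continuous_intros continuous_on_compose2[OF contf]) auto
  have "A i \<in> null_sets lborel" if i: "i \<in> I" for i
  proof -
    obtain z e d where ieq: "i = (z, e, d)" and I: "0 < d" "0 < e" using i by (auto simp: I_def)
    show ?thesis
    proof (rule null_sets_if_null_on_lines)
      fix x
      have "countable {t. x + t *\<^sub>R u \<in> A i}"
      proof (rule countable_separated_real[OF I(1)], rule ccontr)
        fix s t assume s: "s \<in> {t. x + t *\<^sub>R u \<in> A i}" and t: "t \<in> {t. x + t *\<^sub>R u \<in> A i}"
          and st: "s \<noteq> t" "\<not> d \<le> \<bar>s - t\<bar>"
        define k where "k = t - s"
        have k: "\<bar>k\<bar> < d" "k \<noteq> 0" using st by (auto simp: k_def)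
        define a where "a = x + s *\<^sub>R u"
        \<comment> \<open>The first clause at \<open>a + k *\<^sub>R u\<close> and the second clause
          at \<open>a\<close> concern the same increment of \<open>f\<close>, bounded by
          \<open>e * \<bar>k\<bar>\<close> on one side and by \<open>2 * e * \<bar>k\<bar>\<close>
          on the other.\<close>
        have "a + k *\<^sub>R u \<in> A i" using t by (simp add: a_def k_def algebra_simps)
        then have "\<bar>f (a + k *\<^sub>R u + k *\<^sub>R v) - f (a + k *\<^sub>R u) - k * z\<bar> \<le> e * \<bar>k\<bar>"
          using k(1) by (simp add: A_def ieq)
        moreover have "2 * e * \<bar>k\<bar> \<le> \<bar>f (a + k *\<^sub>R (u + v)) - f (a + k *\<^sub>R u) - k * z\<bar>"
          using s k(1) by (simp add: A_def ieq a_def)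
        moreover have "a + k *\<^sub>R (u + v) = a + k *\<^sub>R u + k *\<^sub>R v" by (simp add: algebra_simps)
        ultimately have "2 * e * \<bar>k\<bar> \<le> e * \<bar>k\<bar>" by simp
        with k I show False by simp
      qed
      then show "{t. x + t *\<^sub>R u \<in> A i} \<in> null_sets lborel" by (rule countable_imp_null_set_lborel)
    qed (use clA in auto)
  qed
  moreover have "countable I"
    by (rule countable_subset[of _ "\<rat> \<times> \<rat> \<times> \<rat>"]) (auto simp: I_def intro!: countable_SIGMA countable_rat)
  ultimately have "(\<Union>i\<in>I. A i) \<in> null_sets lborel" by (intro null_sets_UN') auto
  moreover have "x \<in> (\<Union>i\<in>I. A i)"
    if D: "dir_deriv f x u y" "dir_deriv f x v z" "dir_deriv f x (u + v) w" and ne: "w \<noteq> y + z" for x y z w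
  proof -
    define \<delta> where "\<delta> = \<bar>w - y - z\<bar>"
    have \<delta>: "0 < \<delta>" using ne by (simp add: \<delta>_def)
    \<comment> \<open>The margins give \<open>\<bar>z - z'\<bar> < \<delta> / 8 < e\<close> and
      \<open>2 * e < \<delta> / 2 < 7 * \<delta> / 8 < \<bar>w - y - z'\<bar>\<close>, so both
      clauses of \<open>A\<close> hold strictly in the limit and hence for all small
      \<open>k\<close>.\<close>
    obtain e where e: "e \<in> \<rat>" "\<delta> / 8 < e" "e < \<delta> / 4" using Rats_dense_in_real[of "\<delta> / 8" "\<delta> / 4"] \<delta> by auto
    obtain z' where z': "z' \<in> \<rat>" "z - \<delta> / 8 < z'" "z' < z + \<delta> / 8"
      using Rats_dense_in_real[of "z - \<delta> / 8" "z + \<delta> / 8"] \<delta> by auto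
    define q where "q = (\<lambda>u k. (f (x + k *\<^sub>R u) - f x) / k)"
    have q: "(q u \<longlongrightarrow> y) (at 0)" "(q v \<longlongrightarrow> z) (at 0)" "(q (u + v) \<longlongrightarrow> w) (at 0)"
      using D by (simp_all add: dir_deriv_iff q_def)
    have z'': "\<bar>z - z'\<bar> < \<delta> / 8" "\<delta> \<le> \<bar>w - y - z'\<bar> + \<bar>z - z'\<bar>" using z' unfolding \<delta>_def by linarith+
    then have lim: "\<bar>z - z'\<bar> < e" "2 * e < \<bar>w - y - z'\<bar>" using e \<delta> by linarith+
    have "\<forall>\<^sub>F k in at 0. \<bar>q v k - z'\<bar> < e \<and> 2 * e < \<bar>q (u + v) k - q u k - z'\<bar>"
      by (intro eventually_conj order_tendstoD(2)[OF _ lim(1)] order_tendstoD(1)[OF _ lim(2)]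
          tendsto_rabs tendsto_diff tendsto_const q)
    then obtain r where r: "0 < r"
      "\<And>k. k \<noteq> 0 \<Longrightarrow> \<bar>k\<bar> < r \<Longrightarrow> \<bar>q v k - z'\<bar> < e \<and> 2 * e < \<bar>q (u + v) k - q u k - z'\<bar>"
      unfolding eventually_at by (auto simp: dist_real_def)
    obtain d where d: "d \<in> \<rat>" "0 < d" "d < r" using Rats_dense_in_real[OF r(1)] by auto
    have "\<bar>f (x + k *\<^sub>R v) - f x - k * z'\<bar> \<le> e * \<bar>k\<bar> \<and>
      2 * e * \<bar>k\<bar> \<le> \<bar>f (x + k *\<^sub>R (u + v)) - f (x + k *\<^sub>R u) - k * z'\<bar>" if "\<bar>k\<bar> < d" for k
    proof (cases "k = 0")
      case False
      have "f (x + k *\<^sub>R v) - f x - k * z' = (q v k - z') * k"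
        "f (x + k *\<^sub>R (u + v)) - f (x + k *\<^sub>R u) - k * z' = (q (u + v) k - q u k - z') * k"
        using False by (simp_all add: q_def field_simps)
      then show ?thesis using r(2)[OF False] that d(3) by (simp only: abs_mult) (auto intro!: mult_right_mono)
    qed simp
    then have "x \<in> A (z', e, d)" unfolding A_def by blast
    moreover have "(z', e, d) \<in> I" using z' e d \<delta> unfolding I_def by auto
    ultimately show ?thesis by blast
  qed
  ultimately show ?thesis by (intro AE_I'[where N="\<Union>i\<in>I. A i"]) blast+
qed

section \<open>From rational directions to the total derivative\<close>

lemma countable_rational_vectors: "countable {u::'a::euclidean_space. \<forall>b\<in>Basis. u \<bullet> b \<in> \<rat>}"
proof -
  have "countable (PiE (Basis::'a set) (\<lambda>_. \<rat>::real set))"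
    by (intro countable_PiE) (auto intro: countable_rat)
  moreover have "{u::'a. \<forall>b\<in>Basis. u \<bullet> b \<in> \<rat>} \<subseteq> (\<lambda>c. \<Sum>b\<in>Basis. c b *\<^sub>R b) ` PiE Basis (\<lambda>_. \<rat>)"
  proof
    fix u :: 'a assume "u \<in> {u. \<forall>b\<in>Basis. u \<bullet> b \<in> \<rat>}"
    then show "u \<in> (\<lambda>c. \<Sum>b\<in>Basis. c b *\<^sub>R b) ` PiE Basis (\<lambda>_. \<rat>)"
      by (intro image_eqI[of _ _ "restrict (\<lambda>b. u \<bullet> b) Basis"]) (auto simp: euclidean_representation)
  qed
  ultimately show ?thesis by (meson countable_image countable_subset)
qed

lemma rational_vector_dense:
  fixes x :: "'a::euclidean_space"
  assumes "0 < e"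
  obtains u where "\<forall>b\<in>Basis. u \<bullet> b \<in> \<rat>" "norm (x - u) < e"
proof -
  define d where "d = e / (2 * real DIM('a))"
  have d: "0 < d" using assms by (simp add: d_def)
  have "\<exists>q\<in>\<rat>. \<bar>x \<bullet> b - q\<bar> < d" for b
  proof -
    obtain r where "r \<in> \<rat>" "x \<bullet> b - d < r" "r < x \<bullet> b + d"
      using Rats_dense_in_real[of "x \<bullet> b - d" "x \<bullet> b + d"] d by auto
    then show ?thesis by (intro bexI[of _ r]; linarith)
  qed
  then obtain q where q: "\<And>b. q b \<in> \<rat>" "\<And>b. \<bar>x \<bullet> b - q b\<bar> < d" by metis
  define u where "u = (\<Sum>b\<in>Basis. q b *\<^sub>R b)"
  have ub: "u \<bullet> b = q b" if "b \<in> Basis" for b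
    using that by (simp add: u_def)
  have "norm (x - u) \<le> (\<Sum>b\<in>Basis. \<bar>(x - u) \<bullet> b\<bar>)" by (rule norm_le_l1)
  also have "\<dots> \<le> (\<Sum>b\<in>(Basis::'a set). d)"
    using q(2) ub by (intro sum_mono) (auto simp: inner_diff_left intro: less_imp_le)
  also have "\<dots> < e" using assms by (simp add: d_def)
  finally show thesis using ub q by (intro that[of u]) auto
qed

text \<open>Finitely many rational directions form an \<open>r\<close>-net of the unit sphere, so
  one \<open>\<delta>\<close> serves for all of them. An arbitrary direction is replaced by a nearby
  one of the net, at a cost that the Lipschitz condition on \<open>f\<close> and the boundedness of
  \<open>F\<close> control.\<close>

lemma has_derivative_if_dir_derivs:
  fixes f :: "'a::euclidean_space \<Rightarrow> real"
  assumes lip: "L-lipschitz_on UNIV f" and F: "bounded_linear F"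
    and dd: "\<And>u. \<forall>b\<in>Basis. u \<bullet> b \<in> \<rat> \<Longrightarrow> dir_deriv f x u (F u)"
  shows "(f has_derivative F) (at x)"
  unfolding has_derivative_within_alt
proof (intro conjI allI impI F)
  fix e :: real assume e: "0 < e"
  interpret F: bounded_linear F by (rule F)
  obtain B where B: "0 < B" "\<And>u. norm (F u) \<le> norm u * B" using F.pos_bounded by blast
  have L: "0 \<le> L" by (rule lipschitz_on_nonneg[OF lip])
  \<comment> \<open>Exchanging the direction costs \<open>L * r\<close> for \<open>f\<close> and
    \<open>B * r\<close> for \<open>F\<close>, together \<open>e / 2\<close>; the other half of
    \<open>e\<close> is for the directional derivative itself.\<close>
  define r where "r = e / 2 / (L + B)"
  have LB: "0 < L + B" using L B by simp
  have "c * (e / 2 / c) = e / 2" if "0 < c" for c using that by simp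
  from this[OF LB] have r: "0 < r" "(L + B) * r = e / 2" using e LB by (simp_all add: r_def)
  define D where "D = {u::'a. \<forall>b\<in>Basis. u \<bullet> b \<in> \<rat>}"
  have "sphere 0 1 \<subseteq> (\<Union>u\<in>D. ball u r)"
  proof
    fix s :: 'a
    obtain u where "\<forall>b\<in>Basis. u \<bullet> b \<in> \<rat>" "norm (s - u) < r" using rational_vector_dense[OF r(1)] by blast
    then show "s \<in> (\<Union>u\<in>D. ball u r)" by (auto simp: D_def dist_norm norm_minus_commute)
  qed
  then obtain D' where D': "D' \<subseteq> D" "finite D'" "sphere 0 1 \<subseteq> (\<Union>u\<in>D'. ball u r)"
    using compactE_image[OF compact_sphere, of D "\<lambda>u. ball u r" 0 1] by auto
  have e2: "0 < e / 2" using e by simp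
  have "\<forall>u\<in>D. \<exists>d>0. \<forall>k. \<bar>k\<bar> < d \<longrightarrow> \<bar>f (x + k *\<^sub>R u) - f x - k * F u\<bar> \<le> e / 2 * \<bar>k\<bar>"
  proof
    fix u assume "u \<in> D"
    then have "dir_deriv f x u (F u)" by (intro dd) (simp add: D_def)
    from dir_deriv_eps[OF this e2] show "\<exists>d>0. \<forall>k. \<bar>k\<bar> < d \<longrightarrow> \<bar>f (x + k *\<^sub>R u) - f x - k * F u\<bar> \<le> e / 2 * \<bar>k\<bar>"
      by blast
  qed
  then obtain d where d: "\<And>u. u \<in> D \<Longrightarrow> 0 < d u"
    "\<And>u k. u \<in> D \<Longrightarrow> \<bar>k\<bar> < d u \<Longrightarrow> \<bar>f (x + k *\<^sub>R u) - f x - k * F u\<bar> \<le> e / 2 * \<bar>k\<bar>" by metis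
  define \<delta> where "\<delta> = Min (insert 1 (d ` D'))"
  have \<delta>: "0 < \<delta>" "\<And>u. u \<in> D' \<Longrightarrow> \<delta> \<le> d u"
    using D' d by (auto simp: \<delta>_def)
  show "\<exists>d>0. \<forall>y\<in>UNIV. norm (y - x) < d \<longrightarrow> norm (f y - f x - F (y - x)) \<le> e * norm (y - x)"
  proof (intro exI[of _ \<delta>] conjI ballI impI \<delta>(1))
    fix y assume y: "norm (y - x) < \<delta>"
    show "norm (f y - f x - F (y - x)) \<le> e * norm (y - x)"
    proof (cases "y = x")
      case False
      define k where "k = norm (y - x)"
      have k: "0 < k" using False by (simp add: k_def)
      define s where "s = (1 / k) *\<^sub>R (y - x)"
      have ks: "y = x + k *\<^sub>R s" using k by (simp add: s_def)
      have "s \<in> sphere 0 1" using k by (simp add: s_def k_def)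
      then obtain u where u: "u \<in> D'" "norm (u - s) < r" using D' by (force simp: dist_norm)
      have 1: "\<bar>f (x + k *\<^sub>R u) - f x - k * F u\<bar> \<le> e / 2 * k"
        using d(2)[of u k] u D' \<delta>(2)[of u] y k by (auto simp: k_def)
      have 2: "\<bar>f (x + k *\<^sub>R s) - f (x + k *\<^sub>R u)\<bar> \<le> L * (k * r)"
      proof -
        have "\<bar>f (x + k *\<^sub>R s) - f (x + k *\<^sub>R u)\<bar> \<le> L * norm (k *\<^sub>R (s - u))"
          using lipschitz_on_normD[OF lip, of "x + k *\<^sub>R s" "x + k *\<^sub>R u"] by (simp add: algebra_simps)
        also have "\<dots> \<le> L * (k * r)" using k u L by (intro mult_left_mono) (auto simp: norm_minus_commute)
        finally show ?thesis .
      qed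
      have 3: "\<bar>k * F u - k * F s\<bar> \<le> B * (k * r)"
      proof -
        have "\<bar>k * F u - k * F s\<bar> = k * \<bar>F (u - s)\<bar>"
          using k by (simp add: F.diff right_diff_distrib[symmetric] abs_mult)
        also have "\<dots> \<le> k * (r * B)"
          using B(2)[of "u - s"] u(2) B(1) k
          by (intro mult_left_mono) (auto intro: order_trans mult_right_mono less_imp_le)
        finally show ?thesis by (simp add: algebra_simps)
      qed
      have "norm (f y - f x - F (y - x)) = \<bar>f (x + k *\<^sub>R s) - f x - k * F s\<bar>"
        by (simp add: ks F.scaleR)
      also have "\<dots> \<le> e / 2 * k + (L * (k * r) + B * (k * r))"
        using 1 2 3 by linarith
      also have "\<dots> = e / 2 * k + (L + B) * r * k" by (simp add: algebra_simps)
      also have "\<dots> = e * k" unfolding r(2) by simp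
      finally show ?thesis by (simp add: k_def)
    qed (simp add: F.zero)
  qed
qed

text \<open>Outside one null set all rational directional derivatives exist and are additive. Being
  homogeneous over the rationals as well, they are the restriction of a real linear map, the one
  determined by their values on \<open>Basis\<close>.\<close>

lemma AE_differentiable_lipschitz_real:
  fixes f :: "'a::euclidean_space \<Rightarrow> real"
  assumes lip: "L-lipschitz_on UNIV f"
  shows "AE x in lborel. f differentiable (at x)"
proof -
  define D where "D = {u::'a. \<forall>b\<in>Basis. u \<bullet> b \<in> \<rat>}"
  have cD: "countable D" unfolding D_def by (rule countable_rational_vectors)
  have "AE x in lborel. \<forall>u\<in>D. \<exists>y. dir_deriv f x u y"
    using cD AE_dir_deriv_exists[OF lip] by (subst AE_ball_countable) auto
  moreover have "AE x in lborel. \<forall>u\<in>D. \<forall>v\<in>D. \<forall>y z w. dir_deriv f x u y \<longrightarrow> dir_deriv f x v z \<longrightarrow> dir_deriv f x (u + v) w \<longrightarrow> w = y + z"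
    using cD AE_dir_deriv_add[OF lip] by (simp add: AE_ball_countable)
  ultimately show ?thesis
  proof eventually_elim
    case (elim x)
    obtain g where g: "\<And>u. u \<in> D \<Longrightarrow> dir_deriv f x u (g u)" using elim(1) by metis
    have add: "g (u + v) = g u + g v" if "u \<in> D" "v \<in> D" for u v
    proof -
      have "u + v \<in> D" using that by (auto simp: D_def inner_add_left)
      then show ?thesis using elim(2) g that by blast
    qed
    have scale: "g (c *\<^sub>R u) = c * g u" if "u \<in> D" "c \<in> \<rat>" for u c
    proof -
      have "c *\<^sub>R u \<in> D" using that by (auto simp: D_def)
      then show ?thesis using dir_deriv_unique[OF g dir_deriv_scale[OF g[OF that(1)]]] by blast
    qed
    have BD: "b \<in> D" if "b \<in> Basis" for b using that by (auto simp: D_def inner_Basis)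
    define F where "F = (\<lambda>h. \<Sum>b\<in>Basis. (h \<bullet> b) * g b)"
    have F: "bounded_linear F"
      unfolding F_def by (intro bounded_linear_sum bounded_linear_compose[OF bounded_linear_mult_left bounded_linear_inner_left])
    have sum: "g (\<Sum>b\<in>B. (u \<bullet> b) *\<^sub>R b) = (\<Sum>b\<in>B. (u \<bullet> b) * g b) \<and> (\<Sum>b\<in>B. (u \<bullet> b) *\<^sub>R b) \<in> D"
      if "finite B" "B \<subseteq> Basis" "u \<in> D" for u B
      using that(1,2)
    proof induction
      case empty
      have "0 \<in> D" by (simp add: D_def)
      then show ?case using scale[of 0 0] by simp
    next
      case (insert b B)
      have uq: "u \<bullet> b \<in> \<rat>" using that(3) insert by (auto simp: D_def)
      then have D: "(u \<bullet> b) *\<^sub>R b \<in> D" using insert by (auto simp: D_def inner_Basis)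
      moreover have "(u \<bullet> b) *\<^sub>R b + (\<Sum>b\<in>B. (u \<bullet> b) *\<^sub>R b) \<in> D"
        using D insert by (auto simp: D_def inner_add_left)
      ultimately show ?case
        using insert add[OF D, of "\<Sum>b\<in>B. (u \<bullet> b) *\<^sub>R b"] scale[OF BD uq] by auto
    qed
    have "g u = F u" if "u \<in> D" for u
      using sum[OF finite_Basis order_refl that] by (simp add: euclidean_representation F_def)
    then have "(f has_derivative F) (at x)"
      using g by (intro has_derivative_if_dir_derivs[OF lip F]) (auto simp: D_def)
    then show ?case by (auto simp: differentiable_def)
  qed
qed

lemma Rademacher:
  fixes f :: "'a::euclidean_space \<Rightarrow> 'b::euclidean_space"
  assumes lip: "L-lipschitz_on UNIV f"
  shows "negligible {x. \<not> f differentiable (at x)}"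
proof -
  have "AE x in lborel. (\<lambda>x. f x \<bullet> b) differentiable (at x)" if "b \<in> Basis" for b
  proof (rule AE_differentiable_lipschitz_real)
    show "L-lipschitz_on UNIV (\<lambda>x. f x \<bullet> b)"
    proof (rule lipschitz_onI)
      fix x y
      have "dist (f x \<bullet> b) (f y \<bullet> b) = \<bar>(f x - f y) \<bullet> b\<bar>" by (simp add: dist_real_def inner_diff_left)
      also have "\<dots> \<le> norm (f x - f y)" by (rule Basis_le_norm[OF that])
      also have "\<dots> \<le> L * dist x y" using lipschitz_onD[OF lip, of x y] by (simp add: dist_norm)
      finally show "dist (f x \<bullet> b) (f y \<bullet> b) \<le> L * dist x y" .
    qed (rule lipschitz_on_nonneg[OF lip])
  qed
  then have "AE x in lborel. \<forall>b\<in>Basis. (\<lambda>x. f x \<bullet> b) differentiable (at x)"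
    by (subst AE_ball_countable) (auto intro: countable_finite)
  then have "AE x in lborel. f differentiable (at x)"
    by eventually_elim (rule iffD2[OF differentiable_componentwise_within])
  then have "AE x in lebesgue. f differentiable (at x)" by (rule AE_completion)
  then show ?thesis
    unfolding eventually_ae_filter_negligible using negligible_subset by blast
qed

section \<open>Ordinary differential equations with small initial velocity\<close>

text \<open>Integrating from \<open>-1\<close> avoids oriented integrals for \<open>t < 0\<close>.\<close>

definition prim :: "(real \<Rightarrow> 'a::euclidean_space) \<Rightarrow> real \<Rightarrow> 'a" where
  "prim h t = integral {-1..t} h - integral {-1..0} h"

lemma prim_0 [simp]: "prim h 0 = 0"
  by (simp add: prim_def)

lemma integrable_on_initial:
  fixes h :: "real \<Rightarrow> 'a::euclidean_space"
  assumes "continuous_on {-1..2} h" "t \<in> {-1..2}"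
  shows "h integrable_on {-1..t}"
  using assms by (intro integrable_continuous_real) (auto elim: continuous_on_subset)

lemma prim_deriv:
  fixes h :: "real \<Rightarrow> 'a::euclidean_space"
  assumes "continuous_on {-1..2} h" "t \<in> {-1<..<2}"
  shows "(prim h has_vector_derivative h t) (at t)"
proof -
  have "((\<lambda>u. integral {-1..u} h) has_vector_derivative h t) (at t within {-1..2})"
    using assms by (intro integral_has_vector_derivative) auto
  then have "((\<lambda>u. integral {-1..u} h) has_vector_derivative h t) (at t within {-1<..<2})"
    by (rule has_vector_derivative_within_subset) auto
  then have "((\<lambda>u. integral {-1..u} h) has_vector_derivative h t) (at t)"
    unfolding at_within_open[OF assms(2) open_greaterThanLessThan] .
  then show ?thesis unfolding prim_def
    by (auto intro!: derivative_eq_intros)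
qed

lemma prim_continuous:
  fixes h :: "real \<Rightarrow> 'a::euclidean_space"
  assumes "continuous_on {-1..2} h"
  shows "continuous_on {-1..2} (prim h)"
  unfolding prim_def using assms
  by (intro continuous_intros indefinite_integral_continuous_1 integrable_continuous_real)

lemma prim_diff:
  fixes h k :: "real \<Rightarrow> 'a::euclidean_space"
  assumes "continuous_on {-1..2} h" "continuous_on {-1..2} k" "t \<in> {-1..2}"
  shows "prim h t - prim k t = prim (\<lambda>s. h s - k s) t"
  unfolding prim_def using assms
  by (subst (1 2) integral_diff) (auto intro: integrable_on_initial)

text \<open>The two integrals extend over intervals of lengths at most 3 and 1. The factor 4 enters
  all constants of \<open>ode_exists\<close>.\<close>

lemma prim_bound:
  fixes h :: "real \<Rightarrow> 'a::euclidean_space"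
  assumes "continuous_on {-1..2} h" "t \<in> {-1..2}" "\<And>s. s \<in> {-1..2} \<Longrightarrow> norm (h s) \<le> B"
  shows "norm (prim h t) \<le> 4 * B"
proof -
  have B: "0 \<le> B" using order_trans[OF norm_ge_zero assms(3)[of 0]] by simp
  have "norm (integral {-1..s} h) \<le> B * (s - (-1))" if "s \<in> {-1..2}" for s
    using assms that by (intro integral_bound) (auto elim: continuous_on_subset)
  from this[of t] this[of 0]
  have "norm (prim h t) \<le> B * (t + 1) + B * 1"
    unfolding prim_def using assms(2) by (intro order_trans[OF norm_triangle_ineq4]) auto
  also have "\<dots> = B * (t + 2)" by (simp add: algebra_simps)
  also have "\<dots> \<le> B * 4" using B assms(2) by (intro mult_left_mono) auto
  finally show ?thesis by simp
qed

lemma prim_const: "t \<in> {-1..2} \<Longrightarrow> prim (\<lambda>_. c) t = t *\<^sub>R c"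
  by (simp add: prim_def algebra_simps)

text \<open>The unknown is the velocity, a fixed point of
  \<open>u = v + prim (Q (x0 + prim u) u)\<close>. For velocities of size at most
  \<open>r \<le> 1\<close> the hypothesis makes \<open>Q\<close> Lipschitz with a constant of order
  \<open>r\<close>. Hence small velocities, instead of a short time, make the map a contraction, on
  a fixed interval with \<open>{0..1}\<close> in its interior.\<close>

lemma ode_exists:
  fixes Q :: "'a::euclidean_space \<Rightarrow> 'a \<Rightarrow> 'a"
  assumes R: "0 < R" and M: "0 \<le> M"
    and QL: "\<And>r x y u w. \<lbrakk>0 \<le> r; x \<in> cball x0 R; y \<in> cball x0 R; norm u \<le> r; norm w \<le> r\<rbrakk>
      \<Longrightarrow> norm (Q x u - Q y w) \<le> M * (r * r * norm (x - y) + r * norm (u - w))"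
    and Q0: "Q x0 0 = 0"
  obtains \<rho> X U where "0 < \<rho>"
    "\<And>v t. \<lbrakk>norm v \<le> \<rho>; t \<in> {-1..2}\<rbrakk> \<Longrightarrow> norm (X v t - x0) \<le> R \<and> norm (X v t - x0) \<le> 8 * norm v \<and> norm (U v t) \<le> 2 * norm v"
    "\<And>v. norm v \<le> \<rho> \<Longrightarrow> X v 0 = x0 \<and> U v 0 = v"
    "\<And>v t. \<lbrakk>norm v \<le> \<rho>; t \<in> {-1<..<2}\<rbrakk> \<Longrightarrow>
       (X v has_vector_derivative U v t) (at t) \<and> (U v has_vector_derivative Q (X v t) (U v t)) (at t)"
    "\<And>v w t. \<lbrakk>norm v \<le> \<rho>; norm w \<le> \<rho>; t \<in> {-1..2}\<rbrakk> \<Longrightarrow>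
       norm (U v t - U w t) \<le> 2 * norm (v - w) \<and> norm (X v t - X w t) \<le> 8 * norm (v - w)"
    "\<And>v w. \<lbrakk>norm v \<le> \<rho>; norm w \<le> \<rho>\<rbrakk> \<Longrightarrow> norm (X v 1 - X w 1 - (v - w)) \<le> norm (v - w) / 2"
proof -
  \<comment> \<open>\<open>4 * r \<le> R\<close> keeps the positions in the ball,
    \<open>r \<le> 1\<close> absorbs \<open>r * r\<close> into \<open>r\<close>, and
    \<open>320 * (M * r) \<le> 1\<close> turns the factor \<open>20 * (M * r)\<close> below into
    \<open>1 / 16\<close>. The \<open>M + 1\<close> allows for \<open>M = 0\<close>.\<close>
  define r where "r = min 1 (min (R / 4) (1 / (320 * (M + 1))))"
  have r: "0 < r" "r \<le> 1" "4 * r \<le> R" using R M by (auto simp: r_def)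
  have "r \<le> 1 / (320 * (M + 1))" by (simp add: r_def)
  then have "r * (320 * (M + 1)) \<le> 1" using M by (simp add: pos_le_divide_eq)
  then have Mr: "320 * (M * r) \<le> 1" using r by (simp add: algebra_simps)
  have Mr0: "0 \<le> M * r" using M r by simp
  define I where I: "I = {-1..2::real}"
  define adm where "adm = (\<lambda>u::real \<Rightarrow> 'a. continuous_on I u \<and> (\<forall>t\<in>I. norm (u t) \<le> r))"
  define q where "q = (\<lambda>u s. Q (x0 + prim u s) (u s))"
  have pb: "x0 + prim u s \<in> cball x0 R" if "adm u" "s \<in> I" for u s
    using prim_bound[of u s r] that r unfolding adm_def I by (auto simp: dist_norm)
  have QL': "norm (Q x u - Q y w) \<le> M * r * (norm (x - y) + norm (u - w))"
    if "x \<in> cball x0 R" "y \<in> cball x0 R" "norm u \<le> r" "norm w \<le> r" for x y u w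
  proof -
    have "r * r * norm (x - y) \<le> r * 1 * norm (x - y)" using r by (intro mult_right_mono mult_left_mono) auto
    then have "M * (r * r * norm (x - y) + r * norm (u - w)) \<le> M * (r * norm (x - y) + r * norm (u - w))"
      using M by (intro mult_left_mono add_right_mono) auto
    with QL[OF less_imp_le[OF r(1)] that] show ?thesis by (simp add: algebra_simps)
  qed
  have qdiff: "norm (q u s - q w s) \<le> M * r * (norm (prim u s - prim w s) + norm (u s - w s))"
    if "adm u" "adm w" "s \<in> I" for u w s
    unfolding q_def using QL'[of "x0 + prim u s" "x0 + prim w s" "u s" "w s"] pb that by (auto simp: adm_def)
  have qcont: "continuous_on I (q u)" if "adm u" for u
  proof -
    have QC: "continuous_on (cball x0 R \<times> cball 0 r) (\<lambda>z::'a \<times> 'a. Q (fst z) (snd z))"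
    proof (rule lipschitz_on_continuous_on[OF lipschitz_onI])
      fix z z' :: "'a \<times> 'a" assume z: "z \<in> cball x0 R \<times> cball 0 r" "z' \<in> cball x0 R \<times> cball 0 r"
      have "norm (Q (fst z) (snd z) - Q (fst z') (snd z')) \<le> M * r * (norm (fst z - fst z') + norm (snd z - snd z'))"
        using z by (intro QL') auto
      also have "\<dots> \<le> M * r * (dist z z' + dist z z')"
        using Mr0 dist_fst_le[of z z'] dist_snd_le[of z z'] by (intro mult_left_mono add_mono) (auto simp: dist_norm)
      finally show "dist (Q (fst z) (snd z)) (Q (fst z') (snd z')) \<le> 2 * (M * r) * dist z z'"
        by (simp add: dist_norm algebra_simps)
    qed (use Mr0 in simp)
    have "continuous_on I (\<lambda>s. (x0 + prim u s, u s))"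
      using that prim_continuous[of u] unfolding adm_def I by (intro continuous_intros) auto
    moreover have "(\<lambda>s. (x0 + prim u s, u s)) ` I \<subseteq> cball x0 R \<times> cball 0 r"
      using pb[OF that] that by (auto simp: adm_def)
    ultimately show ?thesis
      using continuous_on_compose2[OF QC] by (fastforce simp: q_def)
  qed
  \<comment> \<open>\<open>20 = 4 * (4 + 1)\<close>: the positions differ by at most
    \<open>4 * D\<close>, the velocities by at most \<open>D\<close>, and integrating
    \<open>q u - q w\<close> costs another factor 4.\<close>
  have pq: "norm (prim (q u) t - prim (q w) t) \<le> 20 * (M * r) * D"
    if adm: "adm u" "adm w" and t: "t \<in> I" and D: "\<And>s. s \<in> I \<Longrightarrow> norm (u s - w s) \<le> D" for u w t D
  proof -
    have pD: "norm (prim u s - prim w s) \<le> 4 * D" if s: "s \<in> I" for s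
    proof -
      have "prim u s - prim w s = prim (\<lambda>s. u s - w s) s"
        using adm s by (intro prim_diff) (auto simp: adm_def I)
      then show ?thesis
        using adm s D by (auto simp: adm_def I intro!: prim_bound continuous_intros)
    qed
    have "prim (q u) t - prim (q w) t = prim (\<lambda>s. q u s - q w s) t"
      using adm t qcont by (intro prim_diff) (auto simp: I)
    also have "norm \<dots> \<le> 4 * (M * r * (5 * D))"
    proof (rule prim_bound)
      show "continuous_on {-1..2} (\<lambda>s. q u s - q w s)"
        using qcont adm unfolding I by (intro continuous_intros) auto
      fix s :: real assume "s \<in> {-1..2}"
      then have s: "s \<in> I" by (simp add: I)
      have "norm (q u s - q w s) \<le> M * r * (norm (prim u s - prim w s) + norm (u s - w s))"
        by (rule qdiff[OF adm s])
      also have "\<dots> \<le> M * r * (5 * D)"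
        using pD[OF s] D[OF s] Mr0 by (intro mult_left_mono) auto
      finally show "norm (q u s - q w s) \<le> M * r * (5 * D)" .
    qed (use t in \<open>simp add: I\<close>)
    finally show ?thesis by simp
  qed
  have adm0: "adm (\<lambda>_. 0)" using r by (simp add: adm_def)
  \<comment> \<open>Has the form of the fixed point equation with initial velocity \<open>0\<close>,
    so that the zero solution can be compared with others in \<open>fixed_diff\<close>.\<close>
  have pq0: "0 = 0 + prim (q (\<lambda>_. 0)) t" if t: "t \<in> I" for t
  proof -
    have "norm (prim (q (\<lambda>_. 0)) t) \<le> 4 * 0"
      using qcont[OF adm0] t Q0 by (intro prim_bound) (auto simp: q_def prim_const I)
    then show ?thesis by simp
  qed
  \<comment> \<open>The bound \<open>r / 2\<close> on \<open>v\<close> leaves the other half of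
    \<open>r\<close> to the integral.\<close>
  have ex: "\<exists>u. adm u \<and> (\<forall>t\<in>I. u t = v + prim (q u) t)" if v: "norm v \<le> r / 2" for v
  proof -
    \<comment> \<open>A closed ball in the complete space of bounded continuous functions on the
      whole line. Functions on \<open>I\<close> are extended to it by \<open>clamp\<close>, constant
      on either side of \<open>I\<close>.\<close>
    define S where "S = {u :: real \<Rightarrow>\<^sub>C 'a. \<forall>t. norm (apply_bcontfun u t) \<le> r}"
    have admS: "adm (apply_bcontfun u)" if "u \<in> S" for u
      using that by (auto simp: S_def adm_def intro: continuous_on_subset[OF continuous_on_apply_bcontfun])
    have "\<exists>u'. \<forall>t. apply_bcontfun u' t = v + prim (q (apply_bcontfun u)) (clamp (-1) 2 t)" if "u \<in> S" for u
    proof -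
      have "continuous_on (cbox (-1) 2) (\<lambda>t. v + prim (q (apply_bcontfun u)) t)"
        using prim_continuous[of "q (apply_bcontfun u)"] qcont[OF admS[OF that]] unfolding I
        by (auto intro!: continuous_intros)
      then show ?thesis by (rule continuous_on_cbox_bcontfunE) blast
    qed
    then obtain T where T: "\<And>u t. u \<in> S \<Longrightarrow> apply_bcontfun (T u) t = v + prim (q (apply_bcontfun u)) (clamp (-1) 2 t)"
      by metis
    have cl: "clamp (-1) 2 t \<in> I" for t :: real using clamp_in_interval[of "-1" "2::real" t] by (simp add: I)
    have "\<exists>!u. u \<in> S \<and> T u = u"
    proof (rule Banach_fix[of S "1/2" T])
      have "u \<in> S \<longleftrightarrow> norm u \<le> r" for u
      proof
        show "norm u \<le> r" if "u \<in> S" using that unfolding S_def by (intro norm_bound) blast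
        show "u \<in> S" if "norm u \<le> r" unfolding S_def using order_trans[OF norm_bounded that] by blast
      qed
      then have "S = cball 0 r" unfolding set_eq_iff mem_cball_0 by blast
      then show "complete S" "S \<noteq> {}" using r by (simp_all add: complete_eq_closed)
      show "T ` S \<subseteq> S"
      proof clarify
        fix u assume u: "u \<in> S"
        have "norm (apply_bcontfun (T u) t) \<le> r" for t
        proof -
          have "norm (prim (q (apply_bcontfun u)) (clamp (-1) 2 t) - prim (q (\<lambda>_. 0)) (clamp (-1) 2 t)) \<le> 20 * (M * r) * r"
            using u by (intro pq[OF admS[OF u] adm0 cl]) (auto simp: S_def)
          also have "20 * (M * r) * r \<le> (1 / 2) * r" using Mr r by (intro mult_right_mono) auto
          finally have "norm (prim (q (apply_bcontfun u)) (clamp (-1) 2 t)) \<le> r / 2" using pq0[OF cl, of t] by simp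
          then show ?thesis unfolding T[OF u] using v by (intro norm_triangle_le) linarith
        qed
        then show "T u \<in> S" by (simp add: S_def)
      qed
      fix u w assume uw: "u \<in> S" "w \<in> S"
      show "dist (T u) (T w) \<le> 1 / 2 * dist u w"
      proof (rule dist_bound)
        fix t
        have "dist (apply_bcontfun (T u) t) (apply_bcontfun (T w) t)
          = norm (prim (q (apply_bcontfun u)) (clamp (-1) 2 t) - prim (q (apply_bcontfun w)) (clamp (-1) 2 t))"
          by (simp add: T uw dist_norm)
        also have "\<dots> \<le> 20 * (M * r) * dist u w"
          using dist_bounded[of u _ w] by (intro pq admS uw cl) (simp add: dist_norm)
        also have "\<dots> \<le> 1 / 2 * dist u w" using Mr by (intro mult_right_mono) auto
        finally show "dist (apply_bcontfun (T u) t) (apply_bcontfun (T w) t) \<le> 1 / 2 * dist u w" .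
      qed
    qed auto
    then obtain u where u: "u \<in> S" "T u = u" by blast
    have "apply_bcontfun u t = v + prim (q (apply_bcontfun u)) t" if "t \<in> I" for t
      using T[OF u(1), of t] that clamp_cancel_cbox[of t "-1" 2] unfolding u(2) I by simp
    then show ?thesis using admS[OF u(1)] by blast
  qed
  then obtain U where U: "\<And>v. norm v \<le> r / 2 \<Longrightarrow> adm (U v)"
    "\<And>v t. norm v \<le> r / 2 \<Longrightarrow> t \<in> I \<Longrightarrow> U v t = v + prim (q (U v)) t" by metis
  define X where "X = (\<lambda>v t. x0 + prim (U v) t)"
  have compI: "compact I" "I \<noteq> {}" "0 \<in> I" "1 \<in> I" by (auto simp: I)
  \<comment> \<open>At a time \<open>s\<close> of maximal distance \<open>d\<close> between the
    solutions, \<open>d \<le> norm (v - w) + d / 16\<close>, hence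
    \<open>d \<le> 2 * norm (v - w)\<close>, and \<open>2 / 16\<close> is the \<open>1 / 8\<close>.
    Integration up to time \<open>1\<close>, with the factor 4 of \<open>prim_bound\<close>, turns
    this \<open>1 / 8\<close> into the \<open>1 / 2\<close> of the last claim.\<close>
  have fixed_diff: "norm (x t - y t) \<le> 2 * norm (v - w) \<and> norm (x t - y t - (v - w)) \<le> norm (v - w) / 8"
    if adm: "adm x" "adm y" and fx: "\<And>t. t \<in> I \<Longrightarrow> x t = v + prim (q x) t" "\<And>t. t \<in> I \<Longrightarrow> y t = w + prim (q y) t"
      and t: "t \<in> I" for x y v w t
  proof -
    have "continuous_on I (\<lambda>t. norm (x t - y t))" using adm by (auto simp: adm_def intro!: continuous_intros)
    then obtain s where s: "s \<in> I" "\<And>t. t \<in> I \<Longrightarrow> norm (x t - y t) \<le> norm (x s - y s)"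
      using continuous_attains_sup[OF compI(1,2)] by blast
    have eq: "x t - y t - (v - w) = prim (q x) t - prim (q y) t" if "t \<in> I" for t
      using fx[OF that] by simp
    have est: "norm (x t - y t - (v - w)) \<le> 1 / 16 * norm (x s - y s)" if t: "t \<in> I" for t
    proof -
      have "norm (x t - y t - (v - w)) \<le> 20 * (M * r) * norm (x s - y s)"
        unfolding eq[OF t] by (rule pq[OF adm t s(2)])
      also have "\<dots> \<le> 1 / 16 * norm (x s - y s)" using Mr by (intro mult_right_mono) auto
      finally show ?thesis .
    qed
    have "norm (x s - y s) \<le> norm (v - w) + norm (x s - y s - (v - w))"
      using norm_triangle_ineq[of "v - w" "x s - y s - (v - w)"] by simp
    then have "norm (x s - y s) \<le> 2 * norm (v - w)" using est[OF s(1)] norm_ge_zero[of "v - w"] by linarith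
    then show ?thesis using s(2)[OF t] est[OF t] by linarith
  qed
  have UL: "norm (U v t - U w t) \<le> 2 * norm (v - w) \<and> norm (U v t - U w t - (v - w)) \<le> norm (v - w) / 8"
    if "norm v \<le> r / 2" "norm w \<le> r / 2" "t \<in> I" for v w t
    by (rule fixed_diff) (use U that in auto)
  have Ub: "norm (U v t) \<le> 2 * norm v" if "norm v \<le> r / 2" "t \<in> I" for v t
    using fixed_diff[of "U v" "\<lambda>_. 0" v 0 t] U adm0 pq0 that by simp
  have Xb: "norm (X v t - x0) \<le> 8 * norm v" if v: "norm v \<le> r / 2" and t: "t \<in> I" for v t
    using prim_bound[of "U v" t "2 * norm v"] U(1)[OF v] t Ub[OF v] by (simp add: X_def adm_def I)
  have XL: "norm (X v t - X w t) \<le> 8 * norm (v - w)"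
    if v: "norm v \<le> r / 2" and w: "norm w \<le> r / 2" and t: "t \<in> I" for v w t
  proof -
    have "X v t - X w t = prim (\<lambda>s. U v s - U w s) t"
      using prim_diff[of "U v" "U w" t] U(1)[OF v] U(1)[OF w] t by (simp add: X_def adm_def I)
    moreover have "norm (prim (\<lambda>s. U v s - U w s) t) \<le> 4 * (2 * norm (v - w))"
      using U(1)[OF v] U(1)[OF w] t UL[OF v w] unfolding I adm_def
      by (intro prim_bound) (auto intro!: continuous_intros)
    ultimately show ?thesis by simp
  qed
  show thesis
  proof (rule that[of "r / 2" X U, folded I])
    show "norm (X v t - x0) \<le> R \<and> norm (X v t - x0) \<le> 8 * norm v \<and> norm (U v t) \<le> 2 * norm v"
      if "norm v \<le> r / 2" "t \<in> I" for v t
      using Xb[OF that] Ub[OF that] that r by simp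
    show "X v 0 = x0 \<and> U v 0 = v" if "norm v \<le> r / 2" for v
      using U(2)[OF that compI(3)] by (simp add: X_def)
    show "(X v has_vector_derivative U v t) (at t) \<and> (U v has_vector_derivative Q (X v t) (U v t)) (at t)"
      if v: "norm v \<le> r / 2" and t: "t \<in> {-1<..<2}" for v t
    proof
      have "(prim (U v) has_vector_derivative U v t) (at t)"
        using U(1)[OF v] t by (intro prim_deriv) (auto simp: adm_def I)
      then show "(X v has_vector_derivative U v t) (at t)"
        unfolding X_def by (auto intro!: derivative_eq_intros)
      have "(prim (q (U v)) has_vector_derivative q (U v) t) (at t)"
        using qcont[OF U(1)[OF v]] t by (intro prim_deriv) (auto simp: I)
      then have *: "((\<lambda>t. v + prim (q (U v)) t) has_vector_derivative q (U v) t) (at t)"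
        by (auto intro!: derivative_eq_intros)
      have "(U v has_vector_derivative q (U v) t) (at t)"
        by (rule has_vector_derivative_transform_within_open[OF * open_greaterThanLessThan t])
           (use U(2)[OF v] in \<open>auto simp: I\<close>)
      then show "(U v has_vector_derivative Q (X v t) (U v t)) (at t)"
        by (simp add: q_def X_def)
    qed
    show "norm (X v 1 - X w 1 - (v - w)) \<le> norm (v - w) / 2"
      if v: "norm v \<le> r / 2" and w: "norm w \<le> r / 2" for v w
    proof -
      have adm: "continuous_on {-1..2} (U v)" "continuous_on {-1..2} (U w)"
        using U(1)[OF v] U(1)[OF w] by (auto simp: adm_def I)
      have "X v 1 - X w 1 - (v - w) = prim (\<lambda>s. U v s - U w s) 1 - prim (\<lambda>_. v - w) 1"
        using prim_diff[OF adm, of 1] by (simp add: X_def prim_const)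
      also have "\<dots> = prim (\<lambda>s. U v s - U w s - (v - w)) 1"
        using adm by (intro prim_diff continuous_intros) auto
      also have "norm \<dots> \<le> 4 * (norm (v - w) / 8)"
        using adm UL[OF v w] by (intro prim_bound continuous_intros) (auto simp: I)
      finally show ?thesis by simp
    qed
  qed (use r UL XL in auto)
qed

text \<open>Where the distance of the two solutions is maximal on the ball, the mean value
  inequality from \<open>t0\<close> bounds it by \<open>e * L\<close> times itself.\<close>

lemma ode_unique_local:
  fixes F :: "'a::real_normed_vector \<Rightarrow> 'a"
  assumes L: "L-lipschitz_on S F" and e: "0 < e" "e * L < 1"
    and z: "\<And>t. t \<in> cball t0 e \<Longrightarrow> (z has_vector_derivative F (z t)) (at t) \<and> z t \<in> S"
    and y: "\<And>t. t \<in> cball t0 e \<Longrightarrow> (y has_vector_derivative F (y t)) (at t) \<and> y t \<in> S"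
    and eq: "z t0 = y t0" and t: "t \<in> cball t0 e"
  shows "z t = y t"
proof -
  let ?d = "\<lambda>t. z t - y t"
  have d: "(?d has_derivative (\<lambda>h. h *\<^sub>R (F (z t) - F (y t)))) (at t within cball t0 e)" if "t \<in> cball t0 e" for t
  proof -
    have "(?d has_vector_derivative (F (z t) - F (y t))) (at t)"
      using z[OF that] y[OF that] by (intro has_vector_derivative_diff) simp_all
    then show ?thesis unfolding has_vector_derivative_def by (rule has_derivative_at_withinI)
  qed
  have "continuous_on (cball t0 e) ?d"
    by (rule has_derivative_continuous_on[OF d])
  then have "continuous_on (cball t0 e) (\<lambda>t. norm (?d t))" by (rule continuous_on_norm)
  then obtain s where s: "s \<in> cball t0 e" "\<And>t. t \<in> cball t0 e \<Longrightarrow> norm (?d t) \<le> norm (?d s)"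
    using continuous_attains_sup[of "cball t0 e"] e by fastforce
  have L0: "0 \<le> L" by (rule lipschitz_on_nonneg[OF L])
  have "norm (?d s - ?d t0) \<le> (L * norm (?d s)) * norm (s - t0)"
  proof (rule differentiable_bound[OF convex_cball d _ s(1)])
    fix t assume t: "t \<in> cball t0 e"
    have "norm (F (z t) - F (y t)) \<le> L * norm (?d t)"
      using lipschitz_on_normD[OF L] z[OF t] y[OF t] by blast
    also have "\<dots> \<le> L * norm (?d s)" using s(2)[OF t] L0 by (rule mult_left_mono)
    finally show "onorm (\<lambda>h. h *\<^sub>R (F (z t) - F (y t))) \<le> L * norm (?d s)"
      by (simp add: onorm_scaleR_left[OF bounded_linear_ident] onorm_id)
  qed (use e in auto)
  also have "\<dots> \<le> (L * norm (?d s)) * e"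
    using s(1) L0 by (intro mult_left_mono) (auto simp: dist_norm norm_minus_commute)
  finally have "norm (?d s) \<le> (e * L) * norm (?d s)" using eq by (simp add: algebra_simps)
  then have "norm (?d s) * (1 - e * L) \<le> 0" by (simp add: algebra_simps)
  then have "norm (?d s) \<le> 0" using e(2) unfolding mult_le_0_iff by linarith
  then have "norm (?d t) \<le> 0" using s(2)[OF t] by linarith
  then show ?thesis by simp
qed

section \<open>Metrics of class C(1,1) in coordinates\<close>

definition mform :: "real^'n^'n \<Rightarrow> real^'n \<Rightarrow> real^'n \<Rightarrow> real" where
  "mform B v w = v \<bullet> (B *v w)"

lemma mform_sum: "mform B v w = (\<Sum>i\<in>UNIV. \<Sum>j\<in>UNIV. v $ i * B $ i $ j * w $ j)"
  by (simp add: mform_def inner_vec_def matrix_vector_mult_def sum_distrib_left mult.assoc)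

lemma mform_sym: "(\<And>i j. B $ i $ j = B $ j $ i) \<Longrightarrow> mform B v w = mform B w v"
  unfolding mform_sum by (subst sum.swap) (simp add: mult_ac)

lemma norm_matrix_vector_le: "norm (B *v (w::real^'n)) \<le> norm (B::real^'n^'m) * norm w"
proof -
  have "norm (B *v w) = L2_set (\<lambda>i. \<bar>B $ i \<bullet> w\<bar>) UNIV"
    by (simp add: norm_vec_def matrix_vector_mul_component)
  also have "\<dots> \<le> L2_set (\<lambda>i. norm (B $ i) * norm w) UNIV"
    by (intro L2_set_mono Cauchy_Schwarz_ineq2) auto
  also have "\<dots> = norm B * norm w"
    by (simp add: L2_set_left_distrib norm_vec_def)
  finally show ?thesis .
qed

lemma mform_bound: "\<bar>mform B v w\<bar> \<le> norm B * norm v * norm w"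
proof -
  have "\<bar>mform B v w\<bar> \<le> norm v * norm (B *v w)"
    unfolding mform_def by (rule Cauchy_Schwarz_ineq2)
  also have "\<dots> \<le> norm v * (norm B * norm w)"
    by (intro mult_left_mono norm_matrix_vector_le) auto
  finally show ?thesis by (simp add: mult_ac)
qed

lemma mform_linear:
  "mform (B + C) v w = mform B v w + mform C v w" "mform (B - C) v w = mform B v w - mform C v w"
  "mform (a *\<^sub>R B) v w = a * mform B v w"
  "mform B (v + v') w = mform B v w + mform B v' w" "mform B (v - v') w = mform B v w - mform B v' w"
  "mform B (a *\<^sub>R v) w = a * mform B v w"
  "mform B v (w + w') = mform B v w + mform B v w'" "mform B v (w - w') = mform B v w - mform B v w'"
  "mform B v (a *\<^sub>R w) = a * mform B v w"
  unfolding mform_sum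
  by (simp_all add: algebra_simps sum.distrib sum_subtractf sum_distrib_left)

lemma bounded_bilinear_matrix_vector: "bounded_bilinear (\<lambda>(B::real^'n^'m) (w::real^'n). B *v w)"
proof (rule bounded_bilinear.intro)
  show "\<exists>K. \<forall>a b. norm ((a::real^'n^'m) *v (b::real^'n)) \<le> norm a * norm b * K"
    by (rule exI[of _ 1]) (simp add: norm_matrix_vector_le)
qed (simp_all add: matrix_vector_mult_def vec_eq_iff algebra_simps sum.distrib sum_distrib_left)

lemma mform_has_derivative:
  assumes "(B has_vector_derivative B') (at t)" "(v has_vector_derivative v') (at t)" "(w has_vector_derivative w') (at t)"
  shows "((\<lambda>s. mform (B s) (v s) (w s)) has_vector_derivative
    (mform B' (v t) (w t) + mform (B t) v' (w t) + mform (B t) (v t) w')) (at t)"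
proof -
  have "((\<lambda>s. B s *v w s) has_vector_derivative (B t *v w' + B' *v w t)) (at t)"
    by (rule bounded_bilinear.has_vector_derivative[OF bounded_bilinear_matrix_vector assms(1,3)])
  from bounded_bilinear.has_vector_derivative[OF bounded_bilinear_inner assms(2) this]
  show ?thesis unfolding mform_def by (simp add: inner_add_right algebra_simps)
qed

text \<open>The derivative of \<open>G\<close> at \<open>x\<close> in direction \<open>h\<close>,
  see \<open>G_deriv\<close>. Written with partial derivatives it is linear in \<open>h\<close> by
  its form alone.\<close>

definition mderiv :: "(real^'n \<Rightarrow> real^'n^'n) \<Rightarrow> real^'n \<Rightarrow> real^'n \<Rightarrow> real^'n^'n" where
  "mderiv G x h = (\<chi> j l. \<Sum>i\<in>UNIV. h $ i * partial i (\<lambda>y. G y $ j $ l) x)"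

lemma mderiv_linear:
  "mderiv G x (u + v) = mderiv G x u + mderiv G x v" "mderiv G x (u - v) = mderiv G x u - mderiv G x v"
  "mderiv G x (a *\<^sub>R u) = a *\<^sub>R mderiv G x u"
  by (simp_all add: mderiv_def vec_eq_iff algebra_simps sum.distrib sum_subtractf sum_distrib_left)

lemma vec_as_sum_axis: "(h::real^'n) = (\<Sum>i\<in>UNIV. h $ i *\<^sub>R axis i 1)"
  by (simp add: vec_eq_iff axis_def if_distrib cong: if_cong)

lemma frechet_derivative_eq_partial:
  assumes "f differentiable (at x)"
  shows "frechet_derivative f (at x) h = (\<Sum>i\<in>UNIV. h $ i * partial i f x)"
proof -
  have "bounded_linear (frechet_derivative f (at x))"
    using assms frechet_derivative_works has_derivative_bounded_linear by blast
  then interpret D: bounded_linear "frechet_derivative f (at x)" .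
  have "frechet_derivative f (at x) h = frechet_derivative f (at x) (\<Sum>i\<in>UNIV. h $ i *\<^sub>R axis i 1)"
    using vec_as_sum_axis[of h] by simp
  then show ?thesis by (simp add: D.sum D.scaleR partial_def)
qed

lemma has_derivative_matrix:
  fixes G :: "'a::real_normed_vector \<Rightarrow> real^'n^'m"
  assumes "\<And>j l. ((\<lambda>y. G y $ j $ l) has_derivative (\<lambda>h. D h $ j $ l)) (at x)"
  shows "(G has_derivative D) (at x)"
  unfolding has_derivative_componentwise_within[of G D]
  using assms by (auto simp: Basis_vec_def inner_axis)

lemma norm_matrix_le:
  fixes B :: "real^'n^'m"
  assumes "\<And>j l. \<bar>B $ j $ l\<bar> \<le> b j l"
  shows "norm B \<le> (\<Sum>j\<in>UNIV. \<Sum>l\<in>UNIV. b j l)"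
proof -
  have "norm B \<le> (\<Sum>j\<in>UNIV. norm (B $ j))" unfolding norm_vec_def[of B] by (rule L2_set_le_sum) simp
  also have "\<dots> \<le> (\<Sum>j\<in>UNIV. \<Sum>l\<in>UNIV. b j l)"
  proof (rule sum_mono)
    fix j
    have "norm (B $ j) \<le> (\<Sum>l\<in>UNIV. \<bar>B $ j $ l\<bar>)" by (rule norm_le_l1_cart)
    also have "\<dots> \<le> (\<Sum>l\<in>UNIV. b j l)" by (rule sum_mono) (rule assms)
    finally show "norm (B $ j) \<le> (\<Sum>l\<in>UNIV. b j l)" .
  qed
  finally show ?thesis .
qed

text \<open>The acceleration of a geodesic with its index lowered: minus the Christoffel symbols of
  the first kind, contracted twice with the velocity.\<close>

definition lowered :: "(real^'n \<Rightarrow> real^'n^'n) \<Rightarrow> real^'n \<Rightarrow> real^'n \<Rightarrow> real^'n" where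
  "lowered G x u = (\<chi> l. - (1/2) * (\<Sum>i\<in>UNIV. \<Sum>j\<in>UNIV.
     (partial i (\<lambda>y. G y $ j $ l) x + partial j (\<lambda>y. G y $ i $ l) x - partial l (\<lambda>y. G y $ i $ j) x) * u $ i * u $ j))"

definition accel :: "(real^'n \<Rightarrow> real^'n^'n) \<Rightarrow> real^'n \<Rightarrow> real^'n \<Rightarrow> real^'n" where
  "accel G x u = matrix_inv (G x) *v lowered G x u"

lemma sum_rotate: "(\<Sum>j\<in>A. \<Sum>l\<in>B. \<Sum>i\<in>C. f i j l) = (\<Sum>i\<in>C. \<Sum>j\<in>A. \<Sum>l\<in>B. f i j l)"
proof -
  have "(\<Sum>j\<in>A. \<Sum>l\<in>B. \<Sum>i\<in>C. f i j l) = (\<Sum>j\<in>A. \<Sum>i\<in>C. \<Sum>l\<in>B. f i j l)"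
    by (intro sum.cong refl sum.swap)
  then show ?thesis by (simp only: sum.swap[of _ C A])
qed

lemma accel_christoffel:
  "accel (metric_matrix A g c) x u =
     (\<chi> k. - (\<Sum>i\<in>UNIV. \<Sum>j\<in>UNIV. christoffel A g c k i j x * u $ i * u $ j))"
proof -
  define S where "S = (\<lambda>i j l. partial i (\<lambda>y. metric_matrix A g c y $ j $ l) x
    + partial j (\<lambda>y. metric_matrix A g c y $ i $ l) x - partial l (\<lambda>y. metric_matrix A g c y $ i $ j) x)"
  define N where "N = matrix_inv (metric_matrix A g c x)"
  have "(\<Sum>l\<in>UNIV. N $ k $ l * (- (1/2) * (\<Sum>i\<in>UNIV. \<Sum>j\<in>UNIV. S i j l * u $ i * u $ j)))
    = - (\<Sum>i\<in>UNIV. \<Sum>j\<in>UNIV. (1/2 * (\<Sum>l\<in>UNIV. N $ k $ l * S i j l)) * u $ i * u $ j)" for k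
    using sum_rotate[of "\<lambda>l i j. 1/2 * N $ k $ l * S i j l * u $ i * u $ j" UNIV UNIV UNIV]
    by (simp add: sum_distrib_left sum_distrib_right sum_negf mult_ac)
  then show ?thesis
    by (simp add: accel_def lowered_def christoffel_def matrix_vector_mult_def vec_eq_iff S_def N_def)
qed

text \<open>Contracted twice with \<open>u\<close>, the first two of the three partial derivatives
  agree after an exchange of \<open>i\<close> and \<open>j\<close>; together with the factor
  \<open>1/2\<close> they give the second term.\<close>

lemma lowered_inner:
  "lowered G x u \<bullet> w = 1/2 * mform (mderiv G x w) u u - mform (mderiv G x u) u w"
proof -
  define P where "P = (\<lambda>i j l. partial i (\<lambda>y. G y $ j $ l) x)"
  have 1: "mform (mderiv G x a) b c = (\<Sum>i\<in>UNIV. \<Sum>j\<in>UNIV. \<Sum>l\<in>UNIV. P i j l * a $ i * b $ j * c $ l)" for a b c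
    by (subst sum_rotate[symmetric]) (simp add: mform_sum mderiv_def P_def sum_distrib_left sum_distrib_right mult_ac)
  have "lowered G x u \<bullet> w = (\<Sum>l\<in>UNIV. \<Sum>i\<in>UNIV. \<Sum>j\<in>UNIV. - (1/2) * ((P i j l + P j i l - P l i j) * u $ i * u $ j * w $ l))"
    by (simp add: lowered_def inner_vec_def P_def sum_distrib_left sum_distrib_right mult_ac)
  also have "\<dots> = - (1/2) * (\<Sum>l\<in>UNIV. \<Sum>i\<in>UNIV. \<Sum>j\<in>UNIV. P i j l * u $ i * u $ j * w $ l)
    - (1/2) * (\<Sum>l\<in>UNIV. \<Sum>i\<in>UNIV. \<Sum>j\<in>UNIV. P j i l * u $ i * u $ j * w $ l)
    + (1/2) * (\<Sum>l\<in>UNIV. \<Sum>i\<in>UNIV. \<Sum>j\<in>UNIV. P l i j * u $ i * u $ j * w $ l)"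
    by (simp add: sum_distrib_left sum.distrib[symmetric] sum_subtractf[symmetric] algebra_simps)
  also have "(\<Sum>l\<in>UNIV. \<Sum>i\<in>UNIV. \<Sum>j\<in>UNIV. P l i j * u $ i * u $ j * w $ l) = mform (mderiv G x w) u u"
    unfolding 1 by (simp add: mult_ac)
  also have "(\<Sum>l\<in>UNIV. \<Sum>i\<in>UNIV. \<Sum>j\<in>UNIV. P i j l * u $ i * u $ j * w $ l) = mform (mderiv G x u) u w"
    unfolding 1 by (rule sum_rotate[symmetric])
  also have "(\<Sum>l\<in>UNIV. \<Sum>i\<in>UNIV. \<Sum>j\<in>UNIV. P j i l * u $ i * u $ j * w $ l) = mform (mderiv G x u) u w"
    unfolding 1 by (subst sum_rotate[symmetric], subst sum.swap) (simp add: mult_ac)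
  finally show ?thesis by simp
qed

lemma matrix_inv_inverse:
  assumes "invertible (B::real^'n^'n)"
  shows "B ** matrix_inv B = mat 1" "matrix_inv B ** B = mat 1"
  using someI_ex[OF assms[unfolded invertible_def]] unfolding matrix_inv_def by auto

lemma accel_zero: "accel G x 0 = 0"
  by (simp add: accel_def lowered_def zero_vec_def[symmetric])

text \<open>The geodesic equation in Euler--Lagrange form. Its behaviour under changes of charts is
  easier to see than that of the Christoffel symbols.\<close>

lemma accel_mform:
  assumes "invertible (G x)" and sym: "\<And>i j. G x $ i $ j = G x $ j $ i"
  shows "mform (G x) (accel G x u) w = 1/2 * mform (mderiv G x w) u u - mform (mderiv G x u) u w"
proof -
  have "mform (G x) (accel G x u) w = mform (G x) w (accel G x u)" by (rule mform_sym[OF sym])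
  also have "\<dots> = w \<bullet> lowered G x u"
    by (simp add: mform_def accel_def matrix_vector_mul_assoc matrix_inv_inverse[OF assms(1)])
  finally show ?thesis by (simp add: lowered_inner inner_commute[of w])
qed

lemma accel_unique:
  assumes "invertible (G x)" and sym: "\<And>i j. G x $ i $ j = G x $ j $ i"
    and a: "\<And>w. mform (G x) a w = 1/2 * mform (mderiv G x w) u u - mform (mderiv G x u) u w"
  shows "a = accel G x u"
proof -
  have "mform (G x) w (a - accel G x u) = 0" for w
    using a[of w] accel_mform[where G=G and x=x and u=u and w=w, OF assms(1) sym]
      mform_sym[where B="G x" and v=w, OF sym] by (simp add: mform_linear)
  then have "G x *v (a - accel G x u) = 0"
    unfolding mform_def by (metis inner_eq_zero_iff)
  then have "matrix_inv (G x) *v (G x *v (a - accel G x u)) = 0" by simp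
  then show ?thesis
    by (simp add: matrix_vector_mul_assoc matrix_inv_inverse[OF assms(1)])
qed

section \<open>Uniform estimates on small balls\<close>

locale C11_metric =
  fixes \<Omega> :: "(real^'n) set" and G :: "real^'n \<Rightarrow> real^'n^'n"
  assumes open_\<Omega>: "open \<Omega>"
    and C11: "\<And>i j. C11_on \<Omega> (\<lambda>x. G x $ i $ j)"
    and sym: "\<And>x i j. x \<in> \<Omega> \<Longrightarrow> G x $ i $ j = G x $ j $ i"
    and inv: "\<And>x. x \<in> \<Omega> \<Longrightarrow> invertible (G x)"
begin

lemma G_deriv:
  assumes "x \<in> \<Omega>"
  shows "(G has_derivative mderiv G x) (at x)"
proof (rule has_derivative_matrix)
  fix j l
  have d: "(\<lambda>y. G y $ j $ l) differentiable (at x)" using C11[of j l] assms by (simp add: C11_on_def)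
  have "frechet_derivative (\<lambda>y. G y $ j $ l) (at x) = (\<lambda>h. mderiv G x h $ j $ l)"
    using frechet_derivative_eq_partial[OF d] by (auto simp: mderiv_def)
  then show "((\<lambda>y. G y $ j $ l) has_derivative (\<lambda>h. mderiv G x h $ j $ l)) (at x)"
    using d frechet_derivative_works by metis
qed

lemma accel_el:
  "x \<in> \<Omega> \<Longrightarrow> mform (G x) (accel G x u) w = 1/2 * mform (mderiv G x w) u u - mform (mderiv G x u) u w"
  using accel_mform[where G=G and x=x] inv sym by blast

lemma accel_eqI:
  "x \<in> \<Omega> \<Longrightarrow> (\<And>w. mform (G x) a w = 1/2 * mform (mderiv G x w) u u - mform (mderiv G x u) u w) \<Longrightarrow> a = accel G x u"
  using accel_unique[where G=G and x=x] inv sym by blast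

lemma G_sym: "x \<in> \<Omega> \<Longrightarrow> mform (G x) v w = mform (G x) w v"
  by (rule mform_sym) (rule sym)

lemma mderiv_lipschitz:
  assumes "x0 \<in> \<Omega>"
  obtains e L where "0 < e" "cball x0 e \<subseteq> \<Omega>" "0 \<le> L"
    "\<And>x y h. x \<in> cball x0 e \<Longrightarrow> y \<in> cball x0 e \<Longrightarrow> norm (mderiv G x h - mderiv G y h) \<le> L * norm (x - y) * norm h"
proof -
  have "\<exists>e L. 0 < e \<and> L-lipschitz_on (ball x0 e \<inter> \<Omega>) (partial i (\<lambda>y. G y $ j $ l))" for i j l
    using C11[of j l] assms unfolding C11_on_def locally_lipschitz_on_def by blast
  then obtain e L where eL: "\<And>i j l. 0 < e i j l"
    "\<And>i j l. (L i j l)-lipschitz_on (ball x0 (e i j l) \<inter> \<Omega>) (partial i (\<lambda>y. G y $ j $ l))" by metis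
  obtain e0 where e0: "0 < e0" "cball x0 e0 \<subseteq> \<Omega>" using open_\<Omega> assms open_contains_cball by blast
  \<comment> \<open>Halving the radii fits a closed ball into the open balls of
    \<open>locally_lipschitz_on\<close>.\<close>
  define d where "d = Min (insert e0 ((\<lambda>(i,j,l). e i j l / 2) ` UNIV))"
  have d: "0 < d" "d \<le> e0" "\<And>i j l. d < e i j l"
  proof -
    show "0 < d" "d \<le> e0" using e0 eL(1) by (auto simp: d_def)
    fix i j l
    have "d \<le> e i j l / 2" unfolding d_def by (rule Min_le) (auto intro!: image_eqI[of _ _ "(i,j,l)"])
    then show "d < e i j l" using eL(1)[of i j l] by simp
  qed
  have L0: "0 \<le> L i j l" for i j l using eL(2) by (rule lipschitz_on_nonneg)
  show thesis
  proof (rule that[of d "\<Sum>j\<in>UNIV. \<Sum>l\<in>UNIV. \<Sum>i\<in>UNIV. L i j l"])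
    show "0 < d" by fact
    show "cball x0 d \<subseteq> \<Omega>" using d e0 by auto
    show "0 \<le> (\<Sum>j\<in>UNIV. \<Sum>l\<in>UNIV. \<Sum>i\<in>UNIV. L i j l)" by (intro sum_nonneg L0)
    fix x y h assume x: "x \<in> cball x0 d" and y: "y \<in> cball x0 d"
    have "norm (mderiv G x h - mderiv G y h) \<le> (\<Sum>j\<in>UNIV. \<Sum>l\<in>UNIV. \<Sum>i\<in>UNIV. L i j l * norm (x - y) * norm h)"
    proof (rule norm_matrix_le)
      fix j l
      have "\<bar>(mderiv G x h - mderiv G y h) $ j $ l\<bar>
        = \<bar>\<Sum>i\<in>UNIV. (partial i (\<lambda>y. G y $ j $ l) x - partial i (\<lambda>y. G y $ j $ l) y) * h $ i\<bar>"
        by (simp add: mderiv_def sum_subtractf[symmetric] algebra_simps)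
      also have "\<dots> \<le> (\<Sum>i\<in>UNIV. \<bar>(partial i (\<lambda>y. G y $ j $ l) x - partial i (\<lambda>y. G y $ j $ l) y) * h $ i\<bar>)"
        by (rule sum_abs)
      also have "\<dots> \<le> (\<Sum>i\<in>UNIV. L i j l * norm (x - y) * norm h)"
      proof (rule sum_mono)
        fix i
        have "\<bar>partial i (\<lambda>y. G y $ j $ l) x - partial i (\<lambda>y. G y $ j $ l) y\<bar> \<le> L i j l * norm (x - y)"
          using lipschitz_on_normD[OF eL(2)[of i j l], of x y] x y d(3)[of i j l] d(2) e0 by (auto simp: subset_iff)
        then show "\<bar>(partial i (\<lambda>y. G y $ j $ l) x - partial i (\<lambda>y. G y $ j $ l) y) * h $ i\<bar> \<le> L i j l * norm (x - y) * norm h"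
          unfolding abs_mult by (intro mult_mono component_le_norm_cart) (auto intro!: mult_nonneg_nonneg L0)
      qed
      finally show "\<bar>(mderiv G x h - mderiv G y h) $ j $ l\<bar> \<le> (\<Sum>i\<in>UNIV. L i j l * norm (x - y) * norm h)" .
    qed
    then show "norm (mderiv G x h - mderiv G y h) \<le> (\<Sum>j\<in>UNIV. \<Sum>l\<in>UNIV. \<Sum>i\<in>UNIV. L i j l) * norm (x - y) * norm h"
      by (simp add: sum_distrib_right)
  qed
qed

text \<open>All estimates on one closed ball. The bound with \<open>m\<close> stands in for a bound
  on the inverse matrices. The last clause is a Taylor estimate of second order, which Lipschitz
  first derivatives provide although second derivatives need not exist.\<close>

definition controlled :: "real^'n \<Rightarrow> real \<Rightarrow> real \<Rightarrow> real \<Rightarrow> real \<Rightarrow> bool" where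
  "controlled x0 R K L m \<longleftrightarrow> 0 < R \<and> cball x0 R \<subseteq> \<Omega> \<and> 0 \<le> K \<and> 0 \<le> L \<and> 0 < m \<and>
    (\<forall>x\<in>cball x0 R. \<forall>y\<in>cball x0 R. \<forall>h.
      norm (G x) \<le> K \<and> m * norm h \<le> norm (G x *v h) \<and> norm (mderiv G x h) \<le> K * norm h \<and>
      norm (G x - G y) \<le> K * norm (x - y) \<and>
      norm (mderiv G x h - mderiv G y h) \<le> L * norm (x - y) * norm h \<and>
      norm (G y - G x - mderiv G x (y - x)) \<le> L * norm (y - x) * norm (y - x))"

lemma controlledD:
  assumes "controlled x0 R K L m"
  shows "0 < R" "cball x0 R \<subseteq> \<Omega>" "0 \<le> K" "0 \<le> L" "0 < m"
    and "x \<in> cball x0 R \<Longrightarrow> norm (G x) \<le> K" "x \<in> cball x0 R \<Longrightarrow> m * norm h \<le> norm (G x *v h)"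
    and "x \<in> cball x0 R \<Longrightarrow> norm (mderiv G x h) \<le> K * norm h"
    and "x \<in> cball x0 R \<Longrightarrow> y \<in> cball x0 R \<Longrightarrow> norm (G x - G y) \<le> K * norm (x - y)"
    and "x \<in> cball x0 R \<Longrightarrow> y \<in> cball x0 R \<Longrightarrow> norm (mderiv G x h - mderiv G y h) \<le> L * norm (x - y) * norm h"
    and "x \<in> cball x0 R \<Longrightarrow> y \<in> cball x0 R \<Longrightarrow> norm (G y - G x - mderiv G x (y - x)) \<le> L * norm (y - x) * norm (y - x)"
  using assms unfolding controlled_def by blast+

lemma controlled_exists:
  assumes "x0 \<in> \<Omega>"
  obtains R K L m where "controlled x0 R K L m"
proof -
  obtain e L where e: "0 < e" "cball x0 e \<subseteq> \<Omega>" and L: "0 \<le> L"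
    "\<And>x y h. x \<in> cball x0 e \<Longrightarrow> y \<in> cball x0 e \<Longrightarrow> norm (mderiv G x h - mderiv G y h) \<le> L * norm (x - y) * norm h"
    using mderiv_lipschitz[OF assms] by blast
  obtain B where B: "0 \<le> B" "\<And>h. norm (mderiv G x0 h) \<le> norm h * B"
    using bounded_linear.nonneg_bounded[OF has_derivative_bounded_linear[OF G_deriv[OF assms]]] by blast
  define K1 where "K1 = B + L * e"
  have K1: "0 \<le> K1" using B L e by (simp add: K1_def)
  have D: "norm (mderiv G x h) \<le> K1 * norm h" if x: "x \<in> cball x0 e" for x h
  proof -
    have "norm (mderiv G x h) \<le> norm (mderiv G x0 h) + norm (mderiv G x h - mderiv G x0 h)"
      by (metis add.commute norm_triangle_sub)
    also have "\<dots> \<le> norm h * B + L * norm (x - x0) * norm h"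
      using B(2) L(2)[OF x, of x0] e by (intro add_mono) auto
    also have "\<dots> \<le> norm h * B + L * e * norm h"
      using x L(1) by (intro add_left_mono mult_right_mono mult_left_mono) (auto simp: dist_norm norm_minus_commute)
    finally show ?thesis by (simp add: K1_def algebra_simps)
  qed
  have Gd: "(G has_derivative mderiv G x) (at x within S)" if "x \<in> cball x0 e" for x S
    by (rule has_derivative_at_withinI, rule G_deriv) (use e that in blast)
  have GL: "norm (G x - G y) \<le> K1 * norm (x - y)" if "x \<in> cball x0 e" "y \<in> cball x0 e" for x y
    using D that K1 by (intro differentiable_bound[OF convex_cball Gd]) (auto intro!: onorm_bound)
  \<comment> \<open>Mean value inequality on the segment for \<open>G\<close> minus its
    linearisation at \<open>x\<close>, whose derivative is at most \<open>L * norm (y - x)\<close>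
    there.\<close>
  have T: "norm (G y - G x - mderiv G x (y - x)) \<le> norm (y - x) * (L * norm (y - x))"
    if x: "x \<in> cball x0 e" and y: "y \<in> cball x0 e" for x y
  proof (rule differentiable_bound_linearization[where S="closed_segment x y" and a=x and b=y and f=G and f'="mderiv G" and ?x0.0=x])
    have seg: "closed_segment x y \<subseteq> cball x0 e" using x y closed_segment_subset convex_cball by blast
    show "x + t *\<^sub>R (y - x) \<in> closed_segment x y" if "t \<in> {0..1}" for t
      using that by (auto simp: in_segment algebra_simps intro!: exI[of _ t])
    show "(G has_derivative mderiv G z) (at z within closed_segment x y)" if "z \<in> closed_segment x y" for z
      using Gd seg that by blast
    show "onorm (mderiv G z - mderiv G x) \<le> L * norm (y - x)" if z: "z \<in> closed_segment x y" for z
      unfolding fun_diff_def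
    proof (rule onorm_bound)
      fix h
      have "norm (mderiv G z h - mderiv G x h) \<le> L * norm (z - x) * norm h"
        using L(2) seg z x by blast
      also have "\<dots> \<le> L * norm (y - x) * norm h"
        using segment_bound1[OF z] L(1) by (intro mult_right_mono mult_left_mono) (auto simp: norm_minus_commute)
      finally show "norm (mderiv G z h - mderiv G x h) \<le> L * norm (y - x) * norm h" .
    qed (use L in simp)
  qed simp
  obtain m where m: "0 < m" "\<And>v. m * norm v \<le> norm (G x0 *v v)"
  proof -
    have "inj ((*v) (G x0))"
      using inv[OF assms] by (metis inj_matrix_vector_mult)
    then show thesis
      using linear_inj_bounded_below_pos[of "(*v) (G x0)"] that by (metis matrix_vector_mul_linear)
  qed
  \<comment> \<open>On this ball \<open>G x\<close> differs from \<open>G x0\<close> by at most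
    \<open>m / 2\<close>, so half of the lower bound at \<open>x0\<close> survives.\<close>
  define R where "R = min e (m / (2 * (K1 + 1)))"
  have R: "0 < R" "R \<le> e" using e m K1 by (auto simp: R_def)
  have "R \<le> m / (2 * (K1 + 1))" by (simp add: R_def)
  then have "R * (2 * (K1 + 1)) \<le> m" using K1 by (simp add: pos_le_divide_eq)
  then have K1R: "K1 * R \<le> m / 2" using R by (simp add: algebra_simps)
  have sub: "x \<in> cball x0 e" if "x \<in> cball x0 R" for x using that R by auto
  have Gm: "m / 2 * norm v \<le> norm (G x *v v)" if x: "x \<in> cball x0 R" for x v
  proof -
    have "norm ((G x0 - G x) *v v) \<le> K1 * norm (x0 - x) * norm v"
      using GL[of x0 x] sub[OF x] e by (intro order_trans[OF norm_matrix_vector_le] mult_right_mono) auto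
    also have "\<dots> \<le> K1 * R * norm v"
      using x K1 by (intro mult_right_mono mult_left_mono) (auto simp: dist_norm)
    also have "\<dots> \<le> m / 2 * norm v" using K1R by (intro mult_right_mono) auto
    finally have "norm (G x0 *v v - G x *v v) \<le> m / 2 * norm v" by (simp add: matrix_vector_mult_diff_rdistrib)
    then show ?thesis using m(2)[of v] norm_triangle_ineq2[of "G x0 *v v" "G x *v v"] by simp
  qed
  define K where "K = max K1 (norm (G x0) + K1 * R)"
  have K: "0 \<le> K" "K1 \<le> K" using K1 by (auto simp: K_def)
  have "norm (G x) \<le> K" if x: "x \<in> cball x0 R" for x
  proof -
    have "norm (G x) \<le> norm (G x0) + norm (G x - G x0)" by (metis add.commute norm_triangle_sub)
    also have "\<dots> \<le> norm (G x0) + K1 * norm (x - x0)" using GL[OF sub[OF x], of x0] e by simp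
    also have "\<dots> \<le> norm (G x0) + K1 * R"
      using x K1 by (intro add_left_mono mult_left_mono) (auto simp: dist_norm norm_minus_commute)
    finally show ?thesis by (simp add: K_def)
  qed
  moreover have "K1 * norm h \<le> K * norm h" for h :: "real^'n" using K by (intro mult_right_mono) auto
  then have "norm (mderiv G x h) \<le> K * norm h" "norm (G x - G y) \<le> K * norm (x - y)"
    if "x \<in> cball x0 R" "y \<in> cball x0 R" for x y h
    using D[OF sub[OF that(1)], of h] GL[OF sub[OF that(1)] sub[OF that(2)]] order_trans by blast+
  moreover have "norm (G y - G x - mderiv G x (y - x)) \<le> L * norm (y - x) * norm (y - x)"
    if "x \<in> cball x0 R" "y \<in> cball x0 R" for x y
    using T[OF sub[OF that(1)] sub[OF that(2)]] by (simp add: mult_ac)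
  moreover have "cball x0 R \<subseteq> \<Omega>" using sub e by blast
  ultimately have "controlled x0 R K L (m / 2)"
    unfolding controlled_def using R(1) K(1) L m Gm sub by auto
  then show thesis by (rule that)
qed

text \<open>The powers of \<open>r\<close> reflect that the acceleration is quadratic in the
  velocity; this is the form of hypothesis that \<open>ode_exists\<close> takes. All estimates are
  made for \<open>lowered\<close>, and \<open>m\<close> carries them over to the
  acceleration.\<close>

lemma accel_lipschitz:
  assumes "x0 \<in> \<Omega>"
  obtains R M where "0 < R" "0 \<le> M" "cball x0 R \<subseteq> \<Omega>"
    "\<And>r x y u w. \<lbrakk>0 \<le> r; x \<in> cball x0 R; y \<in> cball x0 R; norm u \<le> r; norm w \<le> r\<rbrakk>
      \<Longrightarrow> norm (accel G x u - accel G y w) \<le> M * (r * r * norm (x - y) + r * norm (u - w))"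
proof -
  obtain R K L m where "controlled x0 R K L m" by (rule controlled_exists[OF assms])
  note ctl = controlledD[OF this]
  note R = ctl(1,2) and c = ctl(3-5) and Gm = ctl(7) and GL = ctl(9)
  define T where "T = (\<lambda>x a b c. mform (mderiv G x a) b c)"
  have Tb: "\<bar>T x a b c\<bar> \<le> K * norm a * norm b * norm c" if "x \<in> cball x0 R" for x a b c
    unfolding T_def using ctl(8)[OF that, of a]
    by (intro order_trans[OF mform_bound] mult_right_mono) auto
  have TL: "\<bar>T x a b c - T y a b c\<bar> \<le> L * norm (x - y) * norm a * norm b * norm c"
    if "x \<in> cball x0 R" "y \<in> cball x0 R" for x y a b c
    unfolding T_def mform_linear(2)[symmetric] using ctl(10)[OF that, of a]
    by (intro order_trans[OF mform_bound] mult_right_mono) auto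
  have low: "lowered G x u \<bullet> z = 1/2 * T x z u u - T x u u z" for x u z
    unfolding T_def by (rule lowered_inner)
  have Gacc: "G x *v accel G x u = lowered G x u" if "x \<in> cball x0 R" for x u
  proof -
    have "invertible (G x)" using inv R that by blast
    then show ?thesis by (simp add: accel_def matrix_vector_mul_assoc matrix_inv_inverse)
  qed
  \<comment> \<open>Bounds on the inner product with an arbitrary vector become bounds on the norm
    when tested with the vector itself.\<close>
  have norm_le: "norm z \<le> C" if "z \<bullet> z \<le> C * norm z" "0 \<le> C" for z :: "real^'n" and C
  proof (cases "z = 0")
    case False
    then have "norm z * norm z \<le> C * norm z" using that by (simp add: dot_square_norm power2_eq_square)
    then show ?thesis using False by simp
  qed (use that in simp)
  \<comment> \<open>\<open>\<kappa> * (r * r)\<close> bounds the acceleration. The three summands of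
    \<open>M\<close> come from the change of the derivatives of \<open>G\<close>, the change of the
    velocity and the change of \<open>G\<close> itself.\<close>
  define \<kappa> where "\<kappa> = 3/2 * K / m"
  have \<kappa>: "0 \<le> \<kappa>" using c by (simp add: \<kappa>_def)
  define M where "M = (3/2 * L + 3 * K + K * \<kappa>) / m"
  have M: "0 \<le> M" using c \<kappa> by (simp add: M_def)
  have mM: "m * M = 3/2 * L + 3 * K + K * \<kappa>" using c by (simp add: M_def)
  show thesis
  proof (rule that[OF R(1) M R(2)])
    fix r :: real and x y u w :: "real^'n" assume r: "0 \<le> r" and x: "x \<in> cball x0 R" and y: "y \<in> cball x0 R"
      and u: "norm u \<le> r" and w: "norm w \<le> r"
    define d where "d = norm (x - y)"
    define k where "k = norm (u - w)"
    have d0: "0 \<le> d" "0 \<le> k" by (simp_all add: d_def k_def)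
    have Tr: "\<bar>T y a b z\<bar> \<le> K * k * r * norm z" "\<bar>T y z a b\<bar> \<le> K * k * r * norm z"
      if "norm a \<le> k \<and> norm b \<le> r \<or> norm a \<le> r \<and> norm b \<le> k" for a b z
    proof -
      have "norm a * norm b \<le> k * r"
        using that mult_mono[of "norm a" k "norm b" r] mult_mono[of "norm a" r "norm b" k] r d0
        by (auto simp: mult.commute)
      then have "K * (norm a * norm b) * norm z \<le> K * (k * r) * norm z"
        using c by (intro mult_right_mono mult_left_mono) auto
      then show "\<bar>T y a b z\<bar> \<le> K * k * r * norm z" "\<bar>T y z a b\<bar> \<le> K * k * r * norm z"
        using Tb[OF y, of a b z] Tb[OF y, of z a b] by (auto simp: mult_ac)
    qed
    have TLr: "\<bar>T x u u z - T y u u z\<bar> \<le> L * d * r * r * norm z" "\<bar>T x z u u - T y z u u\<bar> \<le> L * d * r * r * norm z" for z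
    proof -
      have "norm u * norm u \<le> r * r" using u r by (intro mult_mono) auto
      then have "L * d * (norm u * norm u) * norm z \<le> L * d * (r * r) * norm z"
        using c d0 by (intro mult_right_mono mult_left_mono) auto
      then show "\<bar>T x u u z - T y u u z\<bar> \<le> L * d * r * r * norm z" "\<bar>T x z u u - T y z u u\<bar> \<le> L * d * r * r * norm z"
        using TL[OF x y, of u u z] TL[OF x y, of z u u] by (auto simp: mult_ac d_def)
    qed
    have low_diff: "norm (lowered G x u - lowered G y w) \<le> 3/2 * (L * d * r * r) + 3 * (K * k * r)"
    proof (rule norm_le)
      define z where "z = lowered G x u - lowered G y w"
      have tri: "norm (u - w) \<le> k \<and> norm u \<le> r \<or> norm (u - w) \<le> r \<and> norm u \<le> k"
        "norm w \<le> k \<and> norm (u - w) \<le> r \<or> norm w \<le> r \<and> norm (u - w) \<le> k"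
        using u w by (auto simp: k_def)
      have "z \<bullet> z = 1/2 * (T x z u u - T y z w w) - (T x u u z - T y w w z)"
        using low[of x u z] low[of y w z] by (simp add: z_def inner_diff_left)
      moreover have "T x z u u - T y z w w = (T x z u u - T y z u u) + T y z (u - w) u + T y z w (u - w)"
        "T x u u z - T y w w z = (T x u u z - T y u u z) + T y (u - w) u z + T y w (u - w) z"
        by (simp_all add: T_def mform_linear mderiv_linear)
      ultimately have zz: "z \<bullet> z = ((T x z u u - T y z u u) + T y z (u - w) u + T y z w (u - w)) / 2
          - ((T x u u z - T y u u z) + T y (u - w) u z + T y w (u - w) z)" by simp
      \<comment> \<open>Counts weights: the position differences enter with \<open>1/2\<close> and
        \<open>1\<close>, the velocity differences twice with \<open>1/2\<close> and twice with
        \<open>1\<close>.\<close>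
      have "(a1 + b1 + b2) / 2 - (a2 + b3 + b4) \<le> 3/2 * \<alpha> + 3 * \<beta>"
        if "\<bar>a1\<bar> \<le> \<alpha>" "\<bar>a2\<bar> \<le> \<alpha>" "\<bar>b1\<bar> \<le> \<beta>" "\<bar>b2\<bar> \<le> \<beta>" "\<bar>b3\<bar> \<le> \<beta>" "\<bar>b4\<bar> \<le> \<beta>"
        for a1 a2 b1 b2 b3 b4 \<alpha> \<beta> :: real
        using that[THEN abs_le_D1] that[THEN abs_le_D2] by (simp add: field_simps)
      from this[OF TLr(2)[of z] TLr(1)[of z] Tr(2)[of "u - w" u z, OF tri(1)] Tr(2)[of w "u - w" z, OF tri(2)]
          Tr(1)[of "u - w" u z, OF tri(1)] Tr(1)[of w "u - w" z, OF tri(2)]]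
      have "z \<bullet> z \<le> 3/2 * (L * d * r * r * norm z) + 3 * (K * k * r * norm z)" unfolding zz .
      then show "z \<bullet> z \<le> (3/2 * (L * d * r * r) + 3 * (K * k * r)) * norm z"
        by (simp add: algebra_simps)
    qed (use c d0 r in simp)
    define a where "a = accel G x u"
    define b where "b = accel G y w"
    have b: "norm b \<le> \<kappa> * (r * r)"
    proof -
      have "norm (lowered G y w) \<le> 3/2 * K * (r * r)"
      proof (rule norm_le)
        define z where "z = lowered G y w"
        have "norm w * norm w \<le> r * r" using w r by (intro mult_mono) auto
        then have *: "K * (norm w * norm w) * norm z \<le> K * (r * r) * norm z"
          using c by (intro mult_right_mono mult_left_mono) auto
        have "z \<bullet> z = 1/2 * T y z w w - T y w w z" unfolding low[symmetric] by (simp add: z_def)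
        then show "z \<bullet> z \<le> 3/2 * K * (r * r) * norm z"
          using * Tb[OF y, of z w w] Tb[OF y, of w w z] by (simp add: mult_ac)
      qed (use c r in simp)
      then have "m * norm b \<le> 3/2 * K * (r * r)" using Gm[OF y, of b] Gacc[OF y, of w] by (simp add: b_def)
      then show ?thesis using c by (simp add: \<kappa>_def field_simps)
    qed
    \<comment> \<open>Both accelerations are compared through the single matrix \<open>G x\<close>,
      which avoids a Lipschitz estimate for the inverse matrices.\<close>
    have "G x *v (a - b) = (lowered G x u - lowered G y w) - (G x - G y) *v b"
      using Gacc[OF x, of u] Gacc[OF y, of w]
      by (simp add: a_def b_def matrix_vector_mult_diff_distrib matrix_vector_mult_diff_rdistrib)
    then have "m * norm (a - b) \<le> norm (lowered G x u - lowered G y w) + norm ((G x - G y) *v b)"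
      using Gm[OF x, of "a - b"] norm_triangle_ineq4 by (metis order_trans)
    also have "norm ((G x - G y) *v b) \<le> (K * d) * (\<kappa> * (r * r))"
      using GL[OF x y] b c d0 by (intro order_trans[OF norm_matrix_vector_le] mult_mono) (auto simp: d_def)
    also have "norm (lowered G x u - lowered G y w) + (K * d) * (\<kappa> * (r * r))
      \<le> (m * M) * (r * r * d + r * k)"
    proof -
      have "0 \<le> L * r * k" "0 \<le> K * (r * r * d)" "0 \<le> K * \<kappa> * r * k" using c \<kappa> d0 r by simp_all
      then show ?thesis using low_diff unfolding mM by (simp add: field_simps)
    qed
    finally have "m * norm (a - b) \<le> m * (M * (r * r * d + r * k))" by simp
    then show "norm (accel G x u - accel G y w) \<le> M * (r * r * norm (x - y) + r * norm (u - w))"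
      using c by (simp add: a_def b_def d_def k_def)
  qed
qed

end

section \<open>Conservation of energy and the first variation\<close>

context C11_metric
begin

text \<open>In the product rule the derivative of the metric counts once, and each of the two
  velocity terms contributes \<open>1/2 - 1\<close> times the same expression, by
  \<open>accel_el\<close> with \<open>w = u\<close>.\<close>

lemma kinetic_energy_deriv:
  assumes "x t \<in> \<Omega>" "(x has_vector_derivative u t) (at t)"
    "(u has_vector_derivative accel G (x t) (u t)) (at t)"
  shows "((\<lambda>s. mform (G (x s)) (u s) (u s)) has_vector_derivative 0) (at t)"
proof -
  have "((\<lambda>s. G (x s)) has_vector_derivative mderiv G (x t) (u t)) (at t)"
    using has_derivative_compose[OF assms(2)[unfolded has_vector_derivative_def] G_deriv[OF assms(1)]]
    by (simp add: has_vector_derivative_def mderiv_linear)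
  from mform_has_derivative[OF this assms(3,3)]
  show ?thesis using accel_el[OF assms(1), of "u t" "u t"] G_sym[OF assms(1), of "u t"] by simp
qed

text \<open>The derivative of the metric along the curve cancels against the last term of
  \<open>accel_el\<close>. If \<open>\<eta>\<close> is the deviation of a neighbouring curve and
  \<open>\<eta>'\<close> that of its velocity, the result is the derivative of the Lagrangian in the
  direction of the deviation.\<close>

lemma momentum_deriv:
  assumes "x t \<in> \<Omega>" "(x has_vector_derivative u t) (at t)"
    "(u has_vector_derivative accel G (x t) (u t)) (at t)" "(\<eta> has_vector_derivative \<eta>') (at t)"
  shows "((\<lambda>s. mform (G (x s)) (u s) (\<eta> s)) has_vector_derivative
    1/2 * mform (mderiv G (x t) (\<eta> t)) (u t) (u t) + mform (G (x t)) (u t) \<eta>') (at t)"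
proof -
  have "((\<lambda>s. G (x s)) has_vector_derivative mderiv G (x t) (u t)) (at t)"
    using has_derivative_compose[OF assms(2)[unfolded has_vector_derivative_def] G_deriv[OF assms(1)]]
    by (simp add: has_vector_derivative_def mderiv_linear)
  from mform_has_derivative[OF this assms(3,4)]
  show ?thesis using accel_el[OF assms(1), of "u t" "\<eta> t"] by simp
qed

text \<open>The Lagrangian difference between two neighbouring geodesics is, up to a quadratic error, the
  derivative of the pairing of the momentum of one with the deviation to the other; since
  both Lagrangians are constant in time, integrating over \<open>{0..1}\<close> gives the Gauss lemma in difference form.\<close>

lemma gauss_estimate:
  fixes X U :: "real^'n \<Rightarrow> real \<Rightarrow> real^'n"
  assumes ctl: "controlled x0 R K L m"
    and X: "\<And>z t. \<lbrakk>z \<in> {v, w}; t \<in> {0..1}\<rbrakk> \<Longrightarrow> X z t \<in> cball x0 R \<and> norm (U z t) \<le> 2"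
    and X0: "\<And>z. z \<in> {v, w} \<Longrightarrow> X z 0 = x0 \<and> U z 0 = z"
    and ode: "\<And>z t. \<lbrakk>z \<in> {v, w}; t \<in> {0..1}\<rbrakk> \<Longrightarrow>
       (X z has_vector_derivative U z t) (at t) \<and> (U z has_vector_derivative accel G (X z t) (U z t)) (at t)"
    and lip: "\<And>t. t \<in> {0..1} \<Longrightarrow> norm (U w t - U v t) \<le> 2 * norm (w - v) \<and> norm (X w t - X v t) \<le> 8 * norm (w - v)"
  shows "\<bar>mform (G (X v 1)) (U v 1) (X w 1 - X v 1) - mform (G x0) v (w - v)\<bar> \<le> (35 * K + 128 * L) * (norm (w - v))\<^sup>2"
proof -
  note R = controlledD(2)[OF ctl] and c = controlledD(3,4)[OF ctl] and D = controlledD(8)[OF ctl]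
    and GK = controlledD(6)[OF ctl] and GT = controlledD(11)[OF ctl]
  define \<delta> where "\<delta> = norm (w - v)"
  have \<delta>: "0 \<le> \<delta>" by (simp add: \<delta>_def)
  have x0: "x0 \<in> cball x0 R" using X[of v 0] X0[of v] by auto
  have energy: "mform (G (X z t)) (U z t) (U z t) = mform (G x0) z z" if z: "z \<in> {v, w}" and t: "t \<in> {0..1}" for z t
  proof -
    have "((\<lambda>s. mform (G (X z s)) (U z s) (U z s)) has_vector_derivative 0) (at t within {0..1})" if "t \<in> {0..1}" for t
      using ode[OF z that] X[OF z that] R
      by (intro has_vector_derivative_at_within[OF kinetic_energy_deriv]) auto
    then obtain k where "\<And>s. s \<in> {0..1} \<Longrightarrow> mform (G (X z s)) (U z s) (U z s) = k"
      using has_vector_derivative_zero_constant[of "{0..1}" "\<lambda>s. mform (G (X z s)) (U z s) (U z s)"] by auto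
    from this[OF t] this[of 0] show ?thesis using X0[OF z] by simp
  qed
  define \<eta> where "\<eta> = (\<lambda>t. X w t - X v t)"
  define \<eta>' where "\<eta>' = (\<lambda>t. U w t - U v t)"
  define \<phi>' where "\<phi>' = (\<lambda>t. 1/2 * mform (mderiv G (X v t) (\<eta> t)) (U v t) (U v t) + mform (G (X v t)) (U v t) (\<eta>' t))"
  \<comment> \<open>The difference of the Lagrangians, evaluated at time \<open>0\<close> and
    constant by \<open>energy\<close>.\<close>
  define e where "e = (mform (G x0) w w - mform (G x0) v v) / 2"
  have \<eta>d: "(\<eta> has_vector_derivative \<eta>' t) (at t)" if "t \<in> {0..1}" for t
    unfolding \<eta>_def \<eta>'_def using ode that by (intro has_vector_derivative_diff) auto
  have \<phi>d: "((\<lambda>s. mform (G (X v s)) (U v s) (\<eta> s) - s * e) has_derivative (\<lambda>h. h * (\<phi>' t - e))) (at t within {0..1})"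
    if t: "t \<in> {0..1}" for t
  proof -
    have "((\<lambda>s. mform (G (X v s)) (U v s) (\<eta> s)) has_vector_derivative \<phi>' t) (at t)"
      unfolding \<phi>'_def using ode[of v t] X[of v t] R t \<eta>d[OF t] by (intro momentum_deriv) auto
    then have "((\<lambda>s. mform (G (X v s)) (U v s) (\<eta> s) - s * e) has_vector_derivative (\<phi>' t - e)) (at t)"
      by (auto intro!: derivative_eq_intros)
    then show ?thesis unfolding has_vector_derivative_def by (auto intro: has_derivative_at_withinI)
  qed
  have rem: "\<bar>\<phi>' t - e\<bar> \<le> (34 * K + 128 * L) * \<delta>\<^sup>2" if t: "t \<in> {0..1}" for t
  proof -
    define x where "x = X v t"
    define y where "y = X w t"
    define u where "u = U v t"
    define u' where "u' = U w t"
    define a where "a = \<eta>' t"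
    define B where "B = mderiv G x (\<eta> t)"
    define E where "E = G y - G x - B"
    have xy: "x \<in> cball x0 R" "y \<in> cball x0 R" "norm u \<le> 2" "norm u' \<le> 2"
      using X[OF _ t] by (auto simp: x_def y_def u_def u'_def)
    have l: "norm (\<eta> t) \<le> 8 * \<delta>" "norm a \<le> 2 * \<delta>"
      using lip[OF t] by (auto simp: \<eta>_def a_def \<eta>'_def \<delta>_def)
    have u': "u' = u + a" by (simp add: u_def u'_def a_def \<eta>'_def)
    have Bn: "norm B \<le> K * (8 * \<delta>)"
      unfolding B_def using D[OF xy(1), of "\<eta> t"] l(1) c by (meson mult_left_mono order_trans)
    have En: "norm E \<le> L * (8 * \<delta>) * (8 * \<delta>)"
    proof -
      have "norm E \<le> L * norm (\<eta> t) * norm (\<eta> t)"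
        using GT[OF xy(1,2)] by (simp add: E_def B_def x_def y_def \<eta>_def)
      also have "\<dots> \<le> L * (8 * \<delta>) * (8 * \<delta>)" using l c \<delta> by (intro mult_mono) auto
      finally show ?thesis .
    qed
    \<comment> \<open>Expansion with \<open>u' = u + a\<close> and \<open>G y = G x + B + E\<close>:
      the part linear in the deviation is \<open>2 * \<phi>' t\<close>. The four remaining terms are
      quadratic, with constants \<open>4 K\<close>, \<open>32 K\<close>, \<open>32 K\<close> and
      \<open>256 L\<close>; halving their sum gives \<open>34\<close> and
      \<open>128\<close>.\<close>
    have "2 * e = mform (G y) u' u' - mform (G x) u u"
      using energy[OF _ t] by (simp add: e_def x_def y_def u_def u'_def)
    also have "\<dots> = (mform B u u + 2 * mform (G x) u a) + (mform (G x) a a + mform B a u' + mform B u a + mform E u' u')"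
      using G_sym[of x a u] R xy(1) unfolding E_def u' by (auto simp: mform_linear)
    also have "mform B u u + 2 * mform (G x) u a = 2 * \<phi>' t"
      by (simp add: \<phi>'_def B_def x_def u_def a_def)
    finally have eq: "2 * (\<phi>' t - e) = - (mform (G x) a a + mform B a u' + mform B u a + mform E u' u')" by simp
    have "\<bar>mform (G x) a a\<bar> \<le> K * (2 * \<delta>) * (2 * \<delta>)"
      using GK[OF xy(1)] l c \<delta> by (intro order_trans[OF mform_bound] mult_mono) auto
    moreover have "\<bar>mform B a u'\<bar> \<le> (K * (8 * \<delta>)) * (2 * \<delta>) * 2"
      using Bn xy l c \<delta> by (intro order_trans[OF mform_bound] mult_mono) auto
    moreover have "\<bar>mform B u a\<bar> \<le> (K * (8 * \<delta>)) * 2 * (2 * \<delta>)"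
      using Bn xy l c \<delta> by (intro order_trans[OF mform_bound] mult_mono) auto
    moreover have "\<bar>mform E u' u'\<bar> \<le> (L * (8 * \<delta>) * (8 * \<delta>)) * 2 * 2"
      using En xy l c \<delta> by (intro order_trans[OF mform_bound] mult_mono) auto
    ultimately have "\<bar>2 * (\<phi>' t - e)\<bar> \<le> 68 * (K * \<delta>\<^sup>2) + 256 * (L * \<delta>\<^sup>2)"
      unfolding eq by (simp add: power2_eq_square algebra_simps)
    then show ?thesis by (simp add: algebra_simps abs_mult)
  qed
  \<comment> \<open>The mean value inequality over \<open>{0..1}\<close>; the pairing vanishes at
    time \<open>0\<close>, where both geodesics start.\<close>
  have "norm ((mform (G (X v 1)) (U v 1) (\<eta> 1) - 1 * e) - (mform (G (X v 0)) (U v 0) (\<eta> 0) - 0 * e))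
    \<le> ((34 * K + 128 * L) * \<delta>\<^sup>2) * norm (1 - 0 :: real)"
  proof (rule differentiable_bound[of "{0..1}", OF _ \<phi>d])
    fix t :: real assume t: "t \<in> {0..1}"
    show "onorm (\<lambda>h. h * (\<phi>' t - e)) \<le> (34 * K + 128 * L) * \<delta>\<^sup>2"
    proof (rule onorm_bound)
      show "norm (h * (\<phi>' t - e)) \<le> (34 * K + 128 * L) * \<delta>\<^sup>2 * norm h" for h
        using mult_right_mono[OF rem[OF t] abs_ge_zero[of h]] by (simp add: abs_mult mult.commute)
    qed (rule order_trans[OF abs_ge_zero rem[OF t]])
  qed auto
  moreover have "\<eta> 0 = 0" using X0 by (simp add: \<eta>_def)
  ultimately have 1: "\<bar>mform (G (X v 1)) (U v 1) (\<eta> 1) - e\<bar> \<le> (34 * K + 128 * L) * \<delta>\<^sup>2"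
    by (simp add: mform_def)
  have x0\<Omega>: "x0 \<in> \<Omega>" using x0 R by auto
  \<comment> \<open>Replacing \<open>e\<close> by the pairing of \<open>v\<close> with
    \<open>w - v\<close> costs half of the form on \<open>w - v\<close>, so \<open>34 + 1/2\<close>
    is rounded up to \<open>35\<close>.\<close>
  have "e = mform (G x0) v (w - v) + 1/2 * mform (G x0) (w - v) (w - v)"
    using G_sym[OF x0\<Omega>, of w v] by (simp add: e_def mform_linear field_simps)
  moreover have "\<bar>mform (G x0) (w - v) (w - v)\<bar> \<le> K * \<delta> * \<delta>"
    unfolding \<delta>_def using GK[OF x0] c by (intro order_trans[OF mform_bound] mult_mono) auto
  ultimately have "\<bar>e - mform (G x0) v (w - v)\<bar> \<le> K * \<delta>\<^sup>2 / 2"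
    by (simp add: power2_eq_square)
  moreover have "(34 * K + 128 * L) * \<delta>\<^sup>2 + K * \<delta>\<^sup>2 / 2 \<le> (35 * K + 128 * L) * \<delta>\<^sup>2"
    using mult_nonneg_nonneg[OF c(1) zero_le_power2[of \<delta>]] by (simp add: algebra_simps)
  ultimately show ?thesis
    using 1 unfolding \<eta>_def \<delta>_def[symmetric] by linarith
qed

lemma local_exp:
  assumes "x0 \<in> \<Omega>"
  obtains \<rho> X U C where "0 < \<rho>" "0 \<le> C"
    "\<And>v t. \<lbrakk>norm v \<le> \<rho>; t \<in> {-1..2}\<rbrakk> \<Longrightarrow> X v t \<in> \<Omega> \<and> norm (X v t - x0) \<le> 8 * norm v"
    "\<And>v. norm v \<le> \<rho> \<Longrightarrow> X v 0 = x0 \<and> U v 0 = v"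
    "\<And>v t. \<lbrakk>norm v \<le> \<rho>; t \<in> {-1<..<2}\<rbrakk> \<Longrightarrow>
       (X v has_vector_derivative U v t) (at t) \<and> (U v has_vector_derivative accel G (X v t) (U v t)) (at t)"
    "\<And>v w. \<lbrakk>norm v \<le> \<rho>; norm w \<le> \<rho>\<rbrakk> \<Longrightarrow> norm (X v 1 - X w 1 - (v - w)) \<le> norm (v - w) / 2"
    "\<And>v w. \<lbrakk>norm v \<le> \<rho>; norm w \<le> \<rho>\<rbrakk> \<Longrightarrow>
       \<bar>mform (G (X v 1)) (U v 1) (X w 1 - X v 1) - mform (G x0) v (w - v)\<bar> \<le> C * (norm (w - v))\<^sup>2"
proof -
  obtain R1 K L m where ctl: "controlled x0 R1 K L m" by (rule controlled_exists[OF assms])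
  note R1 = controlledD(1,2)[OF ctl] and c = controlledD(3,4)[OF ctl]
  obtain R2 M where R2: "0 < R2" "0 \<le> M"
    and QL: "\<And>r x y u w. \<lbrakk>0 \<le> r; x \<in> cball x0 R2; y \<in> cball x0 R2; norm u \<le> r; norm w \<le> r\<rbrakk>
      \<Longrightarrow> norm (accel G x u - accel G y w) \<le> M * (r * r * norm (x - y) + r * norm (u - w))"
    by (rule accel_lipschitz[OF assms]) blast
  define R where "R = min R1 R2"
  have R: "0 < R" "cball x0 R \<subseteq> cball x0 R1" "cball x0 R \<subseteq> cball x0 R2" using R1 R2 by (auto simp: R_def)
  have QL': "norm (accel G x u - accel G y w) \<le> M * (r * r * norm (x - y) + r * norm (u - w))"
    if "0 \<le> r" "x \<in> cball x0 R" "y \<in> cball x0 R" "norm u \<le> r" "norm w \<le> r" for r x y u w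
    using that R by (intro QL) auto
  obtain \<rho> X U where \<rho>: "0 < \<rho>"
    and b: "\<And>v t. \<lbrakk>norm v \<le> \<rho>; t \<in> {-1..2}\<rbrakk> \<Longrightarrow> norm (X v t - x0) \<le> R \<and> norm (X v t - x0) \<le> 8 * norm v \<and> norm (U v t) \<le> 2 * norm v"
    and i: "\<And>v. norm v \<le> \<rho> \<Longrightarrow> X v 0 = x0 \<and> U v 0 = v"
    and o: "\<And>v t. \<lbrakk>norm v \<le> \<rho>; t \<in> {-1<..<2}\<rbrakk> \<Longrightarrow>
       (X v has_vector_derivative U v t) (at t) \<and> (U v has_vector_derivative accel G (X v t) (U v t)) (at t)"
    and l: "\<And>v w t. \<lbrakk>norm v \<le> \<rho>; norm w \<le> \<rho>; t \<in> {-1..2}\<rbrakk> \<Longrightarrow>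
       norm (U v t - U w t) \<le> 2 * norm (v - w) \<and> norm (X v t - X w t) \<le> 8 * norm (v - w)"
    and h: "\<And>v w. \<lbrakk>norm v \<le> \<rho>; norm w \<le> \<rho>\<rbrakk> \<Longrightarrow> norm (X v 1 - X w 1 - (v - w)) \<le> norm (v - w) / 2"
    by (rule ode_exists[OF R(1) R2(2) QL' accel_zero]) blast+
  show thesis
  \<comment> \<open>Initial velocities of norm at most \<open>1\<close> give velocities of norm at
    most \<open>2\<close>, as \<open>gauss_estimate\<close> requires.\<close>
  proof (rule that[of "min \<rho> 1" "35 * K + 128 * L" X U])
    show "X v t \<in> \<Omega> \<and> norm (X v t - x0) \<le> 8 * norm v" if "norm v \<le> min \<rho> 1" "t \<in> {-1..2}" for v t
      using b[of v t] that R R1 by (auto simp: dist_norm norm_minus_commute subset_iff)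
    show "\<bar>mform (G (X v 1)) (U v 1) (X w 1 - X v 1) - mform (G x0) v (w - v)\<bar> \<le> (35 * K + 128 * L) * (norm (w - v))\<^sup>2"
      if v: "norm v \<le> min \<rho> 1" and w: "norm w \<le> min \<rho> 1" for v w
    proof (rule gauss_estimate[OF ctl])
      show "X z t \<in> cball x0 R1 \<and> norm (U z t) \<le> 2" if "z \<in> {v, w}" "t \<in> {0..1}" for z t
        using b[of z t] that v w R(2) by (auto simp: dist_norm norm_minus_commute subset_iff)
      show "norm (U w t - U v t) \<le> 2 * norm (w - v) \<and> norm (X w t - X v t) \<le> 8 * norm (w - v)" if "t \<in> {0..1}" for t
        using l[of w v t] that v w by auto
      show "(X z has_vector_derivative U z t) (at t) \<and> (U z has_vector_derivative accel G (X z t) (U z t)) (at t)"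
        if "z \<in> {v, w}" "t \<in> {0..1}" for z t
        using that v w by (intro o) auto
    qed (use i v w in auto)
  qed (use \<rho> c i o h in auto)
qed

end

section \<open>Smooth atlases and tangent vectors\<close>

lemma onorm_scaleR_real_le:
  assumes "norm a \<le> B"
  shows "onorm (\<lambda>k::real. k *\<^sub>R a) \<le> B"
proof (rule onorm_bound)
  show "0 \<le> B" using norm_ge_zero assms by (rule order_trans)
  show "norm (k *\<^sub>R a) \<le> B * norm k" for k :: real
    using mult_right_mono[OF assms abs_ge_zero[of k]] by (simp add: mult.commute)
qed

lemma has_derivative_along_line:
  assumes "(g has_derivative g') (at (y + s *\<^sub>R v))"
  shows "((\<lambda>s. g (y + s *\<^sub>R v)) has_derivative (\<lambda>k. k *\<^sub>R g' v)) (at s within T)"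
proof -
  have "((\<lambda>s. y + s *\<^sub>R v) has_derivative (\<lambda>k. k *\<^sub>R v)) (at s within T)"
    by (auto intro!: derivative_eq_intros)
  from has_derivative_compose[OF this assms] show ?thesis
    using linear_cmul[OF has_derivative_linear[OF assms]] by simp
qed

text \<open>The second difference \<open>\<Delta> v w h\<close> is symmetric in \<open>v\<close> and
  \<open>w\<close>, and two applications of the mean value inequality show that, divided by
  \<open>h * h\<close>, it tends to \<open>D2 v x w\<close>. The hypotheses speak of one direction
  at a time, as \<open>Ck_on\<close> does.\<close>

lemma symmetric_second_derivative:
  fixes f :: "'a::real_normed_vector \<Rightarrow> 'b::real_normed_vector"
  assumes S: "open S" "x \<in> S"
    and D: "\<And>y. y \<in> S \<Longrightarrow> (f has_derivative D y) (at y)"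
    and D2: "\<And>y v. y \<in> S \<Longrightarrow> ((\<lambda>z. D z v) has_derivative D2 v y) (at y)"
    and cont: "\<And>v w. continuous_on S (\<lambda>y. D2 v y w)"
  shows "D2 v x w = D2 w x v"
proof -
  define \<Delta> where "\<Delta> = (\<lambda>v w h. f (x + h *\<^sub>R v + h *\<^sub>R w) - f (x + h *\<^sub>R v) - (f (x + h *\<^sub>R w) - f x))"
  have key: "\<exists>d>0. \<forall>h. 0 < h \<and> h < d \<longrightarrow>
      norm (\<Delta> v w h - h *\<^sub>R h *\<^sub>R D2 v x w) \<le> e * h * h"
    if e: "0 < e" for e v w
  proof -
    obtain r where r: "0 < r" "ball x r \<subseteq> S" "\<And>y. y \<in> ball x r \<Longrightarrow> norm (D2 v y w - D2 v x w) < e"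
    proof -
      have "isCont (\<lambda>y. D2 v y w) x" using cont S by (simp add: continuous_on_eq_continuous_at)
      then obtain r1 where r1: "0 < r1" "\<And>y. dist y x < r1 \<Longrightarrow> dist (D2 v y w) (D2 v x w) < e"
        using e unfolding continuous_at_eps_delta by blast
      obtain r2 where "0 < r2" "ball x r2 \<subseteq> S" using S openE by blast
      then show thesis using r1 by (intro that[of "min r1 r2"]) (auto simp: dist_norm norm_minus_commute)
    qed
    \<comment> \<open>Keeps the parallelogram spanned by \<open>h *\<^sub>R v\<close> and
      \<open>h *\<^sub>R w\<close> at \<open>x\<close> inside the ball.\<close>
    define d where "d = r / (norm v + norm w + 1)"
    have "0 < norm v + norm w + 1" using norm_ge_zero[of v] norm_ge_zero[of w] by linarith
    then have d: "0 < d" "d * (norm v + norm w + 1) = r" using r(1) by (simp_all add: d_def)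
    show ?thesis
    proof (intro exI[of _ d] conjI allI impI d(1))
      fix h assume h: "0 < h \<and> h < d"
      have inb: "x + s *\<^sub>R v + t *\<^sub>R w \<in> ball x r" if "s \<in> {0..h}" "t \<in> {0..h}" for s t
      proof -
        have "norm (s *\<^sub>R v + t *\<^sub>R w) \<le> s * norm v + t * norm w"
          using that by (intro order_trans[OF norm_triangle_ineq]) auto
        also have "\<dots> \<le> h * norm v + h * norm w" using that by (intro add_mono mult_right_mono) auto
        also have "\<dots> < h * (norm v + norm w + 1)" using h by (simp add: algebra_simps)
        also have "\<dots> \<le> d * (norm v + norm w + 1)" using h by (intro mult_right_mono) auto
        finally have "norm (s *\<^sub>R v + t *\<^sub>R w) < r" using d(2) by simp
        moreover have "x - (x + s *\<^sub>R v + t *\<^sub>R w) = - (s *\<^sub>R v + t *\<^sub>R w)" by simp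
        ultimately show ?thesis unfolding mem_ball dist_norm by (simp only: norm_minus_cancel)
      qed
      \<comment> \<open>The second difference is the increment of \<open>\<phi>\<close> up to the
        subtracted main term, and the derivative \<open>\<phi>'\<close> is itself an increment in
        direction \<open>w\<close>, estimated through \<open>\<psi>\<close>.\<close>
      define \<phi> where "\<phi> = (\<lambda>s. f (x + h *\<^sub>R w + s *\<^sub>R v) - f (x + s *\<^sub>R v) - s *\<^sub>R h *\<^sub>R D2 v x w)"
      define \<phi>' where "\<phi>' = (\<lambda>s. D (x + h *\<^sub>R w + s *\<^sub>R v) v - D (x + s *\<^sub>R v) v - h *\<^sub>R D2 v x w)"
      have \<phi>d: "(\<phi> has_derivative (\<lambda>k. k *\<^sub>R \<phi>' s)) (at s within {0..h})" if s: "s \<in> {0..h}" for s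
      proof -
        have i: "x + h *\<^sub>R w + s *\<^sub>R v \<in> S" "x + s *\<^sub>R v \<in> S" using inb[OF s, of h] inb[OF s, of 0] r(2) h by (auto simp: add_ac)
        note 1 = has_derivative_along_line[OF D[OF i(1)], where T="{0..h}"]
        note 2 = has_derivative_along_line[OF D[OF i(2)], where T="{0..h}"]
        have 3: "((\<lambda>s. s *\<^sub>R h *\<^sub>R D2 v x w) has_derivative (\<lambda>k. k *\<^sub>R h *\<^sub>R D2 v x w)) (at s within {0..h})"
          by (auto intro!: derivative_eq_intros)
        show ?thesis using has_derivative_diff[OF has_derivative_diff[OF 1 2] 3]
          unfolding \<phi>_def \<phi>'_def by (simp add: scaleR_diff_right)
      qed
      have \<phi>'b: "norm (\<phi>' s) \<le> e * h" if s: "s \<in> {0..h}" for s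
      proof -
        define y where "y = x + s *\<^sub>R v"
        define \<psi> where "\<psi> = (\<lambda>t. D (y + t *\<^sub>R w) v - t *\<^sub>R D2 v x w)"
        have "norm (\<psi> h - \<psi> 0) \<le> e * norm (h - 0)"
        proof (rule differentiable_bound[of "{0..h}"])
          fix t assume t: "t \<in> {0..h}"
          have i: "y + t *\<^sub>R w \<in> S" "y + t *\<^sub>R w \<in> ball x r" using inb[OF s t] r(2) by (auto simp: y_def)
          note 1 = has_derivative_along_line[OF D2[OF i(1), of v], where T="{0..h}"]
          have 2: "((\<lambda>t. t *\<^sub>R D2 v x w) has_derivative (\<lambda>k. k *\<^sub>R D2 v x w)) (at t within {0..h})"
            by (auto intro!: derivative_eq_intros)
          show "(\<psi> has_derivative (\<lambda>k. k *\<^sub>R (D2 v (y + t *\<^sub>R w) w - D2 v x w))) (at t within {0..h})"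
            using has_derivative_diff[OF 1 2] unfolding \<psi>_def by (simp add: scaleR_diff_right)
          show "onorm (\<lambda>k. k *\<^sub>R (D2 v (y + t *\<^sub>R w) w - D2 v x w)) \<le> e"
            using r(3)[OF i(2)] by (intro onorm_scaleR_real_le) simp
        qed (use h in auto)
        then show ?thesis using h by (simp add: \<psi>_def \<phi>'_def y_def add_ac diff_diff_eq)
      qed
      have "norm (\<phi> h - \<phi> 0) \<le> (e * h) * norm (h - 0)"
      proof (rule differentiable_bound[of "{0..h}", OF _ \<phi>d])
        fix s assume s: "s \<in> {0..h}"
        show "onorm (\<lambda>k. k *\<^sub>R \<phi>' s) \<le> e * h"
          by (rule onorm_scaleR_real_le[OF \<phi>'b[OF s]])
      qed (use h in auto)
      then show "norm (\<Delta> v w h - h *\<^sub>R h *\<^sub>R D2 v x w) \<le> e * h * h"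
        using h by (simp add: \<phi>_def \<Delta>_def add_ac diff_diff_eq)
    qed
  qed
  have "norm (D2 v x w - D2 w x v) \<le> 2 * e" if e: "0 < e" for e
  proof -
    obtain d1 where d1: "0 < d1" "\<And>h. 0 < h \<Longrightarrow> h < d1 \<Longrightarrow>
      norm (\<Delta> v w h - h *\<^sub>R h *\<^sub>R D2 v x w) \<le> e * h * h"
      using key[OF e] by blast
    obtain d2 where d2: "0 < d2" "\<And>h. 0 < h \<Longrightarrow> h < d2 \<Longrightarrow>
      norm (\<Delta> w v h - h *\<^sub>R h *\<^sub>R D2 w x v) \<le> e * h * h"
      using key[OF e] by blast
    obtain h where h: "0 < h" "h < d1" "h < d2" using d1 d2 by (metis field_lbound_gt_zero)
    have "\<Delta> w v h = \<Delta> v w h" by (simp add: \<Delta>_def add_ac)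
    then have "norm (h *\<^sub>R h *\<^sub>R (D2 v x w - D2 w x v)) = norm ((\<Delta> w v h - h *\<^sub>R h *\<^sub>R D2 w x v) - (\<Delta> v w h - h *\<^sub>R h *\<^sub>R D2 v x w))"
      by (simp add: scaleR_diff_right)
    also have "\<dots> \<le> e * h * h + e * h * h"
      by (rule order_trans[OF norm_triangle_ineq4 add_mono[OF d2(2)[OF h(1,3)] d1(2)[OF h(1,2)]]])
    finally have "(h * h) * norm (D2 v x w - D2 w x v) \<le> (h * h) * (2 * e)"
      using h by (simp only: norm_scaleR abs_of_pos) (simp add: mult_ac)
    then show ?thesis using h by simp
  qed
  from this[of "norm (D2 v x w - D2 w x v) / 4"] have "norm (D2 v x w - D2 w x v) \<le> 0" by force
  then show ?thesis by simp
qed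

section \<open>Charts, transition maps and their derivatives\<close>

locale smooth_manifold =
  fixes A :: "('m::{t2_space, second_countable_topology}, real^'n) chart set"
  assumes atlas: "smooth_atlas A"
begin

lemma chart_open: "c \<in> A \<Longrightarrow> open (cdom c)" "c \<in> A \<Longrightarrow> open (cran c)"
  and chart_hom: "c \<in> A \<Longrightarrow> homeomorphism (cdom c) (cran c) (cmap c) (cinv c)"
  using atlas by (auto simp: smooth_atlas_def is_chart_def)

lemma cinv_cmap: "c \<in> A \<Longrightarrow> q \<in> cdom c \<Longrightarrow> cinv c (cmap c q) = q"
  using chart_hom homeomorphism_apply1 by blast

lemma cmap_cinv: "c \<in> A \<Longrightarrow> x \<in> cran c \<Longrightarrow> cmap c (cinv c x) = x"
  using chart_hom homeomorphism_apply2 by blast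

lemma cinv_in: "c \<in> A \<Longrightarrow> x \<in> cran c \<Longrightarrow> cinv c x \<in> cdom c"
  using cinv_cmap by fastforce

lemma continuous_cmap: "c \<in> A \<Longrightarrow> continuous_on (cdom c) (cmap c)"
  and continuous_cinv: "c \<in> A \<Longrightarrow> continuous_on (cran c) (cinv c)"
  using chart_hom by (auto simp: homeomorphism_def)

lemma open_cmap_image:
  assumes "c \<in> A" "open V" "V \<subseteq> cdom c"
  shows "open (cmap c ` V)"
proof -
  have "openin (top_of_set (cran c)) (cmap c ` V)"
    using homeomorphism_imp_open_map[OF chart_hom[OF assms(1)]] assms(2,3) chart_open(1)[OF assms(1)]
    by (metis open_openin_trans inf.absorb_iff2 openin_open_Int open_subset)
  then show ?thesis using chart_open(2)[OF assms(1)] openin_open_trans by blast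
qed

lemma open_cinv_image:
  assumes "c \<in> A" "open V" "V \<subseteq> cran c"
  shows "open (cinv c ` V)"
proof -
  have "openin (top_of_set (cdom c)) (cinv c ` V)"
    using homeomorphism_imp_open_map[OF homeomorphism_symD[OF chart_hom[OF assms(1)]]] assms(2,3)
    by (metis open_subset)
  then show ?thesis using chart_open(1)[OF assms(1)] openin_open_trans by blast
qed

definition overlap :: "('m, real^'n) chart \<Rightarrow> ('m, real^'n) chart \<Rightarrow> (real^'n) set" where
  "overlap c d = cmap c ` (cdom c \<inter> cdom d)"

lemma open_overlap: "c \<in> A \<Longrightarrow> d \<in> A \<Longrightarrow> open (overlap c d)"
  unfolding overlap_def by (intro open_cmap_image open_Int chart_open(1)) auto

lemma in_overlap: "q \<in> cdom c \<Longrightarrow> q \<in> cdom d \<Longrightarrow> cmap c q \<in> overlap c d"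
  by (auto simp: overlap_def)

lemma overlapE:
  assumes "c \<in> A" "x \<in> overlap c d"
  obtains q where "q \<in> cdom c" "q \<in> cdom d" "x = cmap c q" "cinv c x = q"
  using assms cinv_cmap by (auto simp: overlap_def)

lemma transition_cmap: "c \<in> A \<Longrightarrow> q \<in> cdom c \<Longrightarrow> transition c d (cmap c q) = cmap d q"
  by (simp add: transition_def cinv_cmap)

definition dtr :: "('m, real^'n) chart \<Rightarrow> ('m, real^'n) chart \<Rightarrow> real^'n \<Rightarrow> real^'n \<Rightarrow> real^'n" where
  "dtr c d x = frechet_derivative (transition c d) (at x)"

lemma transition_smooth: "c \<in> A \<Longrightarrow> d \<in> A \<Longrightarrow> smooth_on (overlap c d) (transition c d)"
  using atlas by (simp add: smooth_atlas_def overlap_def)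

lemma transition_deriv:
  assumes "c \<in> A" "d \<in> A" "x \<in> overlap c d"
  shows "(transition c d has_derivative dtr c d x) (at x)"
proof -
  have "Ck_on (Suc 0) (overlap c d) (transition c d)"
    using transition_smooth[OF assms(1,2)] by (simp add: smooth_on_def del: Ck_on.simps)
  then show ?thesis using assms(3) frechet_derivative_works by (auto simp: dtr_def)
qed

definition ddtr :: "('m, real^'n) chart \<Rightarrow> ('m, real^'n) chart \<Rightarrow> real^'n \<Rightarrow> real^'n \<Rightarrow> real^'n \<Rightarrow> real^'n" where
  "ddtr c d v x = frechet_derivative (\<lambda>y. dtr c d y v) (at x)"

lemma transition_deriv2:
  assumes "c \<in> A" "d \<in> A"
  shows "x \<in> overlap c d \<Longrightarrow> ((\<lambda>y. dtr c d y v) has_derivative ddtr c d v x) (at x)"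
    and "continuous_on (overlap c d) (\<lambda>y. ddtr c d v y w)"
proof -
  have "Ck_on (Suc (Suc 0)) (overlap c d) (transition c d)"
    using transition_smooth[OF assms(1,2)] by (simp add: smooth_on_def del: Ck_on.simps)
  then have *: "Ck_on (Suc 0) (overlap c d) (\<lambda>y. dtr c d y v)"
    unfolding Ck_on.simps(2)[of "Suc 0"] dtr_def by blast
  then show "x \<in> overlap c d \<Longrightarrow> ((\<lambda>y. dtr c d y v) has_derivative ddtr c d v x) (at x)"
    using frechet_derivative_works by (auto simp: ddtr_def)
  show "continuous_on (overlap c d) (\<lambda>y. ddtr c d v y w)"
    using * by (simp add: ddtr_def)
qed

lemma ddtr_sym:
  assumes "c \<in> A" "d \<in> A" "x \<in> overlap c d"
  shows "ddtr c d v x w = ddtr c d w x v"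
  by (rule symmetric_second_derivative[where f="transition c d" and D="dtr c d" and ?D2.0="ddtr c d" and S="overlap c d"])
     (use assms in \<open>simp_all add: open_overlap transition_deriv transition_deriv2\<close>)

lemma dtr_linear: "c \<in> A \<Longrightarrow> d \<in> A \<Longrightarrow> x \<in> overlap c d \<Longrightarrow> bounded_linear (dtr c d x)"
  using transition_deriv has_derivative_bounded_linear by blast

lemma dtr_compose:
  assumes A: "c \<in> A" "d \<in> A" "e \<in> A" and q: "q \<in> cdom c" "q \<in> cdom d" "q \<in> cdom e"
  shows "dtr d e (cmap d q) (dtr c d (cmap c q) v) = dtr c e (cmap c q) v"
proof -
  have 1: "(transition c d has_derivative dtr c d (cmap c q)) (at (cmap c q))"
    using A q by (intro transition_deriv in_overlap)
  have "(transition d e has_derivative dtr d e (cmap d q)) (at (cmap d q))"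
    using A q by (intro transition_deriv in_overlap)
  then have 2: "(transition d e has_derivative dtr d e (cmap d q)) (at (transition c d (cmap c q)))"
    using A q by (simp add: transition_cmap)
  have "((\<lambda>x. transition d e (transition c d x)) has_derivative (\<lambda>v. dtr d e (cmap d q) (dtr c d (cmap c q) v))) (at (cmap c q))"
    by (rule has_derivative_compose[OF 1 2])
  then have "(transition c e has_derivative (\<lambda>v. dtr d e (cmap d q) (dtr c d (cmap c q) v))) (at (cmap c q))"
  proof (rule has_derivative_transform_within_open[where s="cmap c ` (cdom c \<inter> cdom d \<inter> cdom e)"])
    show "open (cmap c ` (cdom c \<inter> cdom d \<inter> cdom e))"
      using A by (intro open_cmap_image open_Int chart_open(1)) auto
  qed (use A q in \<open>auto simp: transition_cmap\<close>)
  moreover have "(transition c e has_derivative dtr c e (cmap c q)) (at (cmap c q))"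
    using A q by (intro transition_deriv in_overlap)
  ultimately show ?thesis by (metis has_derivative_unique)
qed

lemma dtr_id:
  assumes "c \<in> A" "q \<in> cdom c"
  shows "dtr c c (cmap c q) v = v"
proof -
  have "(transition c c has_derivative (\<lambda>v. v)) (at (cmap c q))"
    by (rule has_derivative_transform_within_open[OF has_derivative_ident, where s="cran c"])
      (use assms chart_open in \<open>auto simp: transition_cmap\<close>)
  moreover have "(transition c c has_derivative dtr c c (cmap c q)) (at (cmap c q))"
    using assms by (intro transition_deriv in_overlap)
  ultimately show ?thesis by (metis has_derivative_unique)
qed

lemma dtr_inverse:
  assumes "c \<in> A" "d \<in> A" "q \<in> cdom c" "q \<in> cdom d"
  shows "dtr d c (cmap d q) (dtr c d (cmap c q) v) = v"
  using dtr_compose[of c d c q v] dtr_id[of c q v] assms by simp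

section \<open>Tangent vectors and their coordinates\<close>

lemma charts_atD: "c \<in> charts_at A q \<Longrightarrow> c \<in> A \<and> q \<in> cdom c"
  by (simp add: charts_at_def)

lemma charts_at_ex: "\<exists>c. c \<in> charts_at A q"
  using atlas by (auto simp: smooth_atlas_def charts_at_def)

lemma of_coords_eq: "of_coords A c q u d = (if d \<in> charts_at A q then dtr c d (cmap c q) u else 0)"
  by (simp add: of_coords_def dtr_def)

lemma tangent_coords:
  assumes "v \<in> tangent_space A q" "c \<in> charts_at A q" "d \<in> charts_at A q"
  shows "v d = dtr c d (cmap c q) (v c)"
  using assms unfolding tangent_space_def dtr_def by blast

lemma of_coords_tangent:
  assumes "c \<in> charts_at A q"
  shows "of_coords A c q u \<in> tangent_space A q"
  unfolding tangent_space_def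
proof (intro CollectI conjI ballI allI impI)
  fix d e assume "d \<in> charts_at A q" "e \<in> charts_at A q"
  then show "of_coords A c q u e = frechet_derivative (transition d e) (at (cmap d q)) (of_coords A c q u d)"
    using dtr_compose[of c d e q u] assms charts_atD by (simp add: of_coords_eq dtr_def)
qed (simp add: of_coords_eq)

lemma coords_of_coords: "c \<in> charts_at A q \<Longrightarrow> of_coords A c q u c = u"
  using dtr_id charts_atD by (simp add: of_coords_eq)

lemma of_coords_coords:
  assumes "v \<in> tangent_space A q" "c \<in> charts_at A q"
  shows "of_coords A c q (v c) = v"
proof
  fix d
  show "of_coords A c q (v c) d = v d"
  proof (cases "d \<in> charts_at A q")
    case True
    then show ?thesis using tangent_coords[OF assms True] by (simp only: of_coords_eq if_True)
  next
    case False
    then have "v d = 0" using assms(1) unfolding tangent_space_def by blast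
    then show ?thesis using False by (simp add: of_coords_eq)
  qed
qed

lemma tangent_eqI:
  assumes "v \<in> tangent_space A q" "w \<in> tangent_space A q" "c \<in> charts_at A q" "v c = w c"
  shows "v = w"
  using of_coords_coords assms by metis

lemma of_coords_linear:
  assumes "c \<in> charts_at A q"
  shows "of_coords A c q (a *\<^sub>R u + v) = tadd (tscale a (of_coords A c q u)) (of_coords A c q v)"
proof
  fix d
  show "of_coords A c q (a *\<^sub>R u + v) d = tadd (tscale a (of_coords A c q u)) (of_coords A c q v) d"
  proof (cases "d \<in> charts_at A q")
    case True
    then interpret bounded_linear "dtr c d (cmap c q)"
      using assms charts_atD by (intro dtr_linear in_overlap) auto
    show ?thesis by (simp add: of_coords_eq tadd_def tscale_def add scaleR)
  qed (simp add: of_coords_eq tadd_def tscale_def)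
qed

lemma of_coords_zero: "c \<in> charts_at A q \<Longrightarrow> of_coords A c q 0 = tzero"
  using of_coords_linear[of c q 1 0 0] by (auto simp: tadd_def tscale_def tzero_def fun_eq_iff)

lemma of_coords_scale: "c \<in> charts_at A q \<Longrightarrow> of_coords A c q (a *\<^sub>R u) = tscale a (of_coords A c q u)"
  using of_coords_linear[of c q a u 0] of_coords_zero[of c q] by (simp add: tadd_def tzero_def)

lemma of_coords_change:
  assumes "c \<in> charts_at A q" "d \<in> charts_at A q"
  shows "of_coords A c q u = of_coords A d q (dtr c d (cmap c q) u)"
  by (rule tangent_eqI[OF of_coords_tangent of_coords_tangent assms(2)])
     (use assms in \<open>simp_all add: coords_of_coords of_coords_eq[of c]\<close>)

end

section \<open>The geodesic equation under changes of charts\<close>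

lemma lowered_scale: "lowered G x (a *\<^sub>R u) = (a * a) *\<^sub>R lowered G x u"
  by (simp add: lowered_def vec_eq_iff sum_distrib_left mult_ac)

lemma accel_scale: "accel G x (a *\<^sub>R u) = (a * a) *\<^sub>R accel G x u"
  by (simp add: accel_def lowered_scale matrix_vector_mult_scaleR)

locale pseudo_riemannian = smooth_manifold A
  for A :: "('m::{t2_space, second_countable_topology}, real^'n) chart set" +
  fixes g :: "('m, real^'n) metric_field"
  assumes metric: "C11_pseudo_riemannian_metric A g"
begin

abbreviation Gm :: "('m, real^'n) chart \<Rightarrow> real^'n \<Rightarrow> real^'n^'n" where
  "Gm \<equiv> metric_matrix A g"

lemma g_sym: "v \<in> tangent_space A q \<Longrightarrow> w \<in> tangent_space A q \<Longrightarrow> g q v w = g q w v"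
  using metric unfolding C11_pseudo_riemannian_metric_def by blast

lemma g_linear: "u \<in> tangent_space A q \<Longrightarrow> v \<in> tangent_space A q \<Longrightarrow> w \<in> tangent_space A q \<Longrightarrow>
    g q (tadd (tscale a u) v) w = a * g q u w + g q v w"
  using metric unfolding C11_pseudo_riemannian_metric_def by blast

lemma g_nondegenerate: "v \<in> tangent_space A q \<Longrightarrow> (\<And>w. w \<in> tangent_space A q \<Longrightarrow> g q v w = 0) \<Longrightarrow> v = tzero"
  using metric unfolding C11_pseudo_riemannian_metric_def by blast

lemma g_of_coords_sum:
  assumes c: "c \<in> charts_at A q" and w: "w \<in> tangent_space A q"
  shows "g q (of_coords A c q v) w = (\<Sum>i\<in>UNIV. v $ i * g q (of_coords A c q (axis i 1)) w)"
proof -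
  define l where "l = (\<lambda>v. g q (of_coords A c q v) w)"
  have comb: "l (a *\<^sub>R u + v) = a * l u + l v" for a u v
    unfolding l_def of_coords_linear[OF c] by (intro g_linear of_coords_tangent c w)
  have l0: "l 0 = 0" using comb[of 1 0 0] by simp
  have "linear l"
    by (rule linearI) (use comb[of 1] comb[of _ _ 0] l0 in simp_all)
  have "l v = l (\<Sum>i\<in>UNIV. v $ i *\<^sub>R axis i 1)" using vec_as_sum_axis[of v] by simp
  also have "\<dots> = (\<Sum>i\<in>UNIV. v $ i * l (axis i 1))"
    using \<open>linear l\<close> by (simp add: linear_sum linear_cmul)
  finally show ?thesis by (simp add: l_def)
qed

lemma mform_metric:
  assumes c: "c \<in> charts_at A q"
  shows "mform (Gm c (cmap c q)) v w = g q (of_coords A c q v) (of_coords A c q w)"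
proof -
  have q: "cinv c (cmap c q) = q" using c charts_atD cinv_cmap by blast
  note T = of_coords_tangent[OF c]
  have "g q (of_coords A c q v) (of_coords A c q w)
    = (\<Sum>i\<in>UNIV. v $ i * g q (of_coords A c q (axis i 1)) (of_coords A c q w))"
    by (rule g_of_coords_sum[OF c T])
  also have "\<dots> = (\<Sum>i\<in>UNIV. v $ i * (\<Sum>j\<in>UNIV. w $ j * g q (of_coords A c q (axis j 1)) (of_coords A c q (axis i 1))))"
    using g_sym[OF T T] g_of_coords_sum[OF c T, of w] by (intro sum.cong refl) metis
  also have "\<dots> = (\<Sum>i\<in>UNIV. v $ i * (\<Sum>j\<in>UNIV. w $ j * g q (of_coords A c q (axis i 1)) (of_coords A c q (axis j 1))))"
    using g_sym[OF T T] by (intro sum.cong refl arg_cong2[where f="(*)"])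
  finally show ?thesis
    by (simp add: mform_sum metric_matrix_def q sum_distrib_left mult_ac)
qed

lemma cran_charts_at:
  assumes "c \<in> A" "x \<in> cran c"
  shows "c \<in> charts_at A (cinv c x)" "cmap c (cinv c x) = x"
  using assms cinv_in cmap_cinv by (auto simp: charts_at_def)

lemma C11_metric_chart:
  assumes "c \<in> A"
  shows "C11_metric (cran c) (Gm c)"
proof
  show "open (cran c)" by (rule chart_open(2)[OF assms])
  show "C11_on (cran c) (\<lambda>x. Gm c x $ i $ j)" for i j
    using metric assms unfolding C11_pseudo_riemannian_metric_def by blast
  fix x assume x: "x \<in> cran c"
  note q = cran_charts_at[OF assms x]
  note T = of_coords_tangent[OF q(1)]
  show "Gm c x $ i $ j = Gm c x $ j $ i" for i j
    using g_sym[OF T T] by (simp add: metric_matrix_def)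
  \<comment> \<open>A kernel vector of the matrix represents a tangent vector orthogonal to the
    whole tangent space.\<close>
  have "v = 0" if v: "Gm c x *v v = 0" for v
  proof -
    have "of_coords A c (cinv c x) v = tzero"
    proof (rule g_nondegenerate[OF T])
      fix w assume w: "w \<in> tangent_space A (cinv c x)"
      have "g (cinv c x) (of_coords A c (cinv c x) (w c)) (of_coords A c (cinv c x) v) = mform (Gm c x) (w c) v"
        using mform_metric[OF q(1), of "w c" v] q(2) by simp
      then show "g (cinv c x) (of_coords A c (cinv c x) v) w = 0"
        using v of_coords_coords[OF w q(1)] g_sym[OF T w] by (simp add: mform_def)
    qed
    then have "of_coords A c (cinv c x) v c = 0" by (simp add: tzero_def)
    then show "v = 0" using coords_of_coords[OF q(1)] by simp
  qed
  then show "invertible (Gm c x)"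
    using matrix_left_invertible_ker[of "Gm c x"] invertible_left_inverse by blast
qed

lemma metric_change:
  assumes c: "c \<in> A" "d \<in> A" and x: "x \<in> overlap c d"
  shows "mform (Gm c x) v w = mform (Gm d (transition c d x)) (dtr c d x v) (dtr c d x w)"
proof -
  obtain q where q: "q \<in> cdom c" "q \<in> cdom d" "x = cmap c q" using overlapE[OF c(1) x] by blast
  have ch: "c \<in> charts_at A q" "d \<in> charts_at A q" using c q by (auto simp: charts_at_def)
  show ?thesis
    unfolding q(3) transition_cmap[OF c(1) q(1)] mform_metric[OF ch(1)] mform_metric[OF ch(2)]
    using of_coords_change[OF ch] by simp
qed

text \<open>Product rule applied to \<open>metric_change\<close> along the line through
  \<open>x\<close> in direction \<open>h\<close>, which stays in the overlap for small
  parameters.\<close>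

lemma metric_change_deriv:
  assumes c: "c \<in> A" "d \<in> A" and x: "x \<in> overlap c d"
  shows "mform (mderiv (Gm c) x h) v w =
    mform (mderiv (Gm d) (transition c d x) (dtr c d x h)) (dtr c d x v) (dtr c d x w)
    + mform (Gm d (transition c d x)) (ddtr c d v x h) (dtr c d x w)
    + mform (Gm d (transition c d x)) (dtr c d x v) (ddtr c d w x h)"
proof -
  interpret Gc: C11_metric "cran c" "Gm c" by (rule C11_metric_chart[OF c(1)])
  interpret Gd: C11_metric "cran d" "Gm d" by (rule C11_metric_chart[OF c(2)])
  define \<tau> where "\<tau> = transition c d"
  obtain q where q: "q \<in> cdom c" "q \<in> cdom d" "x = cmap c q" using overlapE[OF c(1) x] by blast
  have \<tau>x: "\<tau> x \<in> cran d" using q c by (simp add: \<tau>_def transition_cmap)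
  have xc: "x \<in> cran c" using q by simp
  let ?l = "\<lambda>s::real. x + s *\<^sub>R h"
  have line: "(f \<circ> ?l has_vector_derivative f' h) (at 0)" if "(f has_derivative f') (at x)" for f :: "real^'n \<Rightarrow> 'z::real_normed_vector" and f'
    using has_derivative_along_line[of f f' x 0 h UNIV] that by (simp add: has_vector_derivative_def o_def)
  have "(Gm d \<circ> \<tau> has_derivative mderiv (Gm d) (\<tau> x) \<circ> dtr c d x) (at x)"
    using diff_chain_at[OF transition_deriv[OF c x, folded \<tau>_def] Gd.G_deriv[OF \<tau>x]] by simp
  from line[OF this] have 1: "((\<lambda>s. Gm d (\<tau> (?l s))) has_vector_derivative mderiv (Gm d) (\<tau> x) (dtr c d x h)) (at 0)"
    by (simp add: o_def)
  have 2: "((\<lambda>s. dtr c d (?l s) u) has_vector_derivative ddtr c d u x h) (at 0)" for u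
    using line[OF transition_deriv2(1)[OF c x]] by (simp add: o_def)
  have 3: "((\<lambda>s. Gm c (?l s)) has_vector_derivative mderiv (Gm c) x h) (at 0)"
    using line[OF Gc.G_deriv[OF xc]] by (simp add: o_def)
  have L: "((\<lambda>s. mform (Gm c (?l s)) v w) has_vector_derivative mform (mderiv (Gm c) x h) v w) (at 0)"
    using mform_has_derivative[OF 3 has_vector_derivative_const has_vector_derivative_const, of v w]
    by (simp add: mform_def)
  have R: "((\<lambda>s. mform (Gm d (\<tau> (?l s))) (dtr c d (?l s) v) (dtr c d (?l s) w)) has_vector_derivative
    mform (mderiv (Gm d) (\<tau> x) (dtr c d x h)) (dtr c d x v) (dtr c d x w)
    + mform (Gm d (\<tau> x)) (ddtr c d v x h) (dtr c d x w)
    + mform (Gm d (\<tau> x)) (dtr c d x v) (ddtr c d w x h)) (at 0)"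
    using mform_has_derivative[OF 1 2[of v] 2[of w]] by simp
  have op: "open (?l -` overlap c d)"
    by (intro open_vimage open_overlap c continuous_intros)
  have "((\<lambda>s. mform (Gm c (?l s)) v w) has_vector_derivative
    mform (mderiv (Gm d) (\<tau> x) (dtr c d x h)) (dtr c d x v) (dtr c d x w)
    + mform (Gm d (\<tau> x)) (ddtr c d v x h) (dtr c d x w)
    + mform (Gm d (\<tau> x)) (dtr c d x v) (ddtr c d w x h)) (at 0)"
    by (rule has_vector_derivative_transform_within_open[OF R op])
       (use x in \<open>simp_all add: metric_change[OF c] \<tau>_def\<close>)
  then show ?thesis using L vector_derivative_unique_at unfolding \<tau>_def by blast
qed

text \<open>The acceleration of the image curve is \<open>dtr c d x a + ddtr c d u x u\<close> for \<open>a\<close> the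
  acceleration of the original one. In the Euler--Lagrange equation the second order terms
  cancel by the symmetry of the second derivative.\<close>

lemma accel_change:
  assumes c: "c \<in> A" "d \<in> A" and x: "x \<in> overlap c d"
  shows "dtr c d x (accel (Gm c) x u) + ddtr c d u x u = accel (Gm d) (transition c d x) (dtr c d x u)"
proof -
  interpret Gc: C11_metric "cran c" "Gm c" by (rule C11_metric_chart[OF c(1)])
  interpret Gd: C11_metric "cran d" "Gm d" by (rule C11_metric_chart[OF c(2)])
  obtain q where q: "q \<in> cdom c" "q \<in> cdom d" "x = cmap c q" using overlapE[OF c(1) x] by blast
  define y where "y = transition c d x"
  have y: "y = cmap d q" using q c by (simp add: y_def transition_cmap)
  have xc: "x \<in> cran c" and yd: "y \<in> cran d" using q y by simp_all
  define \<theta> where "\<theta> = dtr c d x"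
  show ?thesis unfolding y_def[symmetric] \<theta>_def[symmetric]
  proof (rule Gd.accel_eqI[OF yd])
    fix w'
    define w where "w = dtr d c y w'"
    have w: "\<theta> w = w'" using dtr_inverse[of d c q w'] c q by (simp add: w_def \<theta>_def y)
    note chg = metric_change_deriv[OF c x, folded y_def \<theta>_def]
    have "mform (Gm d y) (\<theta> (accel (Gm c) x u)) w' = mform (Gm c x) (accel (Gm c) x u) w"
      unfolding metric_change[OF c x] by (simp add: y_def[symmetric] \<theta>_def[symmetric] w)
    also have "\<dots> = 1/2 * mform (mderiv (Gm c) x w) u u - mform (mderiv (Gm c) x u) u w"
      by (rule Gc.accel_el[OF xc])
    finally show "mform (Gm d y) (\<theta> (accel (Gm c) x u) + ddtr c d u x u) w' =
      1 / 2 * mform (mderiv (Gm d) y w') (\<theta> u) (\<theta> u) - mform (mderiv (Gm d) y (\<theta> u)) (\<theta> u) w'"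
      \<comment> \<open>Half of the first instance produces the pairing of \<open>\<theta> u\<close>
        with \<open>ddtr c d u x w\<close>; the second one subtracts its pairing with
        \<open>ddtr c d w x u\<close>. These cancel by symmetry, and what is left is minus the
        pairing of \<open>ddtr c d u x u\<close> with \<open>w'\<close>, which the extra term on the
        left compensates.\<close>
      using chg[of w u u] chg[of u u w] ddtr_sym[OF c x, of w u]
        Gd.G_sym[OF yd, of "\<theta> u" "ddtr c d u x w"] by (simp add: w mform_linear field_simps)
  qed
qed

end

section \<open>Geodesics on the manifold\<close>

lemma has_vector_derivative_apply:
  assumes "(x has_vector_derivative u) (at t)" "(f has_derivative D) (at (x t))"
  shows "((\<lambda>s. f (x s)) has_vector_derivative D u) (at t)"
  using has_derivative_compose[OF assms(1)[unfolded has_vector_derivative_def] assms(2)]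
    linear_cmul[OF has_derivative_linear[OF assms(2)]]
  by (simp add: has_vector_derivative_def)

context pseudo_riemannian
begin

text \<open>\<open>transition_deriv2\<close> differentiates \<open>dtr c d y v\<close> in
  \<open>y\<close> for a fixed vector \<open>v\<close> only. Here the vector moves as well, so it is
  expanded in the standard basis and the product rule is applied to each coefficient.\<close>

lemma dtr_curve_deriv:
  assumes c: "c \<in> A" "d \<in> A" and x: "x t \<in> overlap c d"
    and J: "open J" "t \<in> J" "\<And>s. s \<in> J \<Longrightarrow> x s \<in> overlap c d"
    and dx: "(x has_vector_derivative u t) (at t)" and du: "(u has_vector_derivative a) (at t)"
  shows "((\<lambda>s. dtr c d (x s) (u s)) has_vector_derivative (dtr c d (x t) a + ddtr c d (u t) (x t) (u t))) (at t)"
proof -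
  have expand: "L v = (\<Sum>i\<in>UNIV. v $ i *\<^sub>R L (axis i 1))" if "bounded_linear L" for L :: "real^'n \<Rightarrow> real^'n" and v
  proof -
    have "linear L" by (rule bounded_linear.linear[OF that])
    have "L v = L (\<Sum>i\<in>UNIV. v $ i *\<^sub>R axis i 1)" using vec_as_sum_axis[of v] by simp
    then show ?thesis using \<open>linear L\<close> by (simp add: linear_sum linear_cmul)
  qed
  have 1: "((\<lambda>s. dtr c d (x s) v) has_vector_derivative ddtr c d v (x t) (u t)) (at t)" for v
    by (rule has_vector_derivative_apply[OF dx transition_deriv2(1)[OF c x]])
  have 2: "((\<lambda>s. u s $ i) has_vector_derivative a $ i) (at t)" for i
    using bounded_linear.has_vector_derivative[OF bounded_linear_vec_nth du] .
  have "((\<lambda>s. \<Sum>i\<in>UNIV. u s $ i *\<^sub>R dtr c d (x s) (axis i 1)) has_vector_derivative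
      (\<Sum>i\<in>UNIV. u t $ i *\<^sub>R ddtr c d (axis i 1) (x t) (u t) + a $ i *\<^sub>R dtr c d (x t) (axis i 1))) (at t)"
    by (intro has_vector_derivative_sum bounded_bilinear.has_vector_derivative[OF bounded_bilinear_scaleR 2 1])
  \<comment> \<open>Symmetry moves the basis vector into the last argument of \<open>ddtr\<close>,
    which is linear because it is the argument of a derivative; there the sum can be collected
    again.\<close>
  also have "(\<Sum>i\<in>UNIV. u t $ i *\<^sub>R ddtr c d (axis i 1) (x t) (u t) + a $ i *\<^sub>R dtr c d (x t) (axis i 1))
    = (\<Sum>i\<in>UNIV. u t $ i *\<^sub>R ddtr c d (u t) (x t) (axis i 1)) + (\<Sum>i\<in>UNIV. a $ i *\<^sub>R dtr c d (x t) (axis i 1))"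
    using ddtr_sym[OF c x, of _ "u t"] by (simp add: sum.distrib)
  also have "\<dots> = dtr c d (x t) a + ddtr c d (u t) (x t) (u t)"
    using expand[OF dtr_linear[OF c x], of a]
      expand[OF has_derivative_bounded_linear[OF transition_deriv2(1)[OF c x, of "u t"]], of "u t"] by simp
  finally show ?thesis
    by (rule has_vector_derivative_transform_within_open[OF _ J(1,2)])
       (simp add: expand[OF dtr_linear[OF c J(3)], symmetric])
qed

lemma geodesic_on_iff:
  "geodesic_on A g I \<gamma> \<longleftrightarrow> continuous_on I \<gamma> \<and>
     (\<forall>t\<in>I. \<forall>c\<in>charts_at A (\<gamma> t).
        (cmap c \<circ> \<gamma> has_vector_derivative vector_derivative (cmap c \<circ> \<gamma>) (at t)) (at t) \<and>
        ((\<lambda>s. vector_derivative (cmap c \<circ> \<gamma>) (at s)) has_vector_derivative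
          accel (Gm c) ((cmap c \<circ> \<gamma>) t) (vector_derivative (cmap c \<circ> \<gamma>) (at t))) (at t))"
  unfolding geodesic_on_def Let_def accel_christoffel ..

text \<open>\<open>geodesic_on\<close> demands the equation in every chart around each point of the
  curve, whereas the solutions are constructed in one chart; \<open>accel_change\<close> bridges the
  two.\<close>

lemma geodesic_from_chart:
  assumes c: "c \<in> A" and I: "open I"
    and x: "\<And>t. t \<in> I \<Longrightarrow> x t \<in> cran c"
    and dx: "\<And>t. t \<in> I \<Longrightarrow> (x has_vector_derivative u t) (at t)"
    and du: "\<And>t. t \<in> I \<Longrightarrow> (u has_vector_derivative accel (Gm c) (x t) (u t)) (at t)"
  shows "geodesic_on A g I (cinv c \<circ> x)"
    and "t \<in> I \<Longrightarrow> velocity A (cinv c \<circ> x) t = of_coords A c (cinv c (x t)) (u t)"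
proof -
  have contx: "continuous_on I x"
    using dx by (meson continuous_at_imp_continuous_on has_vector_derivative_continuous)
  have eq: "cmap d \<circ> (cinv c \<circ> x) = (\<lambda>s. transition c d (x s))" for d
    by (auto simp: transition_def)
  have first: "((\<lambda>s. transition c d (x s)) has_vector_derivative dtr c d (x t) (u t)) (at t)"
    if "d \<in> A" "t \<in> I" "x t \<in> overlap c d" for d t
    by (rule has_vector_derivative_apply[OF dx[OF that(2)] transition_deriv[OF c that(1,3)]])
  have ov: "x t \<in> overlap c d" if "t \<in> I" "d \<in> charts_at A (cinv c (x t))" for d t
    using in_overlap[of "cinv c (x t)" c d] cinv_in[OF c x] cmap_cinv[OF c x] that charts_atD by auto
  show "geodesic_on A g I (cinv c \<circ> x)"
    unfolding geodesic_on_iff eq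
  proof (intro conjI ballI)
    show "continuous_on I (cinv c \<circ> x)"
      using continuous_on_compose[OF contx continuous_on_subset[OF continuous_cinv[OF c]]] x by blast
    fix t d assume t: "t \<in> I" and "d \<in> charts_at A ((cinv c \<circ> x) t)"
    then have d: "d \<in> A" "x t \<in> overlap c d" using ov charts_atD by auto
    show "((\<lambda>s. transition c d (x s)) has_vector_derivative vector_derivative (\<lambda>s. transition c d (x s)) (at t)) (at t)"
      using first[OF d(1) t d(2)] by (simp add: vector_derivative_at)
    define J where "J = I \<inter> x -` overlap c d"
    have J: "open J" "t \<in> J" "\<And>s. s \<in> J \<Longrightarrow> s \<in> I \<and> x s \<in> overlap c d"
      using continuous_on_open_vimage[OF I] contx open_overlap[OF c d(1)] t d by (auto simp: J_def Int_commute)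
    have "((\<lambda>s. dtr c d (x s) (u s)) has_vector_derivative (dtr c d (x t) (accel (Gm c) (x t) (u t)) + ddtr c d (u t) (x t) (u t))) (at t)"
      by (rule dtr_curve_deriv[where x=x and u=u and t=t and J=J]) (use c d J dx[OF t] du[OF t] in auto)
    then have *: "((\<lambda>s. dtr c d (x s) (u s)) has_vector_derivative accel (Gm d) (transition c d (x t)) (dtr c d (x t) (u t))) (at t)"
      unfolding accel_change[OF c d] .
    have vd: "vector_derivative (\<lambda>s. transition c d (x s)) (at s) = dtr c d (x s) (u s)" if "s \<in> J" for s
      using first[OF d(1)] J(3)[OF that] by (simp add: vector_derivative_at)
    have "((\<lambda>s. vector_derivative (\<lambda>s. transition c d (x s)) (at s)) has_vector_derivative
      accel (Gm d) (transition c d (x t)) (dtr c d (x t) (u t))) (at t)"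
      by (rule has_vector_derivative_transform_within_open[OF * J(1,2)])
         (simp add: vd)
    then show "((\<lambda>s. vector_derivative (\<lambda>s. transition c d (x s)) (at s)) has_vector_derivative
      accel (Gm d) (transition c d (x t)) (vector_derivative (\<lambda>s. transition c d (x s)) (at t))) (at t)"
      using first[OF d(1) t d(2)] by (simp add: vector_derivative_at)
  qed
  show "velocity A (cinv c \<circ> x) t = of_coords A c (cinv c (x t)) (u t)" if t: "t \<in> I"
  proof
    fix d
    show "velocity A (cinv c \<circ> x) t d = of_coords A c (cinv c (x t)) (u t) d"
      unfolding velocity_def of_coords_eq eq
      using first[OF _ t ov[OF t]] charts_atD cmap_cinv[OF c x[OF t]] by (auto simp: vector_derivative_at)
  qed
qed

section \<open>Uniqueness of geodesics\<close>

lemma geodesic_local: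
  assumes geo: "geodesic_on A g I \<gamma>" and I: "open I" "t \<in> I" and c: "c \<in> charts_at A (\<gamma> t)"
    and x: "x = cmap c \<circ> \<gamma>" and u: "u = (\<lambda>s. vector_derivative x (at s))"
  obtains J where "open J" "t \<in> J" "J \<subseteq> I" "\<And>s. s \<in> J \<Longrightarrow> c \<in> charts_at A (\<gamma> s)"
    "\<And>s. s \<in> J \<Longrightarrow> (x has_vector_derivative u s) (at s)"
    "\<And>s. s \<in> J \<Longrightarrow> (u has_vector_derivative accel (Gm c) (x s) (u s)) (at s)"
    "continuous_on J u"
proof -
  have cont: "continuous_on I \<gamma>" using geo by (simp add: geodesic_on_def)
  define J where "J = I \<inter> \<gamma> -` cdom c"
  have cA: "c \<in> A" "\<gamma> t \<in> cdom c" using c charts_atD by auto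
  have "open J" unfolding J_def Int_commute[of I]
    by (rule continuous_on_open_vimage[OF I(1), THEN iffD1, rule_format, OF cont chart_open(1)[OF cA(1)]])
  then have J: "open J" "t \<in> J" "J \<subseteq> I" "\<And>s. s \<in> J \<Longrightarrow> c \<in> charts_at A (\<gamma> s)"
    using I(2) cA by (simp_all add: J_def charts_at_def)
  have d: "(x has_vector_derivative u s) (at s)" "(u has_vector_derivative accel (Gm c) (x s) (u s)) (at s)"
    if "s \<in> J" for s
    using geo J(3) J(4)[OF that] that unfolding geodesic_on_iff x u by blast+
  have "continuous_on J u"
    using d(2) by (meson continuous_at_imp_continuous_on has_vector_derivative_continuous)
  from that[OF J d this] show thesis .
qed

lemma velocity_tangent:
  assumes geo: "geodesic_on A g I \<gamma>" and I: "open I" "t \<in> I"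
  shows "velocity A \<gamma> t \<in> tangent_space A (\<gamma> t)"
  unfolding tangent_space_def
proof (intro CollectI conjI ballI allI impI)
  fix c d assume cd: "c \<in> charts_at A (\<gamma> t)" "d \<in> charts_at A (\<gamma> t)"
  then have A: "c \<in> A" "d \<in> A" "cmap c (\<gamma> t) \<in> overlap c d" using charts_atD in_overlap by auto
  obtain J where J: "open J" "t \<in> J" "\<And>s. s \<in> J \<Longrightarrow> c \<in> charts_at A (\<gamma> s)"
    "\<And>s. s \<in> J \<Longrightarrow> (cmap c \<circ> \<gamma> has_vector_derivative vector_derivative (cmap c \<circ> \<gamma>) (at s)) (at s)"
    using geodesic_local[OF geo I cd(1) refl refl] by metis
  have tr: "transition c d (cmap c (\<gamma> s)) = cmap d (\<gamma> s)" if "s \<in> J" for s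
    using transition_cmap J(3)[OF that] charts_atD by blast
  let ?u = "vector_derivative (cmap c \<circ> \<gamma>) (at t)"
  have "((\<lambda>s. transition c d ((cmap c \<circ> \<gamma>) s)) has_vector_derivative dtr c d (cmap c (\<gamma> t)) ?u) (at t)"
    by (rule has_vector_derivative_apply[OF J(4)[OF J(2)]]) (simp add: transition_deriv[OF A])
  then have "(cmap d \<circ> \<gamma> has_vector_derivative dtr c d (cmap c (\<gamma> t)) ?u) (at t)"
    by (rule has_vector_derivative_transform_within_open[OF _ J(1,2)])
       (simp add: tr)
  then show "velocity A \<gamma> t d = frechet_derivative (transition c d) (at (cmap c (\<gamma> t))) (velocity A \<gamma> t c)"
    using cd by (simp add: velocity_def dtr_def vector_derivative_at)
qed (simp add: velocity_def)

text \<open>The geodesic equation as a first order system for position and velocity, in the form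
  needed by \<open>ode_unique_local\<close>. The velocity is confined to a ball because the system
  is quadratic in it.\<close>

lemma accel_lipschitz_bounded:
  assumes c: "c \<in> A" and x0: "x0 \<in> cran c" and \<rho>: "0 \<le> \<rho>"
  obtains R L where "0 < R" "L-lipschitz_on (cball x0 R \<times> cball 0 \<rho>) (\<lambda>z. (snd z, accel (Gm c) (fst z) (snd z)))"
proof -
  interpret C11_metric "cran c" "Gm c" by (rule C11_metric_chart[OF c])
  obtain R M where R: "0 < R" "0 \<le> M"
    and M: "\<And>r x y u w. \<lbrakk>0 \<le> r; x \<in> cball x0 R; y \<in> cball x0 R; norm u \<le> r; norm w \<le> r\<rbrakk>
      \<Longrightarrow> norm (accel (Gm c) x u - accel (Gm c) y w) \<le> M * (r * r * norm (x - y) + r * norm (u - w))"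
    by (rule accel_lipschitz[OF x0]) blast
  have "(1 + M * (\<rho> * \<rho> + \<rho>))-lipschitz_on (cball x0 R \<times> cball 0 \<rho>) (\<lambda>z. (snd z, accel (Gm c) (fst z) (snd z)))"
  proof (rule lipschitz_onI)
    fix z z' :: "(real^'n) \<times> (real^'n)"
    assume z: "z \<in> cball x0 R \<times> cball 0 \<rho>" "z' \<in> cball x0 R \<times> cball 0 \<rho>"
    define x u y w where "x = fst z" and "u = snd z" and "y = fst z'" and "w = snd z'"
    have xy: "x \<in> cball x0 R" "y \<in> cball x0 R" "norm u \<le> \<rho>" "norm w \<le> \<rho>"
      using z by (auto simp: x_def y_def u_def w_def)
    have d: "norm (x - y) \<le> dist z z'" "norm (u - w) \<le> dist z z'"
      using dist_fst_le[of z z'] dist_snd_le[of z z'] by (auto simp: x_def y_def u_def w_def dist_norm)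
    have "norm (accel (Gm c) x u - accel (Gm c) y w) \<le> M * (\<rho> * \<rho> * dist z z' + \<rho> * dist z z')"
      using d R \<rho> by (intro order_trans[OF M[OF \<rho> xy]] mult_left_mono add_mono) auto
    then have "dist (u, accel (Gm c) x u) (w, accel (Gm c) y w) \<le> dist z z' + M * (\<rho> * \<rho> * dist z z' + \<rho> * dist z z')"
      using d(2) norm_Pair_le[of "u - w" "accel (Gm c) x u - accel (Gm c) y w"] by (simp add: dist_norm)
    then show "dist (snd z, accel (Gm c) (fst z) (snd z)) (snd z', accel (Gm c) (fst z') (snd z')) \<le> (1 + M * (\<rho> * \<rho> + \<rho>)) * dist z z'"
      by (simp add: x_def u_def y_def w_def algebra_simps)
  qed (use \<rho> R in simp)
  then show thesis using that R by blast
qed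

lemma geodesic_unique_local:
  assumes geo: "geodesic_on A g I \<gamma>" "geodesic_on A g I \<sigma>" and I: "open I" "t \<in> I"
    and eq: "\<gamma> t = \<sigma> t" "velocity A \<gamma> t = velocity A \<sigma> t"
  obtains e where "0 < e" "\<And>s. s \<in> ball t e \<Longrightarrow> \<gamma> s = \<sigma> s \<and> velocity A \<gamma> s = velocity A \<sigma> s"
proof -
  obtain c where c: "c \<in> charts_at A (\<gamma> t)" using charts_at_ex by blast
  then have c': "c \<in> charts_at A (\<sigma> t)" using eq by simp
  have cA: "c \<in> A" using c charts_atD by blast
  define x u where "x = cmap c \<circ> \<gamma>" and "u = (\<lambda>s. vector_derivative x (at s))"
  define y w where "y = cmap c \<circ> \<sigma>" and "w = (\<lambda>s. vector_derivative y (at s))"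
  obtain J1 where J1: "open J1" "t \<in> J1" "J1 \<subseteq> I" "\<And>s. s \<in> J1 \<Longrightarrow> c \<in> charts_at A (\<gamma> s)"
    "\<And>s. s \<in> J1 \<Longrightarrow> (x has_vector_derivative u s) (at s)"
    "\<And>s. s \<in> J1 \<Longrightarrow> (u has_vector_derivative accel (Gm c) (x s) (u s)) (at s)"
    by (rule geodesic_local[OF geo(1) I c x_def u_def]) (rule that)
  obtain J2 where J2: "open J2" "t \<in> J2" "J2 \<subseteq> I" "\<And>s. s \<in> J2 \<Longrightarrow> c \<in> charts_at A (\<sigma> s)"
    "\<And>s. s \<in> J2 \<Longrightarrow> (y has_vector_derivative w s) (at s)"
    "\<And>s. s \<in> J2 \<Longrightarrow> (w has_vector_derivative accel (Gm c) (y s) (w s)) (at s)"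
    by (rule geodesic_local[OF geo(2) I c' y_def w_def]) (rule that)
  define \<rho> where "\<rho> = norm (u t) + 1"
  have x0: "x t \<in> cran c" using c charts_atD by (auto simp: x_def)
  obtain R L where R: "0 < R" "L-lipschitz_on (cball (x t) R \<times> cball 0 \<rho>) (\<lambda>z. (snd z, accel (Gm c) (fst z) (snd z)))"
    by (rule accel_lipschitz_bounded[OF cA x0, of \<rho>]) (auto simp: \<rho>_def)
  \<comment> \<open>Open balls, so that both curves stay in \<open>S\<close> near \<open>t\<close>
    by continuity; the velocity bound exceeds the velocity at \<open>t\<close> by
    \<open>1\<close>.\<close>
  define S where "S = ball (x t) R \<times> ball (0 :: real^'n) \<rho>"
  have L: "L-lipschitz_on S (\<lambda>z. (snd z, accel (Gm c) (fst z) (snd z)))"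
    by (rule lipschitz_on_subset[OF R(2)]) (auto simp: S_def)
  define z where "z = (\<lambda>s. (x s, u s))"
  define z' where "z' = (\<lambda>s. (y s, w s))"
  have zd: "(z has_vector_derivative (snd (z s), accel (Gm c) (fst (z s)) (snd (z s)))) (at s)" if "s \<in> J1" for s
    unfolding z_def using J1(5,6)[OF that] by (auto intro: has_vector_derivative_Pair)
  have zd': "(z' has_vector_derivative (snd (z' s), accel (Gm c) (fst (z' s)) (snd (z' s)))) (at s)" if "s \<in> J2" for s
    unfolding z'_def using J2(5,6)[OF that] by (auto intro: has_vector_derivative_Pair)
  have zz: "z t = z' t"
    using eq c c' by (simp add: z_def z'_def x_def y_def u_def w_def velocity_def fun_eq_iff) metis
  have ct: "continuous_on J1 z" "continuous_on J2 z'"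
    using zd zd' by (meson continuous_at_imp_continuous_on has_vector_derivative_continuous)+
  have oS: "open S" by (simp add: S_def open_Times)
  have zS: "z t \<in> S" using R by (simp add: S_def z_def \<rho>_def)
  define J where "J = (J1 \<inter> z -` S) \<inter> (J2 \<inter> z' -` S)"
  have J: "open J" "t \<in> J"
    using continuous_on_open_vimage[OF J1(1), of z] continuous_on_open_vimage[OF J2(1), of z'] ct oS zS zz J1(2) J2(2)
    by (auto simp: J_def Int_commute)
  obtain e1 where e1: "0 < e1" "cball t e1 \<subseteq> J" using J open_contains_cball by blast
  have L0: "0 \<le> L" by (rule lipschitz_on_nonneg[OF L])
  define e where "e = min e1 (1 / (2 * (L + 1)))"
  have e: "0 < e" "cball t e \<subseteq> J" using e1 L0 by (auto simp: e_def)
  have "e \<le> 1 / (2 * (L + 1))" by (simp add: e_def)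
  then have "e * (2 * (L + 1)) \<le> 1" using L0 by (simp add: pos_le_divide_eq)
  then have eL: "e * L < 1" using e L0 by (simp add: algebra_simps)
  have *: "z s = z' s" if "s \<in> cball t e" for s
  proof (rule ode_unique_local[OF L e(1) eL])
    show "(z has_vector_derivative (snd (z s), accel (Gm c) (fst (z s)) (snd (z s)))) (at s) \<and> z s \<in> S" if "s \<in> cball t e" for s
      using zd[of s] that e(2) by (auto simp: J_def)
    show "(z' has_vector_derivative (snd (z' s), accel (Gm c) (fst (z' s)) (snd (z' s)))) (at s) \<and> z' s \<in> S" if "s \<in> cball t e" for s
      using zd'[of s] that e(2) by (auto simp: J_def)
  qed (use zz that in auto)
  show thesis
  proof (rule that[OF e(1)])
    fix s assume "s \<in> ball t e"
    then have s: "s \<in> cball t e" "s \<in> J1" "s \<in> J2" using e(2) by (auto simp: J_def)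
    have "cmap c (\<gamma> s) = cmap c (\<sigma> s)" using *[OF s(1)] by (simp add: z_def z'_def x_def y_def)
    then have \<gamma>\<sigma>: "\<gamma> s = \<sigma> s"
      using cinv_cmap[OF cA] J1(4)[OF s(2)] J2(4)[OF s(3)] charts_atD by metis
    moreover have "velocity A \<gamma> s = velocity A \<sigma> s"
    proof (rule tangent_eqI[OF _ _ J1(4)[OF s(2)]])
      show "velocity A \<gamma> s \<in> tangent_space A (\<gamma> s)" using J1(3) s by (intro velocity_tangent[OF geo(1) I(1)]) auto
      show "velocity A \<sigma> s \<in> tangent_space A (\<gamma> s)" unfolding \<gamma>\<sigma> using J1(3) s by (intro velocity_tangent[OF geo(2) I(1)]) auto
      show "velocity A \<gamma> s c = velocity A \<sigma> s c"
        using *[OF s(1)] J1(4)[OF s(2)] J2(4)[OF s(3)] by (simp add: velocity_def z_def z'_def u_def w_def x_def y_def)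
    qed
    ultimately show "\<gamma> s = \<sigma> s \<and> velocity A \<gamma> s = velocity A \<sigma> s" ..
  qed
qed

text \<open>Different positions are separated by the Hausdorff property. If the positions agree, a
  common chart is available and the velocities are separated in it by continuity. Thus the set of
  agreement is relatively closed.\<close>

lemma geodesic_separate_local:
  assumes geo: "geodesic_on A g I \<gamma>" "geodesic_on A g I \<sigma>" and I: "open I" "t \<in> I"
    and ne: "\<not> (\<gamma> t = \<sigma> t \<and> velocity A \<gamma> t = velocity A \<sigma> t)"
  obtains J where "open J" "t \<in> J" "\<And>s. s \<in> J \<Longrightarrow> \<not> (\<gamma> s = \<sigma> s \<and> velocity A \<gamma> s = velocity A \<sigma> s)"
proof (cases "\<gamma> t = \<sigma> t")
  case False
  from hausdorff[OF this] obtain V W where VW: "open V" "open W" "\<gamma> t \<in> V" "\<sigma> t \<in> W" "V \<inter> W = {}" by blast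
  have cont: "continuous_on I \<gamma>" "continuous_on I \<sigma>" using geo by (simp_all add: geodesic_on_def)
  show thesis
    by (rule that[of "(I \<inter> \<gamma> -` V) \<inter> (I \<inter> \<sigma> -` W)"])
       (use continuous_on_open_vimage[OF I(1)] cont VW I in \<open>auto simp: Int_commute\<close>)
next
  case True
  obtain c where c: "c \<in> charts_at A (\<gamma> t)" using charts_at_ex by blast
  then have c': "c \<in> charts_at A (\<sigma> t)" using True by simp
  define x where "x = cmap c \<circ> \<gamma>"
  define u where "u = (\<lambda>s. vector_derivative x (at s))"
  define y where "y = cmap c \<circ> \<sigma>"
  define w where "w = (\<lambda>s. vector_derivative y (at s))"
  obtain J1 where J1: "open J1" "t \<in> J1" "\<And>s. s \<in> J1 \<Longrightarrow> c \<in> charts_at A (\<gamma> s)" "continuous_on J1 u"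
    by (rule geodesic_local[OF geo(1) I c x_def u_def]) (rule that)
  obtain J2 where J2: "open J2" "t \<in> J2" "\<And>s. s \<in> J2 \<Longrightarrow> c \<in> charts_at A (\<sigma> s)" "continuous_on J2 w"
    by (rule geodesic_local[OF geo(2) I c' y_def w_def]) (rule that)
  have "velocity A \<gamma> t c \<noteq> velocity A \<sigma> t c"
    using tangent_eqI[OF velocity_tangent[OF geo(1) I] _ c] velocity_tangent[OF geo(2) I] True ne by metis
  then have uw: "u t - w t \<noteq> 0" using c c' by (simp add: velocity_def u_def w_def x_def y_def)
  have "continuous_on (J1 \<inter> J2) (\<lambda>s. u s - w s)"
    using J1(4) J2(4) by (intro continuous_on_diff) (auto elim: continuous_on_subset)
  then have "open ((\<lambda>s. u s - w s) -` (- {0}) \<inter> (J1 \<inter> J2))"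
    by (rule continuous_on_open_vimage[OF open_Int[OF J1(1) J2(1)], THEN iffD1, rule_format]) auto
  then show thesis
  proof (rule that)
    show "t \<in> (\<lambda>s. u s - w s) -` (- {0}) \<inter> (J1 \<inter> J2)" using uw J1 J2 by auto
    fix s assume s: "s \<in> (\<lambda>s. u s - w s) -` (- {0}) \<inter> (J1 \<inter> J2)"
    then have "velocity A \<gamma> s c \<noteq> velocity A \<sigma> s c"
      using J1(3)[of s] J2(3)[of s] by (simp add: velocity_def u_def w_def x_def y_def)
    then show "\<not> (\<gamma> s = \<sigma> s \<and> velocity A \<gamma> s = velocity A \<sigma> s)" by metis
  qed
qed

lemma geodesic_subset: "geodesic_on A g I \<gamma> \<Longrightarrow> J \<subseteq> I \<Longrightarrow> geodesic_on A g J \<gamma>"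
  unfolding geodesic_on_def using continuous_on_subset by blast

text \<open>The times at which positions and velocities agree form an open and relatively closed set
  containing \<open>0\<close> in a common interval of definition. This gives the definite
  description in \<open>exp_map\<close> its meaning.\<close>

lemma exp_rel_unique:
  assumes "exp_rel A g q v r" "exp_rel A g q v r'"
  shows "r = r'"
proof -
  obtain I \<gamma> where I: "open I" "is_interval I" "{0..1} \<subseteq> I" and \<gamma>: "geodesic_on A g I \<gamma>" "\<gamma> 0 = q" "velocity A \<gamma> 0 = v" "\<gamma> 1 = r"
    using assms(1) unfolding exp_rel_def by blast
  obtain I' \<sigma> where I': "open I'" "is_interval I'" "{0..1} \<subseteq> I'" and \<sigma>: "geodesic_on A g I' \<sigma>" "\<sigma> 0 = q" "velocity A \<sigma> 0 = v" "\<sigma> 1 = r'"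
    using assms(2) unfolding exp_rel_def by blast
  define J where "J = I \<inter> I'"
  have J: "open J" "connected J" "0 \<in> J" "1 \<in> J"
    using I I' is_interval_Int[OF I(2) I'(2)] by (auto simp: J_def open_Int is_interval_connected)
  have geo: "geodesic_on A g J \<gamma>" "geodesic_on A g J \<sigma>"
    using geodesic_subset \<gamma>(1) \<sigma>(1) by (auto simp: J_def)
  define P where "P = (\<lambda>s. \<gamma> s = \<sigma> s \<and> velocity A \<gamma> s = velocity A \<sigma> s)"
  define E where "E = {s \<in> J. P s}"
  have "open E"
  proof (subst open_subopen, rule ballI)
    fix t assume "t \<in> E"
    then have t: "t \<in> J" "P t" by (auto simp: E_def)
    obtain e where e: "0 < e" "\<And>s. s \<in> ball t e \<Longrightarrow> P s"
      using geodesic_unique_local[OF geo J(1) t(1)] t(2) unfolding P_def by blast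
    show "\<exists>T. open T \<and> t \<in> T \<and> T \<subseteq> E"
      by (rule exI[of _ "J \<inter> ball t e"]) (use e t J in \<open>auto simp: E_def open_Int\<close>)
  qed
  moreover have "open (J - E)"
  proof (subst open_subopen, rule ballI)
    fix t assume "t \<in> J - E"
    then have t: "t \<in> J" "\<not> P t" by (auto simp: E_def)
    obtain K where K: "open K" "t \<in> K" "\<And>s. s \<in> K \<Longrightarrow> \<not> P s"
      using geodesic_separate_local[OF geo J(1) t(1)] t(2) unfolding P_def by blast
    show "\<exists>T. open T \<and> t \<in> T \<and> T \<subseteq> J - E"
      by (rule exI[of _ "J \<inter> K"]) (use K t J in \<open>auto simp: E_def open_Int\<close>)
  qed
  moreover have "0 \<in> E" using \<gamma> \<sigma> J by (simp add: E_def P_def)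
  ultimately have "J - E = {}"
    using J(2) unfolding connected_def E_def by blast
  then have "1 \<in> E" using J by blast
  then show ?thesis using \<gamma> \<sigma> by (simp add: E_def P_def)
qed

lemma exp_map_eq: "exp_rel A g q v r \<Longrightarrow> exp_map A g q v = r"
  unfolding exp_map_def using exp_rel_unique by blast

end

section \<open>The Gauss lemma\<close>

lemma derivative_if_quadratic_error:
  fixes k :: "real \<Rightarrow> real"
  assumes r: "0 < r" and q: "\<And>s. \<bar>s\<bar> < r \<Longrightarrow> \<bar>k s - k 0 - s * m\<bar> \<le> C * s\<^sup>2"
  shows "(k has_real_derivative m) (at 0)"
proof -
  have "((\<lambda>s. (k s - k 0) / s - m) \<longlongrightarrow> 0) (at 0)"
  proof (rule tendsto_0_le[where f="\<lambda>s. s" and K="\<bar>C\<bar>"])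
    show "((\<lambda>s::real. s) \<longlongrightarrow> 0) (at 0)" by (rule tendsto_ident_at)
    show "\<forall>\<^sub>F s in at 0. norm ((k s - k 0) / s - m) \<le> norm s * \<bar>C\<bar>"
      unfolding eventually_at
    proof (intro exI[of _ r] conjI ballI impI r)
      fix s :: real assume s: "s \<noteq> 0 \<and> dist s 0 < r"
      have "\<bar>(k s - k 0) / s - m\<bar> * \<bar>s\<bar> = \<bar>k s - k 0 - s * m\<bar>"
        using s by (simp add: abs_mult[symmetric] field_simps)
      also have "\<dots> \<le> C * s\<^sup>2" using q[of s] s by simp
      also have "\<dots> \<le> (\<bar>s\<bar> * \<bar>C\<bar>) * \<bar>s\<bar>"
        by (simp add: power2_eq_square mult_ac abs_mult[symmetric])
      finally show "norm ((k s - k 0) / s - m) \<le> norm s * \<bar>C\<bar>" using s by (simp add: mult.commute)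
    qed
  qed
  then show ?thesis by (simp add: DERIV_def LIM_zero_iff)
qed

context pseudo_riemannian
begin

text \<open>\<open>E\<close> is the exponential map in coordinates, and \<open>V v\<close> is the
  velocity at time \<open>1\<close> of the geodesic with initial velocity \<open>v\<close>. The last
  clause holds since \<open>E (s *\<^sub>R v)\<close> is the point of that geodesic at time
  \<open>s\<close>; only \<open>s \<le> 1\<close> is used, so the derivative is one-sided.\<close>

lemma exp_in_chart:
  assumes c: "c \<in> charts_at A p"
  obtains \<rho> E V C where "0 < \<rho>"
    "\<And>v. norm v \<le> \<rho> \<Longrightarrow> E v \<in> cran c \<and> norm (E v - cmap c p) \<le> 8 * norm v"
    "\<And>v. norm v \<le> \<rho> \<Longrightarrow> exp_rel A g p (of_coords A c p v) (cinv c (E v))"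
    "\<And>v w. norm v \<le> \<rho> \<Longrightarrow> norm w \<le> \<rho> \<Longrightarrow> norm (E v - E w - (v - w)) \<le> norm (v - w) / 2"
    "\<And>v w. norm v \<le> \<rho> \<Longrightarrow> norm w \<le> \<rho> \<Longrightarrow>
       \<bar>mform (Gm c (E v)) (V v) (E w - E v) - mform (Gm c (cmap c p)) v (w - v)\<bar> \<le> C * (norm (w - v))\<^sup>2"
    "\<And>v. norm v \<le> \<rho> \<Longrightarrow> ((\<lambda>s. E (s *\<^sub>R v)) has_vector_derivative V v) (at 1 within {0..1})"
proof -
  have cA: "c \<in> A" "p \<in> cdom c" using c charts_atD by auto
  interpret C11_metric "cran c" "Gm c" by (rule C11_metric_chart[OF cA(1)])
  define x0 where "x0 = cmap c p"
  have x0: "x0 \<in> cran c" "cinv c x0 = p" using cA cinv_cmap by (auto simp: x0_def)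
  obtain \<rho> X U C where \<rho>: "0 < \<rho>"
    and b: "\<And>v t. \<lbrakk>norm v \<le> \<rho>; t \<in> {-1..2}\<rbrakk> \<Longrightarrow> X v t \<in> cran c \<and> norm (X v t - x0) \<le> 8 * norm v"
    and i: "\<And>v. norm v \<le> \<rho> \<Longrightarrow> X v 0 = x0 \<and> U v 0 = v"
    and o: "\<And>v t. \<lbrakk>norm v \<le> \<rho>; t \<in> {-1<..<2}\<rbrakk> \<Longrightarrow>
       (X v has_vector_derivative U v t) (at t) \<and> (U v has_vector_derivative accel (Gm c) (X v t) (U v t)) (at t)"
    and h: "\<And>v w. \<lbrakk>norm v \<le> \<rho>; norm w \<le> \<rho>\<rbrakk> \<Longrightarrow> norm (X v 1 - X w 1 - (v - w)) \<le> norm (v - w) / 2"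
    and ga: "\<And>v w. \<lbrakk>norm v \<le> \<rho>; norm w \<le> \<rho>\<rbrakk> \<Longrightarrow>
       \<bar>mform (Gm c (X v 1)) (U v 1) (X w 1 - X v 1) - mform (Gm c x0) v (w - v)\<bar> \<le> C * (norm (w - v))\<^sup>2"
    by (rule local_exp[OF x0(1)]) blast
  \<comment> \<open>The reparametrised curve \<open>X v (s * t)\<close> has initial velocity
    \<open>s *\<^sub>R v\<close> and is again a geodesic because the acceleration is quadratic in
    the velocity (\<open>accel_scale\<close>).\<close>
  have ray: "exp_rel A g p (of_coords A c p (s *\<^sub>R v)) (cinv c (X v s))" if v: "norm v \<le> \<rho>" and s: "s \<in> {0..1}" for v s
  proof -
    define I where "I = {-1<..<2::real}"
    define x where "x = (\<lambda>t. X v (s * t))"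
    define u where "u = (\<lambda>t. s *\<^sub>R U v (s * t))"
    have st: "s * t \<in> {-1<..<2}" if "t \<in> I" for t
    proof -
      have "\<bar>s * t\<bar> \<le> \<bar>t\<bar>" using s by (simp add: abs_mult mult_left_le_one_le)
      moreover have "s * t \<ge> min 0 t \<and> s * t \<le> max 0 t"
        using s by (cases "0 \<le> t") (auto simp: mult_nonneg_nonpos mult_left_le_one_le mult_le_cancel_right1)
      ultimately show ?thesis using that by (auto simp: I_def)
    qed
    have lin: "((\<lambda>t. s * t) has_real_derivative s) (at t)" for t
      by (auto intro!: derivative_eq_intros)
    have dx: "(x has_vector_derivative u t) (at t)" if "t \<in> I" for t
      using vector_diff_chain_at[OF lin[of t, unfolded has_real_derivative_iff_has_vector_derivative], of "X v"] o[OF v st[OF that]]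
      unfolding x_def u_def o_def by simp
    have du: "(u has_vector_derivative accel (Gm c) (x t) (u t)) (at t)" if "t \<in> I" for t
    proof -
      have "((\<lambda>t. U v (s * t)) has_vector_derivative s *\<^sub>R accel (Gm c) (X v (s * t)) (U v (s * t))) (at t)"
        using vector_diff_chain_at[OF lin[of t, unfolded has_real_derivative_iff_has_vector_derivative], of "U v"] o[OF v st[OF that]]
        unfolding o_def by simp
      from bounded_linear.has_vector_derivative[OF bounded_linear_scaleR_right this, of s]
      show ?thesis by (simp add: x_def u_def accel_scale)
    qed
    have xI: "x t \<in> cran c" if "t \<in> I" for t using b[OF v, of "s * t"] st[OF that] by (simp add: x_def)
    have I: "open I" "is_interval I" "{0..1} \<subseteq> I" "0 \<in> I" by (auto simp: I_def is_interval_oo)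
    have "geodesic_on A g I (cinv c \<circ> x)"
      by (rule geodesic_from_chart(1)[OF cA(1) I(1) xI dx du])
    moreover have "velocity A (cinv c \<circ> x) 0 = of_coords A c p (s *\<^sub>R v)"
      using geodesic_from_chart(2)[OF cA(1) I(1) xI dx du I(4)] i[OF v] x0 by (simp add: x_def u_def)
    moreover have "(cinv c \<circ> x) 0 = p" "(cinv c \<circ> x) 1 = cinv c (X v s)" using i[OF v] x0 by (simp_all add: x_def)
    ultimately show ?thesis unfolding exp_rel_def using I by blast
  qed
  \<comment> \<open>The solution constructed for \<open>s *\<^sub>R v\<close> and the reparametrised
    one for \<open>v\<close> are compared on the manifold; the chart carries the equality of end
    points back to coordinates.\<close>
  have hom: "X (s *\<^sub>R v) 1 = X v s" if v: "norm v \<le> \<rho>" and s: "s \<in> {0..1}" for v s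
  proof -
    have sv: "norm (s *\<^sub>R v) \<le> \<rho>" using v s mult_left_le_one_le[of "norm v" s] by simp
    have "cinv c (X (s *\<^sub>R v) 1) = cinv c (X v s)"
      by (rule exp_rel_unique[OF _ ray[OF v s]]) (use ray[OF sv, of 1] in simp)
    moreover have "X (s *\<^sub>R v) 1 \<in> cran c" "X v s \<in> cran c" using b[OF sv, of 1] b[OF v, of s] s by auto
    ultimately show ?thesis using cmap_cinv[OF cA(1)] by metis
  qed
  show thesis
  proof (rule that[of \<rho> "\<lambda>v. X v 1" "\<lambda>v. U v 1" C])
    show "X v 1 \<in> cran c \<and> norm (X v 1 - cmap c p) \<le> 8 * norm v" if "norm v \<le> \<rho>" for v
      using b[OF that, of 1] by (simp add: x0_def)
    show "exp_rel A g p (of_coords A c p v) (cinv c (X v 1))" if "norm v \<le> \<rho>" for v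
      using ray[OF that, of 1] by simp
    show "((\<lambda>s. X (s *\<^sub>R v) 1) has_vector_derivative U v 1) (at 1 within {0..1})" if v: "norm v \<le> \<rho>" for v
    proof (rule has_vector_derivative_transform)
      show "(X v has_vector_derivative U v 1) (at 1 within {0..1})"
        using o[OF v, of 1] by (simp add: has_vector_derivative_at_within)
    qed (use hom[OF v] in auto)
  qed (use \<rho> h ga in \<open>auto simp: x0_def\<close>)
qed

text \<open>The derivative at \<open>0\<close> of the pairing of \<open>u\<close> with
  \<open>E (v + s *\<^sub>R w) - E v\<close> is computed twice, by the chain rule and from the
  quadratic estimate. Together with \<open>E' v = u\<close> this is the Gauss lemma for the radial
  vector \<open>v\<close>.\<close>

lemma gauss_in_chart:
  assumes \<rho>: "norm v < \<rho>"
    and gauss: "\<And>w. norm w \<le> \<rho> \<Longrightarrow> \<bar>mform B u (E w - E v) - mform B0 v (w - v)\<bar> \<le> C * (norm (w - v))\<^sup>2"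
    and ray: "((\<lambda>s. E (s *\<^sub>R v)) has_vector_derivative u) (at 1 within {0..1})"
    and E': "(E has_derivative E') (at v)"
  shows "E' v = u" "mform B u (E' w) = mform B0 v w"
proof -
  have "((\<lambda>s. E (0 + s *\<^sub>R v)) has_derivative (\<lambda>k. k *\<^sub>R E' v)) (at 1 within {0..1})"
    by (rule has_derivative_along_line) (simp add: E')
  then have "((\<lambda>s. E (s *\<^sub>R v)) has_vector_derivative E' v) (at 1 within {0..1})"
    by (simp add: has_vector_derivative_def)
  then show "E' v = u"
    by (rule vector_derivative_unique_within[rotated]) (use ray in \<open>simp_all add: at_within_Icc_at_left trivial_limit_at_left_real\<close>)
  define k where "k = (\<lambda>s. mform B u (E (v + s *\<^sub>R w) - E v))"
  have "((\<lambda>s. E (v + s *\<^sub>R w)) has_derivative (\<lambda>k. k *\<^sub>R E' w)) (at 0)"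
    by (rule has_derivative_along_line) (simp add: E')
  then have "((\<lambda>s. E (v + s *\<^sub>R w) - E v) has_vector_derivative E' w) (at 0)"
    unfolding has_vector_derivative_def by (auto intro!: derivative_eq_intros)
  from mform_has_derivative[OF has_vector_derivative_const has_vector_derivative_const this, of B u]
  have "(k has_vector_derivative mform B u (E' w)) (at 0)" by (simp add: k_def mform_def)
  then have 1: "(k has_real_derivative mform B u (E' w)) (at 0)"
    by (simp add: has_real_derivative_iff_has_vector_derivative)
  have 2: "(k has_real_derivative mform B0 v w) (at 0)"
  proof (rule derivative_if_quadratic_error)
    \<comment> \<open>Keeps \<open>v + s *\<^sub>R w\<close> in the ball of radius
      \<open>\<rho>\<close>, where the estimate is available.\<close>
    define r where "r = (\<rho> - norm v) / (norm w + 1)"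
    have w1: "0 < norm w + 1" using norm_ge_zero[of w] by linarith
    show "0 < r" using \<rho> w1 by (simp add: r_def)
    fix s :: real assume s: "\<bar>s\<bar> < r"
    have "\<bar>s\<bar> * (norm w + 1) \<le> \<rho> - norm v" using s w1 by (simp add: r_def pos_less_divide_eq)
    then have "norm v + \<bar>s\<bar> * norm w \<le> \<rho>" by (simp add: algebra_simps)
    then have "norm (v + s *\<^sub>R w) \<le> \<rho>" by (intro norm_triangle_le) simp
    from gauss[OF this] show "\<bar>k s - k 0 - s * mform B0 v w\<bar> \<le> (C * (norm w)\<^sup>2) * s\<^sup>2"
      by (simp add: k_def mform_linear power_mult_distrib mult_ac)
  qed
  show "mform B u (E' w) = mform B0 v w" by (rule DERIV_unique[OF 1 2])
qed

lemma gauss_lemma: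
  assumes W: "open W" "p \<in> W"
  shows "\<exists>U S. U \<subseteq> W \<and> normal_neighbourhood A g p S U \<and>
      talmost_all A p S (\<lambda>x. \<exists>D. has_differential A p (exp_map A g p) D x \<and>
        (\<forall>v\<in>tangent_space A p. \<forall>w\<in>tangent_space A p. radial x v \<longrightarrow>
          g (exp_map A g p x) (D v) (D w) = g p v w))"
proof -
  obtain c where c: "c \<in> charts_at A p" using charts_at_ex by blast
  have cA: "c \<in> A" "p \<in> cdom c" using c charts_atD by auto
  define x0 where "x0 = cmap c p"
  obtain \<rho> E V C where \<rho>: "0 < \<rho>"
    and Eb: "\<And>v. norm v \<le> \<rho> \<Longrightarrow> E v \<in> cran c \<and> norm (E v - x0) \<le> 8 * norm v"
    and Erel: "\<And>v. norm v \<le> \<rho> \<Longrightarrow> exp_rel A g p (of_coords A c p v) (cinv c (E v))"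
    and Elip: "\<And>v w. norm v \<le> \<rho> \<Longrightarrow> norm w \<le> \<rho> \<Longrightarrow> norm (E v - E w - (v - w)) \<le> norm (v - w) / 2"
    and Egauss: "\<And>v w. norm v \<le> \<rho> \<Longrightarrow> norm w \<le> \<rho> \<Longrightarrow>
       \<bar>mform (Gm c (E v)) (V v) (E w - E v) - mform (Gm c x0) v (w - v)\<bar> \<le> C * (norm (w - v))\<^sup>2"
    and Eray: "\<And>v. norm v \<le> \<rho> \<Longrightarrow> ((\<lambda>s. E (s *\<^sub>R v)) has_vector_derivative V v) (at 1 within {0..1})"
    unfolding x0_def by (rule exp_in_chart[OF c]) blast
  have "open (cmap c ` (cdom c \<inter> W))" by (intro open_cmap_image[OF cA(1)] open_Int chart_open(1)[OF cA(1)] W) auto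
  moreover have "x0 \<in> cmap c ` (cdom c \<inter> W)" using cA W by (simp add: x0_def)
  ultimately obtain \<epsilon> where \<epsilon>: "0 < \<epsilon>" "cball x0 \<epsilon> \<subseteq> cmap c ` (cdom c \<inter> W)"
    using open_contains_cball by blast
  \<comment> \<open>Since \<open>E v\<close> is within \<open>8 * norm v\<close> of
    \<open>x0\<close>, the image of the ball \<open>Bd\<close> stays within
    \<open>\<epsilon>\<close> of \<open>x0\<close> and hence in the chart image of
    \<open>W\<close>.\<close>
  define \<delta> where "\<delta> = min \<rho> (\<epsilon> / 8)"
  have \<delta>: "0 < \<delta>" "\<delta> \<le> \<rho>" "8 * \<delta> \<le> \<epsilon>" using \<rho> \<epsilon> by (auto simp: \<delta>_def)
  define Bd where "Bd = ball (0::real^'n) \<delta>"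
  have BdD: "norm v < \<delta>" "norm v \<le> \<rho>" if "v \<in> Bd" for v using that \<delta> by (auto simp: Bd_def)
  have oBd: "open Bd" by (simp add: Bd_def)
  define T where "T = of_coords A c p"
  define S where "S = T ` Bd"
  define U where "U = (\<lambda>v. cinv c (E v)) ` Bd"
  define e where "e = exp_map A g p"
  have eT: "e (T v) = cinv c (E v)" if "norm v \<le> \<rho>" for v
    unfolding e_def T_def by (rule exp_map_eq[OF Erel[OF that]])
  have Tc: "T v c = v" "T v \<in> tangent_space A p" for v
    using c by (simp_all add: T_def coords_of_coords of_coords_tangent)
  have cS: "coords b ` S = dtr c b x0 ` Bd" if "b \<in> charts_at A p" for b
    using that by (auto simp: S_def T_def coords_def of_coords_eq x0_def image_image)
  have dtr_cb: "bounded_linear (dtr c b x0)" "\<And>v. dtr b c (cmap b p) (dtr c b x0 v) = v"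
    "\<And>v. dtr c b x0 (dtr b c (cmap b p) v) = v" if "b \<in> charts_at A p" for b
    using that cA charts_atD[OF that] dtr_inverse[of c b p] dtr_inverse[of b c p] dtr_linear[of c b x0] in_overlap[of p c b]
    by (auto simp: x0_def)
  \<comment> \<open>\<open>E\<close> differs from the identity by a map with Lipschitz constant
    \<open>1/2\<close>, which leaves the constants \<open>1/2\<close> and \<open>3/2\<close>, the
    latter rounded up to \<open>2\<close>.\<close>
  have Edist: "norm (v - w) / 2 \<le> norm (E v - E w)" "norm (E v - E w) \<le> 2 * norm (v - w)"
    if "norm v \<le> \<rho>" "norm w \<le> \<rho>" for v w
    using Elip[OF that] norm_triangle_ineq2[of "v - w" "E v - E w"] norm_triangle_ineq2[of "E v - E w" "v - w"]
      norm_ge_zero[of "v - w"] norm_minus_commute[of "E v - E w" "v - w"] by linarith+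
  have Einj: "inj_on E Bd"
  proof (rule inj_onI)
    fix v w assume vw: "v \<in> Bd" "w \<in> Bd" "E v = E w"
    show "v = w" using Edist(1)[OF BdD(2)[OF vw(1)] BdD(2)[OF vw(2)]] vw(3) by simp
  qed
  have Elips: "2-lipschitz_on (cball 0 \<rho>) E"
    using Edist(2) by (intro lipschitz_onI) (auto simp: dist_norm)
  have Bdsub: "Bd \<subseteq> cball 0 \<rho>" using \<delta> by (auto simp: Bd_def)
  have Econt: "continuous_on Bd E"
    using lipschitz_on_continuous_on[OF Elips] Bdsub continuous_on_subset by blast
  \<comment> \<open>Invariance of domain yields openness from continuity and injectivity, without
    any derivative of \<open>E\<close>.\<close>
  have oEB: "open (E ` Bd)" by (rule invariance_of_domain[OF Econt oBd Einj])
  have E\<epsilon>: "E v \<in> cball x0 \<epsilon>" if "v \<in> Bd" for v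
    using Eb[OF BdD(2)[OF that]] BdD(1)[OF that] \<delta>(3) by (auto simp: dist_norm norm_minus_commute)
  have EBc: "E ` Bd \<subseteq> cran c" using Eb BdD by blast
  have Ueq: "U = cinv c ` E ` Bd" by (simp add: U_def image_image)
  have UW: "U \<subseteq> W"
  proof
    fix q assume "q \<in> U"
    then obtain v where v: "v \<in> Bd" "q = cinv c (E v)" by (auto simp: U_def)
    then obtain q' where "q' \<in> cdom c \<inter> W" "E v = cmap c q'" using E\<epsilon>[OF v(1)] \<epsilon>(2) by blast
    then show "q \<in> W" using v cinv_cmap[OF cA(1)] by auto
  qed
  have normal: "normal_neighbourhood A g p S U"
    unfolding normal_neighbourhood_def
  proof (intro conjI)
    show "open U" unfolding Ueq by (rule open_cinv_image[OF cA(1) oEB EBc])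
    have "E 0 = x0" using Eb[of 0] \<rho> by simp
    then show "p \<in> U" unfolding U_def
      using \<delta>(1) cinv_cmap[OF cA] by (intro image_eqI[of _ _ 0]) (simp_all add: x0_def Bd_def)
    show "topen A p S" unfolding topen_def
    proof (intro conjI ballI)
      show "S \<subseteq> tangent_space A p" using Tc by (auto simp: S_def)
      fix b assume b: "b \<in> charts_at A p"
      show "open (coords b ` S)" unfolding cS[OF b]
        using open_surjective_linear_image[OF oBd bounded_linear.linear[OF dtr_cb(1)[OF b]]] dtr_cb(3)[OF b]
        by (metis surjI)
    qed
    show "star_shaped_0 S" unfolding star_shaped_0_def
    proof (intro conjI ballI)
      show "tzero \<in> S" unfolding S_def T_def of_coords_zero[OF c, symmetric] using \<delta> by (simp add: Bd_def)
      fix x t assume x: "x \<in> S" and t: "t \<in> {0..1::real}"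
      obtain v where v: "v \<in> Bd" "x = T v" using x by (auto simp: S_def)
      have "norm (t *\<^sub>R v) \<le> norm v" using t by (simp add: mult_left_le_one_le)
      then have "t *\<^sub>R v \<in> Bd" using BdD(1)[OF v(1)] unfolding Bd_def mem_ball_0 by (rule order.strict_trans1)
      then show "tscale t x \<in> S" unfolding S_def v(2) T_def of_coords_scale[OF c, symmetric] by (rule imageI)
    qed
    show "S \<subseteq> exp_dom A g p"
    proof
      fix x assume "x \<in> S"
      then obtain v where "v \<in> Bd" "x = T v" by (auto simp: S_def)
      then show "x \<in> exp_dom A g p" using Erel[OF BdD(2)] Tc(2) unfolding exp_dom_def T_def by blast
    qed
    \<comment> \<open>The compact set comes from the closed ball of radius
      \<open>\<epsilon>\<close>, which lies in the chart image and contains the image of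
      \<open>Bd\<close>.\<close>
    define K where "K = cinv c ` cball x0 \<epsilon>"
    define h where "h = inv_into Bd E \<circ> cmap c"
    have \<epsilon>c: "cball x0 \<epsilon> \<subseteq> cran c" using \<epsilon>(2) by blast
    have hE: "inv_into Bd E (E v) = v" if "v \<in> Bd" for v using Einj that by simp
    have cE: "cmap c (cinv c (E v)) = E v" if "v \<in> Bd" for v
      using EBc that cmap_cinv[OF cA(1)] by blast
    have cU: "cmap c ` U = E ` Bd" using cE by (auto simp: U_def image_image)
    have Elipinv: "2-lipschitz_on (E ` Bd) (inv_into Bd E)"
    proof (rule lipschitz_onI)
      fix x y assume "x \<in> E ` Bd" "y \<in> E ` Bd"
      then obtain v w where vw: "v \<in> Bd" "w \<in> Bd" "x = E v" "y = E w" by blast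
      show "dist (inv_into Bd E x) (inv_into Bd E y) \<le> 2 * dist x y"
        using Edist(1)[OF BdD(2)[OF vw(1)] BdD(2)[OF vw(2)]] vw hE by (simp add: dist_norm)
    qed simp
    have Ucdom: "U \<subseteq> cdom c" using EBc cinv_in[OF cA(1)] by (auto simp: U_def)
    have hom: "homeomorphism Bd U (e \<circ> T) h"
      unfolding homeomorphism_def
    proof (intro conjI ballI)
      show im: "(e \<circ> T) ` Bd = U" using eT BdD(2) by (auto simp: U_def intro!: image_eqI)
      show hU: "h ` U = Bd" using hE cE by (force simp: h_def U_def image_image)
      show "h ((e \<circ> T) v) = v" if "v \<in> Bd" for v using that eT[OF BdD(2)[OF that]] by (simp add: h_def hE cE)
      show "(e \<circ> T) (h q) = q" if q: "q \<in> U" for q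
      proof -
        obtain v where v: "v \<in> Bd" "q = cinv c (E v)" using q by (auto simp: U_def)
        then show ?thesis using eT[OF BdD(2)[OF v(1)]] by (simp add: h_def hE cE)
      qed
      have "continuous_on Bd (\<lambda>v. cinv c (E v))"
        by (rule continuous_on_compose2[OF continuous_cinv[OF cA(1)] Econt EBc])
      then show "continuous_on Bd (e \<circ> T)"
        by (rule continuous_on_eq) (simp add: eT BdD)
      show "continuous_on U h" unfolding h_def
        by (rule continuous_on_compose[OF continuous_on_subset[OF continuous_cmap[OF cA(1)] Ucdom]])
           (simp add: cU lipschitz_on_continuous_on[OF Elipinv])
    qed
    have "coords c ` S = Bd" using Tc(1) by (auto simp: S_def coords_def image_image)
    moreover have "2-lipschitz_on Bd (cmap c \<circ> (e \<circ> T))"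
      by (rule lipschitz_on_transform[OF lipschitz_on_subset[OF Elips Bdsub]]) (simp add: eT BdD cE)
    moreover have "2-lipschitz_on (cmap c ` U) (h \<circ> cinv c)" unfolding cU
      by (rule lipschitz_on_transform[OF Elipinv]) (auto simp: h_def cE)
    moreover have "compact K" unfolding K_def
      by (rule compact_continuous_image[OF continuous_on_subset[OF continuous_cinv[OF cA(1)] \<epsilon>c] compact_cball])
    moreover have "U \<subseteq> K" unfolding U_def K_def using E\<epsilon> by blast
    moreover have "K \<subseteq> cdom c" unfolding K_def using \<epsilon>c cinv_in[OF cA(1)] by blast
    ultimately show "bi_lipschitz_homeomorphism A p S U (exp_map A g p)"
      unfolding bi_lipschitz_homeomorphism_def e_def[symmetric] using hom c cA(1) unfolding T_def by metis
  qed
  define bad where "bad = {v \<in> Bd. \<not> E differentiable (at v)}"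
  have negbad: "negligible bad"
  proof -
    \<comment> \<open>The estimates for \<open>E\<close> hold near \<open>0\<close> only. Composing
      it with the projection onto a closed ball gives a map that is Lipschitz everywhere and agrees
      with \<open>E\<close> on \<open>Bd\<close>.\<close>
    define Q where "Q = closest_point (cball (0::real^'n) \<delta>)"
    have Qin: "Q v \<in> cball 0 \<rho>" for v
      using closest_point_in_set[of "cball (0::real^'n) \<delta>" v] \<delta> by (auto simp: Q_def)
    have "1-lipschitz_on UNIV Q"
      unfolding Q_def using \<delta> by (intro lipschitz_onI) (auto intro!: closest_point_lipschitz)
    then have "(2 * 1)-lipschitz_on UNIV (E \<circ> Q)"
      by (rule lipschitz_on_compose) (rule lipschitz_on_subset[OF Elips], use Qin in blast)
    then have "negligible {v. \<not> (E \<circ> Q) differentiable (at v)}" by (rule Rademacher)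
    moreover have "E differentiable (at v)" if v: "v \<in> Bd" "(E \<circ> Q) differentiable (at v)" for v
    proof -
      obtain D where "((E \<circ> Q) has_derivative D) (at v)" using v(2) by (auto simp: differentiable_def)
      then have "(E has_derivative D) (at v)"
        by (rule has_derivative_transform_within_open[OF _ oBd v(1)])
           (simp add: Q_def closest_point_self Bd_def)
      then show ?thesis by (auto simp: differentiable_def)
    qed
    ultimately show ?thesis unfolding bad_def by (auto elim!: negligible_subset)
  qed
  define P where "P = (\<lambda>x. \<exists>D. has_differential A p e D x \<and>
    (\<forall>v\<in>tangent_space A p. \<forall>w\<in>tangent_space A p. radial x v \<longrightarrow> g (e x) (D v) (D w) = g p v w))"
  have good: "P (T v)"
    if v: "v \<in> Bd" "E differentiable (at v)" for v
  proof -
    obtain E' where E': "(E has_derivative E') (at v)" using v(2) by (auto simp: differentiable_def)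
    interpret E': bounded_linear E' by (rule has_derivative_bounded_linear[OF E'])
    have v\<rho>: "norm v < \<rho>" using BdD(1)[OF v(1)] \<delta>(2) by linarith
    have gv: "E' v = V v" "\<And>w. mform (Gm c (E v)) (V v) (E' w) = mform (Gm c x0) v w"
      using gauss_in_chart[OF v\<rho> Egauss[OF less_imp_le[OF v\<rho>]] Eray[OF less_imp_le[OF v\<rho>]] E'] by blast+
    define q where "q = e (T v)"
    have qE: "q = cinv c (E v)" by (simp add: q_def eT[OF BdD(2)[OF v(1)]])
    have q: "c \<in> charts_at A q" "cmap c q = E v"
      unfolding qE using cran_charts_at[OF cA(1)] EBc v(1) by blast+
    \<comment> \<open>The derivative of \<open>E\<close>, transported to the tangent spaces at
      \<open>p\<close> and at \<open>q\<close> by the coordinates of the one chart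
      \<open>c\<close>.\<close>
    define D where "D = (\<lambda>a. of_coords A c q (E' (a c)))"
    have "has_differential A p e D (T v)"
      unfolding has_differential_def q_def[symmetric]
    proof (intro conjI ballI)
      show "D a \<in> tangent_space A q" for a unfolding D_def by (rule of_coords_tangent[OF q(1)])
      fix b d assume b: "b \<in> charts_at A p" and d: "d \<in> charts_at A q"
      \<comment> \<open>The linear change of coordinates on the tangent space at \<open>p\<close>
        from \<open>b\<close> to \<open>c\<close>. In the charts \<open>b\<close> and
        \<open>d\<close> the exponential map is \<open>E\<close> between \<open>\<beta>\<close> and
        a transition map, and the chain rule applies.\<close>
      define \<beta> where "\<beta> = dtr b c (cmap b p)"
      have \<beta>: "bounded_linear \<beta>"
        unfolding \<beta>_def using b c charts_atD by (intro dtr_linear in_overlap) auto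
      define y0 where "y0 = coords b (T v)"
      have \<beta>y0: "\<beta> y0 = v"
        using dtr_cb(2)[OF b, of v] b by (simp add: \<beta>_def y0_def coords_def T_def of_coords_eq x0_def)
      have bT: "of_coords A b p y = T (\<beta> y)" for y
        unfolding T_def \<beta>_def by (rule of_coords_change[OF b c])
      have "E v \<in> overlap c d" using in_overlap[of q c d] q d charts_atD by auto
      then have tr: "(transition c d has_derivative dtr c d (E v)) (at (E v))"
        using d charts_atD by (intro transition_deriv cA) auto
      have "(\<beta> has_derivative \<beta>) (at y0)" by (rule bounded_linear_imp_has_derivative[OF \<beta>])
      from has_derivative_compose[OF this, of E E'] have "((\<lambda>y. E (\<beta> y)) has_derivative (\<lambda>y. E' (\<beta> y))) (at y0)"
        using E' by (simp add: \<beta>y0)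
      from has_derivative_compose[OF this, of "transition c d" "dtr c d (E v)"]
      have main: "((\<lambda>y. transition c d (E (\<beta> y))) has_derivative (\<lambda>y. dtr c d (E v) (E' (\<beta> y)))) (at y0)"
        using tr by (simp add: \<beta>y0)
      have "((cmap d \<circ> e \<circ> of_coords A b p) has_derivative (\<lambda>y. dtr c d (E v) (E' (\<beta> y)))) (at y0)"
      proof (rule has_derivative_transform_within_open[OF main, where s="\<beta> -` Bd"])
        show "open (\<beta> -` Bd)"
          by (rule open_vimage[OF oBd linear_continuous_on[OF \<beta>]])
        show "y0 \<in> \<beta> -` Bd" using \<beta>y0 v(1) by simp
        show "transition c d (E (\<beta> y)) = (cmap d \<circ> e \<circ> of_coords A b p) y" if "y \<in> \<beta> -` Bd" for y
          using eT[OF BdD(2)] that by (simp add: bT transition_def)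
      qed
      moreover have "coords d \<circ> D \<circ> of_coords A b p = (\<lambda>y. dtr c d (E v) (E' (\<beta> y)))"
        using d by (simp add: fun_eq_iff coords_def D_def bT Tc of_coords_eq[of c q] q(2))
      ultimately show "((cmap d \<circ> e \<circ> of_coords A b p) has_derivative (coords d \<circ> D \<circ> of_coords A b p)) (at (coords b (T v)))"
        by (simp add: y0_def)
    qed
    moreover have "g q (D a) (D w) = g p a w"
      if a: "a \<in> tangent_space A p" and w: "w \<in> tangent_space A p" and rad: "radial (T v) a" for a w
    proof -
      \<comment> \<open>Homogeneity reduces a radial vector to the case of \<open>v\<close> itself,
        where \<open>E' v = V v\<close> makes \<open>gauss_in_chart\<close> applicable.\<close>
      obtain k where "a = tscale k (T v)" using rad unfolding radial_def by blast
      then have k: "a c = k *\<^sub>R v" by (simp add: tscale_def Tc(1))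
      have "g q (D a) (D w) = mform (Gm c (E v)) (E' (a c)) (E' (w c))"
        unfolding D_def mform_metric[OF q(1), symmetric] q(2) ..
      also have "\<dots> = k * mform (Gm c x0) v (w c)"
        by (simp add: k E'.scaleR gv mform_linear)
      also have "\<dots> = mform (Gm c x0) (a c) (w c)" by (simp add: k mform_linear)
      also have "\<dots> = g p a w"
        unfolding x0_def mform_metric[OF c] by (simp add: of_coords_coords[OF a c] of_coords_coords[OF w c])
      finally show ?thesis .
    qed
    ultimately show ?thesis unfolding P_def q_def by blast
  qed
  have "talmost_all A p S P"
    unfolding talmost_all_def
  proof
    fix b assume b: "b \<in> charts_at A p"
    \<comment> \<open>In any chart \<open>b\<close> the exceptional points lie in a linear image of
      the null set \<open>bad\<close>.\<close>
    have "coords b ` {x \<in> S. \<not> P x} \<subseteq> dtr c b x0 ` bad"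
    proof
      fix y assume "y \<in> coords b ` {x \<in> S. \<not> P x}"
      then obtain x where x: "x \<in> S" "\<not> P x" "y = coords b x" by blast
      then obtain v where v: "v \<in> Bd" "x = T v" by (auto simp: S_def)
      then have "v \<in> bad" using good[of v] x(2) unfolding bad_def by blast
      moreover have "y = dtr c b x0 v" using v x(3) b by (simp add: T_def coords_def of_coords_eq x0_def)
      ultimately show "y \<in> dtr c b x0 ` bad" by blast
    qed
    moreover have "negligible (dtr c b x0 ` bad)"
      using negbad linear_imp_differentiable_on[OF bounded_linear.linear[OF dtr_cb(1)[OF b]]]
      by (intro negligible_differentiable_image_negligible) auto
    ultimately show "negligible (coords b ` {x \<in> S. \<not> P x})" by (rule negligible_subset[rotated])
  qed
  then show ?thesis using UW normal unfolding P_def e_def by blast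
qed

end

theorem theorem2p7:
  fixes A :: "('m::{t2_space, second_countable_topology}, real^'n) chart set"
    and g :: "('m, real^'n) metric_field"
    and p :: 'm
  assumes "smooth_atlas A"
    and "C11_pseudo_riemannian_metric A g"
  shows "\<forall>W. open W \<and> p \<in> W \<longrightarrow>
    (\<exists>U S. U \<subseteq> W \<and> normal_neighbourhood A g p S U \<and>
      talmost_all A p S (\<lambda>x. \<exists>D. has_differential A p (exp_map A g p) D x \<and>
        (\<forall>v\<in>tangent_space A p. \<forall>w\<in>tangent_space A p. radial x v \<longrightarrow>
          g (exp_map A g p x) (D v) (D w) = g p v w)))"
proof -
  interpret pseudo_riemannian A g by unfold_locales (fact assms)+
  show ?thesis using gauss_lemma by blast
qed

end
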